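(* Let $(R,\mathfrak{m})$ be a Noetherian local ring of equal characteristic $p>0$. Suppose that $R$ is $F$-injective and that the local cohomology module $H_{\mathfrak{m}}^i(R)$ has finite length for each $i<\dim R$. Then $R$ is a Buchsbaum ring.
   Context: $R$ contains a field of characteristic $p>0$. The Frobenius endomorphism $r\mapsto r^p$ of $R$ induces a natural Frobenius action on each local cohomology module $H_{\mathfrak{m}}^i(R)$; $R$ is called $F$-injective if this action is injective on $H_{\mathfrak{m}}^i(R)$ for every $i$. A Noetherian local ring $(R,\mathfrak{m})$ of dimension $n$ is called Buchsbaum if for every system of parameters $x_1,\dots,x_n$ of $R$ and every $1\le i\le n$ one has $(x_1,\dots,x_{i-1}):x_i=(x_1,\dots,x_{i-1}):\mathfrak{m}$. *)

theory Defs
  imports "HOL-Algebra.Algebra" "HOL-Library.Extended_Nat" "HOL-Library.FuncSet"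
begin

section \<open>Noetherian local rings, dimension, systems of parameters\<close>

locale noetherian_local_ring = cring R + noetherian_ring R for R (structure) +
  fixes \<mm>
  assumes maximal: "maximalideal \<mm> R"
    and unique_maximal: "maximalideal I R \<Longrightarrow> I = \<mm>"

text \<open>The defining condition on \<open>n\<close> says that \<open>p\<close> generates the kernel of the map from the
  integers to the field \<open>K\<close>; \<open>\<one>\<close> and \<open>\<zero>\<close> of a subfield are those of the ring.\<close>

definition contains_field_of_char :: "('a, 'c) ring_scheme \<Rightarrow> nat \<Rightarrow> bool" where
  "contains_field_of_char R p \<longleftrightarrow>
     (\<exists>K. subfield K R \<and> (\<forall>n::nat. [n] \<cdot>\<^bsub>R\<^esub> \<one>\<^bsub>R\<^esub> = \<zero>\<^bsub>R\<^esub> \<longleftrightarrow> p dvd n))"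

definition krull_dim :: "('a, 'c) ring_scheme \<Rightarrow> enat" where
  "krull_dim R = Sup {enat n | n. \<exists>P :: nat \<Rightarrow> 'a set.
     (\<forall>i\<le>n. primeideal (P i) R) \<and> (\<forall>i<n. P i \<subset> P (Suc i))}"

definition radical :: "('a, 'c) ring_scheme \<Rightarrow> 'a set \<Rightarrow> 'a set" where
  "radical R I = {a \<in> carrier R. \<exists>n::nat. a [^]\<^bsub>R\<^esub> n \<in> I}"

text \<open>In a local ring with maximal ideal \<open>\<mm>\<close>, an ideal is \<open>\<mm>\<close>-primary iff its radical is \<open>\<mm>\<close>.\<close>

definition system_of_parameters :: "('a, 'c) ring_scheme \<Rightarrow> 'a set \<Rightarrow> 'a list \<Rightarrow> bool" where
  "system_of_parameters R \<mm> xs \<longleftrightarrow>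
     set xs \<subseteq> \<mm> \<and> enat (length xs) = krull_dim R \<and> radical R (Idl\<^bsub>R\<^esub> (set xs)) = \<mm>"

definition colon :: "('a, 'c) ring_scheme \<Rightarrow> 'a set \<Rightarrow> 'a set \<Rightarrow> 'a set" where
  "colon R I J = {r \<in> carrier R. \<forall>x\<in>J. r \<otimes>\<^bsub>R\<^esub> x \<in> I}"

text \<open>Lists are indexed from 0: \<open>take i xs\<close> is \<open>x\<^sub>1, \<dots>, x\<^sub>i\<close> and \<open>xs ! i\<close> is the next parameter.\<close>

definition buchsbaum_ring :: "('a, 'c) ring_scheme \<Rightarrow> 'a set \<Rightarrow> bool" where
  "buchsbaum_ring R \<mm> \<longleftrightarrow> noetherian_local_ring R \<mm> \<and>
     (\<forall>xs. system_of_parameters R \<mm> xs \<longrightarrow>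
        (\<forall>i<length xs. colon R (Idl\<^bsub>R\<^esub> (set (take i xs))) {xs ! i}
                      = colon R (Idl\<^bsub>R\<^esub> (set (take i xs))) \<mm>))"


section \<open>Modules: quotients and finite length\<close>

text \<open>Modules are records extending rings; in the modules below that carry no ring structure the
  ring multiplication and unit are left undefined.\<close>

definition quotient_module :: "('a, 'b, 'd) module_scheme \<Rightarrow> 'b set \<Rightarrow> ('a, 'b set) module" where
  "quotient_module M N =
     \<lparr>carrier = a_rcosets\<^bsub>M\<^esub> N, monoid.mult = undefined, monoid.one = undefined,
      ring.zero = N, ring.add = set_add M,
      smult = (\<lambda>r A. \<Union>x\<in>A. N +>\<^bsub>M\<^esub> (r \<odot>\<^bsub>M\<^esub> x))\<rparr>"

text \<open>Finite length: existence of a composition series.\<close>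

definition finite_length :: "('a, 'c) ring_scheme \<Rightarrow> ('a, 'b, 'd) module_scheme \<Rightarrow> bool" where
  "finite_length R M \<longleftrightarrow> (\<exists>(n::nat) N. N 0 = {\<zero>\<^bsub>M\<^esub>} \<and> N n = carrier M \<and>
     (\<forall>i\<le>n. submodule (N i) R M) \<and>
     (\<forall>i<n. N i \<subset> N (Suc i) \<and> \<not> (\<exists>L. submodule L R M \<and> N i \<subset> L \<and> L \<subset> N (Suc i))))"


section \<open>Localization\<close>

definition loc_rel :: "('a, 'c) ring_scheme \<Rightarrow> 'a set \<Rightarrow> (('a \<times> 'a) \<times> ('a \<times> 'a)) set" where
  "loc_rel R S = {((a, s), (b, t)). a \<in> carrier R \<and> s \<in> S \<and> b \<in> carrier R \<and> t \<in> S \<and>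
     (\<exists>u\<in>S. u \<otimes>\<^bsub>R\<^esub> (a \<otimes>\<^bsub>R\<^esub> t) = u \<otimes>\<^bsub>R\<^esub> (b \<otimes>\<^bsub>R\<^esub> s))}"

definition fraction :: "('a, 'c) ring_scheme \<Rightarrow> 'a set \<Rightarrow> 'a \<Rightarrow> 'a \<Rightarrow> ('a \<times> 'a) set" where
  "fraction R S a s = loc_rel R S `` {(a, s)}"

text \<open>The \<open>R\<close>-algebra \<open>S\<inverse>R\<close>, for a multiplicative submonoid \<open>S\<close>. Operations are given on
  representatives; the unions are over equal sets.\<close>

definition localization ::
  "('a, 'c) ring_scheme \<Rightarrow> 'a set \<Rightarrow> ('a, ('a \<times> 'a) set) module" where
  "localization R S =
     \<lparr>carrier = (carrier R \<times> S) // loc_rel R S,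
      monoid.mult = (\<lambda>A B. \<Union>(a, s)\<in>A. \<Union>(b, t)\<in>B. fraction R S (a \<otimes>\<^bsub>R\<^esub> b) (s \<otimes>\<^bsub>R\<^esub> t)),
      monoid.one = fraction R S \<one>\<^bsub>R\<^esub> \<one>\<^bsub>R\<^esub>,
      ring.zero = fraction R S \<zero>\<^bsub>R\<^esub> \<one>\<^bsub>R\<^esub>,
      ring.add = (\<lambda>A B. \<Union>(a, s)\<in>A. \<Union>(b, t)\<in>B.
               fraction R S (a \<otimes>\<^bsub>R\<^esub> t \<oplus>\<^bsub>R\<^esub> b \<otimes>\<^bsub>R\<^esub> s) (s \<otimes>\<^bsub>R\<^esub> t)),
      smult = (\<lambda>r A. \<Union>(a, s)\<in>A. fraction R S (r \<otimes>\<^bsub>R\<^esub> a) s)\<rparr>"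

definition powers :: "('a, 'c) ring_scheme \<Rightarrow> 'a \<Rightarrow> 'a set" where
  "powers R f = {f [^]\<^bsub>R\<^esub> n | n::nat. True}"

text \<open>The canonical map \<open>R\<^sub>f \<rightarrow> R\<^bsub>fg\<^esub>\<close>, \<open>a/f\<^sup>n \<mapsto> ag\<^sup>n/(fg)\<^sup>n\<close>.\<close>

definition loc_map ::
  "('a, 'c) ring_scheme \<Rightarrow> 'a \<Rightarrow> 'a \<Rightarrow> ('a \<times> 'a) set \<Rightarrow> ('a \<times> 'a) set" where
  "loc_map R f g A =
     \<Union>{fraction R (powers R (f \<otimes>\<^bsub>R\<^esub> g)) (a \<otimes>\<^bsub>R\<^esub> g [^]\<^bsub>R\<^esub> n) ((f \<otimes>\<^bsub>R\<^esub> g) [^]\<^bsub>R\<^esub> n)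
        | a (n::nat). (a, f [^]\<^bsub>R\<^esub> n) \<in> A}"


section \<open>Local cohomology via the Cech complex\<close>

text \<open>For \<open>xs = [x\<^sub>0, \<dots>, x\<^bsub>k-1\<^esub>]\<close>, the \<open>j\<close>-th Cech module is the direct sum of the localizations
  of \<open>R\<close> at \<open>\<Prod>\<^bsub>l\<in>J\<^esub> x\<^sub>l\<close> over the \<open>j\<close>-element subsets \<open>J\<close> of the index set. Cochains are
  extensional functions on the set of these \<open>J\<close>.\<close>

definition cech_index :: "'a list \<Rightarrow> nat \<Rightarrow> nat set set" where
  "cech_index xs j = {J. J \<subseteq> {..<length xs} \<and> card J = j}"

definition cech_elem :: "('a, 'c) ring_scheme \<Rightarrow> 'a list \<Rightarrow> nat set \<Rightarrow> 'a" where
  "cech_elem R xs J = (\<Otimes>\<^bsub>R\<^esub> l\<in>J. xs ! l)"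

definition cech_loc ::
  "('a, 'c) ring_scheme \<Rightarrow> 'a list \<Rightarrow> nat set \<Rightarrow> ('a, ('a \<times> 'a) set) module" where
  "cech_loc R xs J = localization R (powers R (cech_elem R xs J))"

definition cech_module ::
  "('a, 'c) ring_scheme \<Rightarrow> 'a list \<Rightarrow> nat \<Rightarrow> ('a, nat set \<Rightarrow> ('a \<times> 'a) set) module" where
  "cech_module R xs j =
     \<lparr>carrier = (\<Pi>\<^sub>E J\<in>cech_index xs j. carrier (cech_loc R xs J)),
      monoid.mult = undefined, monoid.one = undefined,
      ring.zero = (\<lambda>J\<in>cech_index xs j. \<zero>\<^bsub>cech_loc R xs J\<^esub>),
      ring.add = (\<lambda>c d. \<lambda>J\<in>cech_index xs j. c J \<oplus>\<^bsub>cech_loc R xs J\<^esub> d J),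
      smult = (\<lambda>r c. \<lambda>J\<in>cech_index xs j. r \<odot>\<^bsub>cech_loc R xs J\<^esub> c J)\<rparr>"

definition cech_diff ::
  "('a, 'c) ring_scheme \<Rightarrow> 'a list \<Rightarrow> nat \<Rightarrow>
     (nat set \<Rightarrow> ('a \<times> 'a) set) \<Rightarrow> (nat set \<Rightarrow> ('a \<times> 'a) set)" where
  "cech_diff R xs j c = (\<lambda>J\<in>cech_index xs (Suc j).
     \<Oplus>\<^bsub>cech_loc R xs J\<^esub> l\<in>J.
       (let y = loc_map R (cech_elem R xs (J - {l})) (xs ! l) (c (J - {l}))
        in if even (card {m\<in>J. m < l}) then y else \<ominus>\<^bsub>cech_loc R xs J\<^esub> y))"

definition cech_cocycles ::
  "('a, 'c) ring_scheme \<Rightarrow> 'a list \<Rightarrow> nat \<Rightarrow> (nat set \<Rightarrow> ('a \<times> 'a) set) set" where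
  "cech_cocycles R xs j =
     {c \<in> carrier (cech_module R xs j). cech_diff R xs j c = \<zero>\<^bsub>cech_module R xs (Suc j)\<^esub>}"

definition cech_coboundaries ::
  "('a, 'c) ring_scheme \<Rightarrow> 'a list \<Rightarrow> nat \<Rightarrow> (nat set \<Rightarrow> ('a \<times> 'a) set) set" where
  "cech_coboundaries R xs j =
     (case j of 0 \<Rightarrow> {\<zero>\<^bsub>cech_module R xs 0\<^esub>}
      | Suc i \<Rightarrow> cech_diff R xs i ` carrier (cech_module R xs i))"

definition cech_cohomology ::
  "('a, 'c) ring_scheme \<Rightarrow> 'a list \<Rightarrow> nat \<Rightarrow> ('a, (nat set \<Rightarrow> ('a \<times> 'a) set) set) module" where
  "cech_cohomology R xs j =
     quotient_module ((cech_module R xs j)\<lparr>carrier := cech_cocycles R xs j\<rparr>)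
       (cech_coboundaries R xs j)"

text \<open>The Frobenius endomorphism of each localization acts on cochains componentwise, commutes with
  the differential, and so acts on cohomology classes (cosets of the coboundaries). Here \<open>p\<close> is the
  characteristic.\<close>

definition cech_frobenius ::
  "('a, 'c) ring_scheme \<Rightarrow> nat \<Rightarrow> 'a list \<Rightarrow> nat \<Rightarrow>
     (nat set \<Rightarrow> ('a \<times> 'a) set) \<Rightarrow> (nat set \<Rightarrow> ('a \<times> 'a) set)" where
  "cech_frobenius R p xs j c = (\<lambda>J\<in>cech_index xs j. c J [^]\<^bsub>cech_loc R xs J\<^esub> p)"

definition cohomology_frobenius ::
  "('a, 'c) ring_scheme \<Rightarrow> nat \<Rightarrow> 'a list \<Rightarrow> nat \<Rightarrow>
     (nat set \<Rightarrow> ('a \<times> 'a) set) set \<Rightarrow> (nat set \<Rightarrow> ('a \<times> 'a) set) set" where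
  "cohomology_frobenius R p xs j A =
     (\<Union>c\<in>A. cech_coboundaries R xs j +>\<^bsub>cech_module R xs j\<^esub> cech_frobenius R p xs j c)"

text \<open>Local cohomology with support in a finitely generated ideal \<open>I\<close>. Up to an isomorphism
  compatible with Frobenius it does not depend on the choice of generators, so one system of
  generators is fixed for each ideal.\<close>

definition ideal_gens :: "('a, 'c) ring_scheme \<Rightarrow> 'a set \<Rightarrow> 'a list" where
  "ideal_gens R I = (SOME xs. set xs \<subseteq> carrier R \<and> Idl\<^bsub>R\<^esub> (set xs) = I)"

definition local_cohomology ::
  "('a, 'c) ring_scheme \<Rightarrow> 'a set \<Rightarrow> nat \<Rightarrow> ('a, (nat set \<Rightarrow> ('a \<times> 'a) set) set) module" where
  "local_cohomology R I i = cech_cohomology R (ideal_gens R I) i"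

definition local_cohomology_frobenius ::
  "('a, 'c) ring_scheme \<Rightarrow> nat \<Rightarrow> 'a set \<Rightarrow> nat \<Rightarrow>
     (nat set \<Rightarrow> ('a \<times> 'a) set) set \<Rightarrow> (nat set \<Rightarrow> ('a \<times> 'a) set) set" where
  "local_cohomology_frobenius R p I i = cohomology_frobenius R p (ideal_gens R I) i"

definition F_injective :: "('a, 'c) ring_scheme \<Rightarrow> 'a set \<Rightarrow> nat \<Rightarrow> bool" where
  "F_injective R \<mm> p \<longleftrightarrow>
     (\<forall>i. inj_on (local_cohomology_frobenius R p \<mm> i) (carrier (local_cohomology R \<mm> i)))"

end

theory Submission
  imports Defs
begin

text \<open>By F-injectivity, an element of \<open>\<mm>\<close> some power of which kills \<open>H\<^sup>j\<^sub>\<mm>(R)\<close> kills it already, so finite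
  length gives \<open>\<mm> H\<^sup>j\<^sub>\<mm>(R) = 0\<close> for \<open>j < dim R\<close>. Let \<open>C\<close> be the Cech complex of \<open>\<mm>\<close> and \<open>K(xs; C)\<close> the
  iterated cone of the multiplications by the members of \<open>xs\<close>. The Frobenius maps \<open>K(xs; C)\<close> to
  \<open>K(xs\<^sup>p; C)\<close>, and induction on the length of \<open>xs\<close> shows both that it is injective on \<open>H\<^sup>j\<close> for
  \<open>j \<le> dim R\<close> and that \<open>\<mm>\<close> kills \<open>H\<^sup>j(K(xs; C))\<close> for \<open>j < dim R\<close>: as \<open>x\<^sup>p\<close> is zero on cohomology, the long
  exact sequences of the cones break up into short ones, which give injectivity; they also give
  \<open>\<mm>\<^sup>2 H\<^sup>j = 0\<close>, and then \<open>\<mm> H\<^sup>j = 0\<close> because \<open>y\<^sup>p F(u)\<close> is a coboundary only if \<open>y u\<close> is one.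

  If \<open>xs\<close> is a system of parameters then \<open>K(xs; -)\<close> is exact on the terms of \<open>C\<close> in positive degrees,
  so every Koszul cocycle over \<open>R\<close> lifts to \<open>K(xs; C)\<close>. Hence \<open>\<mm>\<close> kills \<open>H\<close> of \<open>K(xs; R)\<close> in degree
  \<open>dim R - 1\<close>, which is the colon condition for the last parameter. For the others, replace the
  later parameters by high powers and apply Krull's intersection theorem to one of them at a time.\<close>

section \<open>Cones of cochain complexes\<close>

text \<open>The Cech complex stays on the generators of \<mm> that were fixed when local cohomology
  was defined. A system of parameters enters only as the list of a Koszul complex with coefficients
  in it, so local cohomology for two sets of generators is never compared. The positive terms of
  \<open>C\<close> are built from localizations \<open>R_f\<close> with \<open>f\<close> in \<mm>.
  As some power of \<open>f\<close> lies in the ideal of the parameters, 1 is a combination of them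
  in \<open>R_f\<close>, and its coefficients give a contracting homotopy. The obstacle is that
  these coefficients are chosen for each \<open>f\<close> separately and need not commute with the
  Cech differential. The homotopy is therefore correct only up to terms of higher Cech degree; a
  filtration by that degree, finite in every total degree, turns it into exactness. The two ranges
  of the induction fit together because injectivity on a cone in degree \<open>j\<close> uses the
  vanishing of \<open>x^p\<close> on cohomology in degree \<open>j - 1\<close> only. Degree
  \<open>dim R - 1\<close> is the one that matters, since a relation among \<open>dim R\<close>
  parameters with one of them singled out is a Koszul cochain of that degree.\<close>

definition additive_map :: "('a, 'm) ring_scheme \<Rightarrow> ('b, 'n) ring_scheme \<Rightarrow> ('a \<Rightarrow> 'b) \<Rightarrow> bool" where
  "additive_map M N f \<longleftrightarrow> f \<in> carrier M \<rightarrow> carrier N \<and>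
     (\<forall>u\<in>carrier M. \<forall>v\<in>carrier M. f (u \<oplus>\<^bsub>M\<^esub> v) = f u \<oplus>\<^bsub>N\<^esub> f v)"

definition linear_map :: "('a, 'c) ring_scheme \<Rightarrow> ('a, 'b, 'm) module_scheme \<Rightarrow>
    ('a, 'd, 'n) module_scheme \<Rightarrow> ('b \<Rightarrow> 'd) \<Rightarrow> bool" where
  "linear_map R M N f \<longleftrightarrow> additive_map M N f \<and>
     (\<forall>r\<in>carrier R. \<forall>u\<in>carrier M. f (r \<odot>\<^bsub>M\<^esub> u) = r \<odot>\<^bsub>N\<^esub> f u)"

context
  fixes M :: "('a, 'm) ring_scheme" and N :: "('b, 'n) ring_scheme" and f
  assumes M: "abelian_group M" and N: "abelian_group N" and f: "additive_map M N f"
begin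

interpretation M: abelian_group M by (fact M)
interpretation N: abelian_group N by (fact N)

lemma additive_map_zero: "f \<zero>\<^bsub>M\<^esub> = \<zero>\<^bsub>N\<^esub>"
proof -
  have "f \<zero>\<^bsub>M\<^esub> = f \<zero>\<^bsub>M\<^esub> \<oplus>\<^bsub>N\<^esub> f \<zero>\<^bsub>M\<^esub>" "f \<zero>\<^bsub>M\<^esub> \<in> carrier N"
    using f unfolding additive_map_def by (metis M.zero_closed M.r_zero, auto)
  then show ?thesis using N.add.l_cancel_one' by metis
qed

lemma additive_map_neg: "u \<in> carrier M \<Longrightarrow> f (\<ominus>\<^bsub>M\<^esub> u) = \<ominus>\<^bsub>N\<^esub> f u"
proof -
  assume u: "u \<in> carrier M"
  have "f (\<ominus>\<^bsub>M\<^esub> u) \<oplus>\<^bsub>N\<^esub> f u = \<zero>\<^bsub>N\<^esub>"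
    using f u unfolding additive_map_def
    by (metis M.a_inv_closed M.l_neg additive_map_zero)
  then show ?thesis using f u unfolding additive_map_def
    by (metis M.a_inv_closed N.minus_equality PiE)
qed

lemma additive_map_finsum:
  "finite A \<Longrightarrow> g \<in> A \<rightarrow> carrier M \<Longrightarrow>
     f (\<Oplus>\<^bsub>M\<^esub> i\<in>A. g i) = (\<Oplus>\<^bsub>N\<^esub> i\<in>A. f (g i))"
proof (induction A rule: finite_induct)
  case empty
  then show ?case by (simp add: additive_map_zero)
next
  case (insert x F)
  then have "(\<lambda>i. f (g i)) \<in> F \<rightarrow> carrier N" "f (g x) \<in> carrier N"
    "(\<Oplus>\<^bsub>M\<^esub> i\<in>F. g i) \<in> carrier M"
    using f unfolding additive_map_def by auto
  then show ?case using insert f by (simp add: additive_map_def)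
qed

end

text \<open>Pairs of functions on the naturals are interleaved into one function, so that cones can be
  iterated without changing the type.\<close>

definition join :: "(nat \<Rightarrow> 'b) \<Rightarrow> (nat \<Rightarrow> 'b) \<Rightarrow> nat \<Rightarrow> 'b" where
  "join a b = (\<lambda>n. if even n then a (n div 2) else b (n div 2))"

definition evens :: "(nat \<Rightarrow> 'b) \<Rightarrow> nat \<Rightarrow> 'b" where "evens u = (\<lambda>n. u (2 * n))"
definition odds :: "(nat \<Rightarrow> 'b) \<Rightarrow> nat \<Rightarrow> 'b" where "odds u = (\<lambda>n. u (Suc (2 * n)))"

lemma evens_join [simp]: "evens (join a b) = a"
  and odds_join [simp]: "odds (join a b) = b"
  and join_evens_odds [simp]: "join (evens u) (odds u) = u"
  by (auto simp: evens_def odds_def join_def fun_eq_iff)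

lemma join_eq_iff [simp]: "join a b = join a' b' \<longleftrightarrow> a = a' \<and> b = b'"
  by (metis evens_join odds_join)

lemma eq_join_iff: "u = join a b \<longleftrightarrow> evens u = a \<and> odds u = b"
  by (metis evens_join odds_join join_evens_odds)

text \<open>The mapping cone of a multiplication map, shifted by one; iterated over a module in
  degree 0 it gives the cohomological Koszul complex. The terms do not depend on the multiplier,
  which enters only through \<open>cone_diff\<close>, so cones on \<open>x\<close> and on
  \<open>x^p\<close> share them.\<close>

definition cone_module :: "(int \<Rightarrow> ('a, nat \<Rightarrow> 'b) module) \<Rightarrow> int \<Rightarrow> ('a, nat \<Rightarrow> 'b) module" where
  "cone_module M j =
     \<lparr>carrier = {u. evens u \<in> carrier (M j) \<and> odds u \<in> carrier (M (j - 1))},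
      monoid.mult = undefined, monoid.one = undefined,
      ring.zero = join \<zero>\<^bsub>M j\<^esub> \<zero>\<^bsub>M (j - 1)\<^esub>,
      ring.add = (\<lambda>u v. join (evens u \<oplus>\<^bsub>M j\<^esub> evens v) (odds u \<oplus>\<^bsub>M (j - 1)\<^esub> odds v)),
      smult = (\<lambda>r u. join (r \<odot>\<^bsub>M j\<^esub> evens u) (r \<odot>\<^bsub>M (j - 1)\<^esub> odds u))\<rparr>"

text \<open>The minus sign makes the square zero: for \<open>(a, b)\<close> the second component of
  the square is \<open>x (d a) - d (x a) + d (d b)\<close>.\<close>

definition cone_diff ::
  "(int \<Rightarrow> ('a, nat \<Rightarrow> 'b) module) \<Rightarrow> 'a \<Rightarrow> (int \<Rightarrow> (nat \<Rightarrow> 'b) \<Rightarrow> nat \<Rightarrow> 'b) \<Rightarrow>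
     int \<Rightarrow> (nat \<Rightarrow> 'b) \<Rightarrow> nat \<Rightarrow> 'b" where
  "cone_diff M x d j u =
     join (d j (evens u)) (x \<odot>\<^bsub>M j\<^esub> evens u \<ominus>\<^bsub>M j\<^esub> d (j - 1) (odds u))"

definition cone_map ::
  "(int \<Rightarrow> (nat \<Rightarrow> 'b) \<Rightarrow> nat \<Rightarrow> 'b) \<Rightarrow> int \<Rightarrow> (nat \<Rightarrow> 'b) \<Rightarrow> nat \<Rightarrow> 'b" where
  "cone_map f j u = join (f j (evens u)) (f (j - 1) (odds u))"

lemma cone_carrier: "u \<in> carrier (cone_module M j) \<longleftrightarrow>
    evens u \<in> carrier (M j) \<and> odds u \<in> carrier (M (j - 1))"
  by (simp add: cone_module_def)

lemma cone_zero: "\<zero>\<^bsub>cone_module M j\<^esub> = join \<zero>\<^bsub>M j\<^esub> \<zero>\<^bsub>M (j - 1)\<^esub>"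
  and cone_add: "u \<oplus>\<^bsub>cone_module M j\<^esub> v =
    join (evens u \<oplus>\<^bsub>M j\<^esub> evens v) (odds u \<oplus>\<^bsub>M (j - 1)\<^esub> odds v)"
  and cone_smult: "r \<odot>\<^bsub>cone_module M j\<^esub> u =
    join (r \<odot>\<^bsub>M j\<^esub> evens u) (r \<odot>\<^bsub>M (j - 1)\<^esub> odds u)"
  by (simp_all add: cone_module_def)

locale graded_module = cring R for R :: "('a, 'c) ring_scheme" (structure) +
  fixes M :: "int \<Rightarrow> ('a, 'b) module"
  assumes graded: "module R (M j)"
begin
sublocale M: module R "M j" for j by (rule graded)
end

lemma (in graded_module) linear_mapD:
  assumes "linear_map R (M i) (M j) f"
  shows "u \<in> carrier (M i) \<Longrightarrow> f u \<in> carrier (M j)"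
    and "f \<zero>\<^bsub>M i\<^esub> = \<zero>\<^bsub>M j\<^esub>"
    and "u \<in> carrier (M i) \<Longrightarrow> v \<in> carrier (M i) \<Longrightarrow> f (u \<oplus>\<^bsub>M i\<^esub> v) = f u \<oplus>\<^bsub>M j\<^esub> f v"
    and "r \<in> carrier R \<Longrightarrow> u \<in> carrier (M i) \<Longrightarrow> f (r \<odot>\<^bsub>M i\<^esub> u) = r \<odot>\<^bsub>M j\<^esub> f u"
    and "u \<in> carrier (M i) \<Longrightarrow> f (\<ominus>\<^bsub>M i\<^esub> u) = \<ominus>\<^bsub>M j\<^esub> f u"
    and "u \<in> carrier (M i) \<Longrightarrow> v \<in> carrier (M i) \<Longrightarrow> f (u \<ominus>\<^bsub>M i\<^esub> v) = f u \<ominus>\<^bsub>M j\<^esub> f v"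
proof -
  have a: "additive_map (M i) (M j) f" using assms by (simp add: linear_map_def)
  note zero = additive_map_zero[OF M.abelian_group_axioms M.abelian_group_axioms a]
  note neg = additive_map_neg[OF M.abelian_group_axioms M.abelian_group_axioms a]
  show "f \<zero>\<^bsub>M i\<^esub> = \<zero>\<^bsub>M j\<^esub>" by (rule zero)
  show "u \<in> carrier (M i) \<Longrightarrow> f (\<ominus>\<^bsub>M i\<^esub> u) = \<ominus>\<^bsub>M j\<^esub> f u" by (rule neg)
  show "u \<in> carrier (M i) \<Longrightarrow> v \<in> carrier (M i) \<Longrightarrow> f (u \<ominus>\<^bsub>M i\<^esub> v) = f u \<ominus>\<^bsub>M j\<^esub> f v"
    using assms by (simp add: M.minus_eq linear_map_def additive_map_def neg)
qed (use assms in \<open>auto simp: linear_map_def additive_map_def\<close>)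

lemma (in graded_module) is_graded_module: "graded_module R M" ..

lemma (in abelian_group) a_minus_eq_zero_iff:
  assumes "u \<in> carrier G" "v \<in> carrier G"
  shows "u \<ominus> v = \<zero> \<longleftrightarrow> u = v"
  using assms by (metis a_minus_def a_inv_closed minus_equality minus_minus r_neg)

lemma (in abelian_group) a_add_minus_cancel:
  assumes "u \<in> carrier G" "v \<in> carrier G"
  shows "v \<oplus> (u \<oplus> \<ominus> v) = u"
  using assms by (metis a_comm a_inv_closed r_neg2)

lemma cone_graded_module:
  assumes "graded_module R M"
  shows "graded_module R (cone_module M)"
proof -
  interpret graded_module R M by fact
  show ?thesis
  proof (rule graded_module.intro[OF is_cring graded_module_axioms.intro])
    fix j
    show "module R (cone_module M j)"
    proof (rule moduleI)
      show "cring R" by (rule is_cring)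
      show "abelian_group (cone_module M j)"
      proof (rule abelian_groupI)
        fix u assume "u \<in> carrier (cone_module M j)"
        then show "\<exists>v\<in>carrier (cone_module M j). v \<oplus>\<^bsub>cone_module M j\<^esub> u = \<zero>\<^bsub>cone_module M j\<^esub>"
          by (intro bexI[of _ "join (\<ominus>\<^bsub>M j\<^esub> evens u) (\<ominus>\<^bsub>M (j - 1)\<^esub> odds u)"])
            (auto simp: cone_carrier cone_add cone_zero M.l_neg)
      qed (auto simp: cone_carrier cone_add cone_zero M.a_ac)
    qed (auto simp: cone_carrier cone_add cone_zero cone_smult M.smult_l_distr M.smult_r_distr
        M.smult_assoc1)
  qed
qed

lemma cone_neg:
  assumes "graded_module R M" "u \<in> carrier (cone_module M j)"
  shows "\<ominus>\<^bsub>cone_module M j\<^esub> u = join (\<ominus>\<^bsub>M j\<^esub> evens u) (\<ominus>\<^bsub>M (j - 1)\<^esub> odds u)"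
proof -
  interpret graded_module R M by fact
  interpret C: graded_module R "cone_module M" by (rule cone_graded_module) fact
  show ?thesis
    by (rule C.M.minus_equality) (use assms in \<open>auto simp: cone_carrier cone_add cone_zero M.l_neg\<close>)
qed

lemma cone_minus:
  assumes "graded_module R M" "u \<in> carrier (cone_module M j)" "v \<in> carrier (cone_module M j)"
  shows "u \<ominus>\<^bsub>cone_module M j\<^esub> v =
    join (evens u \<ominus>\<^bsub>M j\<^esub> evens v) (odds u \<ominus>\<^bsub>M (j - 1)\<^esub> odds v)"
  using assms by (simp add: a_minus_def cone_neg cone_add)

locale cochain_complex = graded_module R M
  for R :: "('a, 'c) ring_scheme" (structure) and M :: "int \<Rightarrow> ('a, 'b) module" +
  fixes d :: "int \<Rightarrow> 'b \<Rightarrow> 'b"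
  assumes d_linear: "linear_map R (M j) (M (j + 1)) (d j)"
    and d_d_raw: "u \<in> carrier (M j) \<Longrightarrow> d (j + 1) (d j u) = \<zero>\<^bsub>M (j + 2)\<^esub>"
begin

lemma d_closed [simp, intro]: "u \<in> carrier (M j) \<Longrightarrow> k = j + 1 \<Longrightarrow> d j u \<in> carrier (M k)"
  using d_linear[of j] by (auto simp: linear_map_def additive_map_def)

lemma d_additive: "additive_map (M j) (M (j + 1)) (d j)"
  using d_linear by (auto simp: linear_map_def)

lemma d_add [simp]: "u \<in> carrier (M j) \<Longrightarrow> v \<in> carrier (M j) \<Longrightarrow>
    d j (u \<oplus>\<^bsub>M j\<^esub> v) = d j u \<oplus>\<^bsub>M (j + 1)\<^esub> d j v"
  using d_additive[of j] by (auto simp: additive_map_def)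

lemma d_smult [simp]: "r \<in> carrier R \<Longrightarrow> u \<in> carrier (M j) \<Longrightarrow>
    d j (r \<odot>\<^bsub>M j\<^esub> u) = r \<odot>\<^bsub>M (j + 1)\<^esub> d j u"
  using d_linear[of j] by (auto simp: linear_map_def)

lemma d_zero [simp]: "d j \<zero>\<^bsub>M j\<^esub> = \<zero>\<^bsub>M (j + 1)\<^esub>"
  by (rule additive_map_zero[OF M.abelian_group_axioms M.abelian_group_axioms d_additive])

lemma d_neg [simp]: "u \<in> carrier (M j) \<Longrightarrow> d j (\<ominus>\<^bsub>M j\<^esub> u) = \<ominus>\<^bsub>M (j + 1)\<^esub> d j u"
  by (rule additive_map_neg[OF M.abelian_group_axioms M.abelian_group_axioms d_additive])

lemma d_minus [simp]: "u \<in> carrier (M j) \<Longrightarrow> v \<in> carrier (M j) \<Longrightarrow>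
    d j (u \<ominus>\<^bsub>M j\<^esub> v) = d j u \<ominus>\<^bsub>M (j + 1)\<^esub> d j v"
  by (simp add: a_minus_def)

lemma d_d [simp]: "u \<in> carrier (M j) \<Longrightarrow> k = j + 1 \<Longrightarrow> d k (d j u) = \<zero>\<^bsub>M (k + 1)\<^esub>"
  using d_d_raw[of u j] by (simp add: add.assoc)

definition cocycles :: "int \<Rightarrow> 'b set" where
  "cocycles j = {u \<in> carrier (M j). d j u = \<zero>\<^bsub>M (j + 1)\<^esub>}"

definition coboundaries :: "int \<Rightarrow> 'b set" where
  "coboundaries j = d (j - 1) ` carrier (M (j - 1))"

lemma is_cochain_complex: "cochain_complex R M d" ..

end

lemma cone_complex:
  assumes "cochain_complex R M d" and x: "x \<in> carrier R"
  shows "cochain_complex R (cone_module M) (cone_diff M x d)"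
proof -
  interpret cochain_complex R M d by fact
  interpret C: graded_module R "cone_module M" by (rule cone_graded_module) (rule is_graded_module)
  show ?thesis
  proof (unfold_locales, goal_cases)
    case (1 j)
    show ?case
      unfolding linear_map_def additive_map_def
      using x by (auto simp: cone_carrier cone_add cone_smult cone_diff_def M.smult_r_distr
          a_minus_def M.minus_add M.a_ac M.smult_r_minus M.smult_assoc1[symmetric] m_comm)
  next
    case (2 u j)
    then show ?case
      using x by (auto simp: cone_carrier cone_zero cone_diff_def a_minus_def M.r_neg M.add.inv_one[folded a_inv_def]
          add.commute[of 1] add.commute[of 2])
  qed
qed


text \<open>There are two differentials on one graded module because the Frobenius maps the Koszul complex
  on \<open>xs\<close> to the one on the \<open>p\<close>-th powers of \<open>xs\<close>, which has the same terms.\<close>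

locale frobenius_pair = D: cochain_complex R M d + D': cochain_complex R M d'
  for R :: "('a, 'c) ring_scheme" (structure) and M :: "int \<Rightarrow> ('a, 'b) module" and d d' +
  fixes p :: nat and \<phi> :: "int \<Rightarrow> 'b \<Rightarrow> 'b"
  assumes \<phi>_additive: "additive_map (M j) (M j) (\<phi> j)"
    and \<phi>_smult: "r \<in> carrier R \<Longrightarrow> u \<in> carrier (M j) \<Longrightarrow>
      \<phi> j (r \<odot>\<^bsub>M j\<^esub> u) = (r [^] p) \<odot>\<^bsub>M j\<^esub> \<phi> j u"
    and \<phi>_d: "u \<in> carrier (M j) \<Longrightarrow> \<phi> (j + 1) (d j u) = d' j (\<phi> j u)"
begin

lemma \<phi>_closed [simp, intro]: "u \<in> carrier (M j) \<Longrightarrow> \<phi> j u \<in> carrier (M j)"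
  using \<phi>_additive[of j] by (auto simp: additive_map_def)

lemma \<phi>_add [simp]: "u \<in> carrier (M j) \<Longrightarrow> v \<in> carrier (M j) \<Longrightarrow>
    \<phi> j (u \<oplus>\<^bsub>M j\<^esub> v) = \<phi> j u \<oplus>\<^bsub>M j\<^esub> \<phi> j v"
  using \<phi>_additive[of j] by (auto simp: additive_map_def)

lemma \<phi>_zero [simp]: "\<phi> j \<zero>\<^bsub>M j\<^esub> = \<zero>\<^bsub>M j\<^esub>"
  by (rule additive_map_zero[OF D.M.abelian_group_axioms D.M.abelian_group_axioms \<phi>_additive])

lemma \<phi>_neg [simp]: "u \<in> carrier (M j) \<Longrightarrow> \<phi> j (\<ominus>\<^bsub>M j\<^esub> u) = \<ominus>\<^bsub>M j\<^esub> \<phi> j u"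
  by (rule additive_map_neg[OF D.M.abelian_group_axioms D.M.abelian_group_axioms \<phi>_additive])

lemma \<phi>_minus [simp]: "u \<in> carrier (M j) \<Longrightarrow> v \<in> carrier (M j) \<Longrightarrow>
    \<phi> j (u \<ominus>\<^bsub>M j\<^esub> v) = \<phi> j u \<ominus>\<^bsub>M j\<^esub> \<phi> j v"
  by (simp add: a_minus_def)

lemma \<phi>_d' [simp]: "u \<in> carrier (M j) \<Longrightarrow> k = j + 1 \<Longrightarrow> \<phi> k (d j u) = d' j (\<phi> j u)"
  using \<phi>_d by simp

end

lemma cone_frobenius_pair:
  assumes "frobenius_pair R M d d' p \<phi>" and x: "x \<in> carrier R"
  shows "frobenius_pair R (cone_module M) (cone_diff M x d) (cone_diff M (x [^]\<^bsub>R\<^esub> p) d') p (cone_map \<phi>)"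
proof -
  interpret frobenius_pair R M d d' p \<phi> by fact
  interpret C: cochain_complex R "cone_module M" "cone_diff M x d"
    by (rule cone_complex[OF D.is_cochain_complex x])
  interpret C': cochain_complex R "cone_module M" "cone_diff M (x [^]\<^bsub>R\<^esub> p) d'"
    by (rule cone_complex[OF D'.is_cochain_complex]) (use x in simp)
  show ?thesis
  proof (unfold_locales, goal_cases)
    case (1 j)
    show ?case by (auto simp: additive_map_def cone_carrier cone_add cone_map_def)
  next
    case (2 r u j)
    then show ?case by (auto simp: cone_carrier cone_smult cone_map_def \<phi>_smult)
  next
    case (3 u j)
    then show ?case using x
      by (auto simp: cone_carrier cone_diff_def cone_map_def \<phi>_smult)
  qed
qed

section \<open>Frobenius injectivity and annihilators on the cohomology of a cone\<close>

context frobenius_pair begin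

text \<open>Phrased as a trivial kernel on representatives. As \<phi> is additive and commutes with
  the differentials, this is injectivity of the induced map, without forming quotients.\<close>

definition injective_on_cohomology :: "int \<Rightarrow> bool" where
  "injective_on_cohomology j \<longleftrightarrow>
     (\<forall>u\<in>D.cocycles j. \<phi> j u \<in> D'.coboundaries j \<longrightarrow> u \<in> D.coboundaries j)"

end

context cochain_complex begin

definition kills_cohomology :: "'a \<Rightarrow> int \<Rightarrow> bool" where
  "kills_cohomology y j \<longleftrightarrow> (\<forall>u\<in>cocycles j. y \<odot>\<^bsub>M j\<^esub> u \<in> coboundaries j)"

lemma coboundariesI: "v \<in> carrier (M k) \<Longrightarrow> k = j - 1 \<Longrightarrow> d k v = u \<Longrightarrow> u \<in> coboundaries j"
  by (auto simp: coboundaries_def)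

lemma coboundariesE:
  assumes "u \<in> coboundaries j"
  obtains v where "v \<in> carrier (M (j - 1))" "u = d (j - 1) v"
  using assms by (auto simp: coboundaries_def)

end

text \<open>Cohomology of the cone is an extension of the \<open>x\<close>-torsion of
  \<open>H^j\<close> by the quotient of \<open>H^(j-1)\<close> by \<open>x\<close>. In the target,
  \<open>x^p\<close> is zero on \<open>H^(j-1)\<close>, so that quotient is all of
  \<open>H^(j-1)\<close> and injectivity in the two degrees \<open>j\<close> and
  \<open>j - 1\<close> of the base suffices.\<close>

lemma cone_injective_on_cohomology:
  assumes "frobenius_pair R M d d' p \<phi>" and x: "x \<in> carrier R"
    and inj: "frobenius_pair.injective_on_cohomology M d d' \<phi> j"
      "frobenius_pair.injective_on_cohomology M d d' \<phi> (j - 1)"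
    and kills: "cochain_complex.kills_cohomology M d' (x [^]\<^bsub>R\<^esub> p) (j - 1)"
  shows "frobenius_pair.injective_on_cohomology (cone_module M) (cone_diff M x d)
     (cone_diff M (x [^]\<^bsub>R\<^esub> p) d') (cone_map \<phi>) j"
proof -
  interpret frobenius_pair R M d d' p \<phi> by fact
  interpret C: frobenius_pair R "cone_module M" "cone_diff M x d" "cone_diff M (x [^]\<^bsub>R\<^esub> p) d'"
      p "cone_map \<phi>"
    by (rule cone_frobenius_pair) fact+
  have xp: "x [^]\<^bsub>R\<^esub> p \<in> carrier R" using x by simp
  show ?thesis
    unfolding C.injective_on_cohomology_def
  proof (intro ballI impI)
    fix u assume "u \<in> C.D.cocycles j" and F: "cone_map \<phi> j u \<in> C.D'.coboundaries j"
    then obtain a b where u: "u = join a b" and a: "a \<in> carrier (M j)" and b: "b \<in> carrier (M (j - 1))"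
      and da: "d j a = \<zero>\<^bsub>M (j + 1)\<^esub>" and e: "x \<odot>\<^bsub>M j\<^esub> a \<ominus>\<^bsub>M j\<^esub> d (j - 1) b = \<zero>\<^bsub>M j\<^esub>"
      by (auto simp: C.D.cocycles_def cone_carrier cone_diff_def cone_zero eq_join_iff)
    have e: "x \<odot>\<^bsub>M j\<^esub> a = d (j - 1) b"
      using e a b x by (simp add: D.M.minus_eq D.M.a_minus_eq_zero_iff[unfolded D.M.minus_eq])
    from F obtain a' b' where a': "a' \<in> carrier (M (j - 1))" and b': "b' \<in> carrier (M (j - 2))"
      and \<phi>a: "\<phi> j a = d' (j - 1) a'"
      and \<phi>b: "\<phi> (j - 1) b = (x [^]\<^bsub>R\<^esub> p) \<odot>\<^bsub>M (j - 1)\<^esub> a' \<ominus>\<^bsub>M (j - 1)\<^esub> d' (j - 2) b'"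
      by (auto simp: C.D'.coboundaries_def cone_carrier cone_diff_def cone_map_def u)
    have "a \<in> D.coboundaries j"
      using inj(1) a da a' \<phi>a unfolding injective_on_cohomology_def D'.coboundaries_def D.cocycles_def
      by auto
    then obtain a2 where a2: "a2 \<in> carrier (M (j - 1))" "a = d (j - 1) a2"
      by (auto simp: D.coboundaries_def)
    \<comment> \<open>Subtracting the coboundary of \<open>(a2, 0)\<close> from \<open>u\<close>
      leaves \<open>(0, b1)\<close>.\<close>
    define b1 where "b1 = b \<ominus>\<^bsub>M (j - 1)\<^esub> x \<odot>\<^bsub>M (j - 1)\<^esub> a2"
    have b1: "b1 \<in> carrier (M (j - 1))" "d (j - 1) b1 = \<zero>\<^bsub>M j\<^esub>"
      using a2 b e x by (simp_all add: b1_def D.M.minus_eq D.M.r_neg)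
    \<comment> \<open>The same correction on the Frobenius side: the cochain \<open>a'\<close> alone
      is not a cocycle, but its difference from the image of \<open>a2\<close> is one, so the
      annihilation by \<open>x^p\<close> applies to it.\<close>
    define a3 where "a3 = a' \<ominus>\<^bsub>M (j - 1)\<^esub> \<phi> (j - 1) a2"
    have a3: "a3 \<in> carrier (M (j - 1))" "d' (j - 1) a3 = \<zero>\<^bsub>M j\<^esub>"
      using a2 a' \<phi>a by (simp_all add: a3_def D.M.minus_eq D.M.r_neg)
    have \<phi>b1: "\<phi> (j - 1) b1 = (x [^]\<^bsub>R\<^esub> p) \<odot>\<^bsub>M (j - 1)\<^esub> a3 \<ominus>\<^bsub>M (j - 1)\<^esub> d' (j - 2) b'"
      using a2 b x a' b' by (simp add: b1_def a3_def \<phi>b \<phi>_smult D.M.minus_eq D.M.smult_r_distr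
          D.M.smult_r_minus D.M.a_ac)
    have "(x [^]\<^bsub>R\<^esub> p) \<odot>\<^bsub>M (j - 1)\<^esub> a3 \<in> D'.coboundaries (j - 1)"
      using kills a3 by (simp add: D'.kills_cohomology_def D'.cocycles_def)
    then obtain c where c: "c \<in> carrier (M (j - 2))" "(x [^]\<^bsub>R\<^esub> p) \<odot>\<^bsub>M (j - 1)\<^esub> a3 = d' (j - 2) c"
      by (auto simp: D'.coboundaries_def)
    have "\<phi> (j - 1) b1 = d' (j - 2) (c \<ominus>\<^bsub>M (j - 2)\<^esub> b')"
      using \<phi>b1 c b' by simp
    then have "\<phi> (j - 1) b1 \<in> D'.coboundaries (j - 1)"
      using b' c by (auto intro!: D'.coboundariesI[of "c \<ominus>\<^bsub>M (j - 2)\<^esub> b'" "j - 2"])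
    then have "b1 \<in> D.coboundaries (j - 1)"
      using inj(2) b1 unfolding injective_on_cohomology_def D.cocycles_def by auto
    then obtain b2 where b2: "b2 \<in> carrier (M (j - 2))" "b1 = d (j - 2) b2"
      by (auto simp: D.coboundaries_def)
    have "b = x \<odot>\<^bsub>M (j - 1)\<^esub> a2 \<ominus>\<^bsub>M (j - 1)\<^esub> d (j - 2) (\<ominus>\<^bsub>M (j - 2)\<^esub> b2)"
      using a2 b b2 x unfolding b2(2)[symmetric]
      by (simp add: b2(2)[symmetric]) (simp add: b1_def D.M.minus_eq D.M.a_ac D.M.r_neg)
    then show "u \<in> C.D.coboundaries j"
      using a2 b2
      by (intro C.D.coboundariesI[of "join a2 (\<ominus>\<^bsub>M (j - 2)\<^esub> b2)" "j - 1"])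
        (auto simp: cone_carrier cone_diff_def u)
  qed
qed

text \<open>In the extension that describes the cohomology of the cone, \<open>y\<close> kills the
  sub and the quotient, so two factors \<open>y\<close> are needed. The extra factor is removed
  later by Frobenius.\<close>

lemma cone_kills_cohomology:
  assumes "cochain_complex R M d" and x: "x \<in> carrier R" and y: "y \<in> carrier R"
    and k1: "cochain_complex.kills_cohomology M d y j"
    and k2: "cochain_complex.kills_cohomology M d y (j - 1)"
  shows "cochain_complex.kills_cohomology (cone_module M) (cone_diff M x d) (y \<otimes>\<^bsub>R\<^esub> y) j"
proof -
  interpret cochain_complex R M d by fact
  interpret C: cochain_complex R "cone_module M" "cone_diff M x d"
    by (rule cone_complex[OF is_cochain_complex x])
  show ?thesis
    unfolding C.kills_cohomology_def
  proof (intro ballI impI)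
    fix u assume "u \<in> C.cocycles j"
    then obtain a b where u: "u = join a b" and a: "a \<in> carrier (M j)" and b: "b \<in> carrier (M (j - 1))"
      and da: "d j a = \<zero>\<^bsub>M (j + 1)\<^esub>" and e: "x \<odot>\<^bsub>M j\<^esub> a \<ominus>\<^bsub>M j\<^esub> d (j - 1) b = \<zero>\<^bsub>M j\<^esub>"
      by (auto simp: C.cocycles_def cone_carrier cone_diff_def cone_zero eq_join_iff)
    have e: "x \<odot>\<^bsub>M j\<^esub> a = d (j - 1) b"
      using e a b x by (simp add: M.minus_eq M.a_minus_eq_zero_iff[unfolded M.minus_eq])
    have "y \<odot>\<^bsub>M j\<^esub> a \<in> coboundaries j"
      using k1 a da by (simp add: kills_cohomology_def cocycles_def)
    then obtain a1 where a1: "a1 \<in> carrier (M (j - 1))" "y \<odot>\<^bsub>M j\<^esub> a = d (j - 1) a1"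
      by (auto simp: coboundaries_def)
    \<comment> \<open>\<open>y u\<close> minus the coboundary of \<open>(a1, 0)\<close> is
      \<open>(0, b1)\<close>; the second factor \<open>y\<close> is spent on
      \<open>b1\<close>.\<close>
    define b1 where "b1 = y \<odot>\<^bsub>M (j - 1)\<^esub> b \<ominus>\<^bsub>M (j - 1)\<^esub> x \<odot>\<^bsub>M (j - 1)\<^esub> a1"
    have "y \<odot>\<^bsub>M j\<^esub> (x \<odot>\<^bsub>M j\<^esub> a) = x \<odot>\<^bsub>M j\<^esub> (y \<odot>\<^bsub>M j\<^esub> a)"
      using a x y by (simp add: M.smult_assoc1[symmetric] m_comm)
    then have b1: "b1 \<in> carrier (M (j - 1))" "d (j - 1) b1 = \<zero>\<^bsub>M j\<^esub>"
      using a a1 b x y e by (simp_all add: b1_def M.minus_eq M.r_neg)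
    with k2 have "y \<odot>\<^bsub>M (j - 1)\<^esub> b1 \<in> coboundaries (j - 1)"
      by (simp add: kills_cohomology_def cocycles_def)
    then obtain b2 where b2: "b2 \<in> carrier (M (j - 2))" "y \<odot>\<^bsub>M (j - 1)\<^esub> b1 = d (j - 2) b2"
      by (auto simp: coboundaries_def)
    have "(y \<otimes>\<^bsub>R\<^esub> y) \<odot>\<^bsub>M (j - 1)\<^esub> b = x \<odot>\<^bsub>M (j - 1)\<^esub> (y \<odot>\<^bsub>M (j - 1)\<^esub> a1) \<oplus>\<^bsub>M (j - 1)\<^esub> y \<odot>\<^bsub>M (j - 1)\<^esub> b1"
      using a1 b x y
      by (simp add: b1_def M.minus_eq M.smult_r_distr M.smult_r_minus M.smult_assoc1[symmetric] m_comm)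
         (simp add: M.a_add_minus_cancel)
    then have "(y \<otimes>\<^bsub>R\<^esub> y) \<odot>\<^bsub>M (j - 1)\<^esub> b = x \<odot>\<^bsub>M (j - 1)\<^esub> (y \<odot>\<^bsub>M (j - 1)\<^esub> a1) \<ominus>\<^bsub>M (j - 1)\<^esub>
        d (j - 2) (\<ominus>\<^bsub>M (j - 2)\<^esub> b2)"
      using b2 by (simp add: M.minus_eq)
    then show "(y \<otimes>\<^bsub>R\<^esub> y) \<odot>\<^bsub>cone_module M j\<^esub> u \<in> C.coboundaries j"
      using a1 b2 y a
      by (intro C.coboundariesI[of "join (y \<odot>\<^bsub>M (j - 1)\<^esub> a1) (\<ominus>\<^bsub>M (j - 2)\<^esub> b2)" "j - 1"])
        (auto simp: cone_carrier cone_smult cone_diff_def u M.smult_assoc1)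
  qed
qed

section \<open>Koszul complexes as iterated cones, and the induction on their length\<close>

primrec koszul_module :: "(int \<Rightarrow> ('a, nat \<Rightarrow> 'b) module) \<Rightarrow> nat \<Rightarrow> int \<Rightarrow> ('a, nat \<Rightarrow> 'b) module" where
  "koszul_module M 0 = M"
| "koszul_module M (Suc n) = cone_module (koszul_module M n)"

primrec koszul_diff ::
  "(int \<Rightarrow> ('a, nat \<Rightarrow> 'b) module) \<Rightarrow> (int \<Rightarrow> (nat \<Rightarrow> 'b) \<Rightarrow> nat \<Rightarrow> 'b) \<Rightarrow> 'a list \<Rightarrow>
     int \<Rightarrow> (nat \<Rightarrow> 'b) \<Rightarrow> nat \<Rightarrow> 'b" where
  "koszul_diff M d [] = d"
| "koszul_diff M d (x # xs) = cone_diff (koszul_module M (length xs)) x (koszul_diff M d xs)"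

primrec koszul_map ::
  "nat \<Rightarrow> (int \<Rightarrow> (nat \<Rightarrow> 'b) \<Rightarrow> nat \<Rightarrow> 'b) \<Rightarrow> int \<Rightarrow> (nat \<Rightarrow> 'b) \<Rightarrow> nat \<Rightarrow> 'b" where
  "koszul_map 0 f = f"
| "koszul_map (Suc n) f = cone_map (koszul_map n f)"

lemma koszul_graded_module: "graded_module R M \<Longrightarrow> graded_module R (koszul_module M n)"
  by (induction n) (auto intro: cone_graded_module)

lemma koszul_complex:
  assumes "cochain_complex R M d" "set xs \<subseteq> carrier R"
  shows "cochain_complex R (koszul_module M (length xs)) (koszul_diff M d xs)"
  using assms(2) by (induction xs) (auto intro: cone_complex assms(1))

lemma koszul_frobenius_pair:
  assumes "frobenius_pair R M d d p \<phi>" "set xs \<subseteq> carrier R"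
  shows "frobenius_pair R (koszul_module M (length xs)) (koszul_diff M d xs)
     (koszul_diff M d (map (\<lambda>x. x [^]\<^bsub>R\<^esub> p) xs)) p (koszul_map (length xs) \<phi>)"
  using assms(2) by (induction xs) (use assms(1) cone_frobenius_pair in \<open>auto\<close>)

context frobenius_pair begin

text \<open>The annihilator is known on the target complex and obtained on the source. This
  asymmetry is what allows a passage from the list of \<open>p\<close>-th powers back to the list
  itself.\<close>

lemma kills_cohomology_descent:
  assumes inj: "injective_on_cohomology j" and y: "y \<in> carrier R"
    and kills: "D'.kills_cohomology (y \<otimes> y) j" and p: "p \<ge> 2"
  shows "D.kills_cohomology y j"
  unfolding D.kills_cohomology_def
proof
  fix u assume "u \<in> D.cocycles j"
  then have u: "u \<in> carrier (M j)" "d j u = \<zero>\<^bsub>M (j + 1)\<^esub>" by (auto simp: D.cocycles_def)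
  then have "d' j (\<phi> j u) = \<zero>\<^bsub>M (j + 1)\<^esub>" by (metis \<phi>_d \<phi>_zero)
  with u kills have "(y \<otimes> y) \<odot>\<^bsub>M j\<^esub> \<phi> j u \<in> D'.coboundaries j"
    by (auto simp: D'.kills_cohomology_def D'.cocycles_def)
  then obtain v where v: "v \<in> carrier (M (j - 1))" "(y \<otimes> y) \<odot>\<^bsub>M j\<^esub> \<phi> j u = d' (j - 1) v"
    by (rule D'.coboundariesE)
  \<comment> \<open>Here \<open>p \<ge> 2\<close> is used: \<open>y^p\<close> is \<open>y^q\<close>
    times the factor \<open>y^2\<close> that is known to kill.\<close>
  obtain q where q: "p = q + 2" using p by (metis add.commute le_Suc_ex)
  have "\<phi> j (y \<odot>\<^bsub>M j\<^esub> u) = (y [^] q) \<odot>\<^bsub>M j\<^esub> ((y \<otimes> y) \<odot>\<^bsub>M j\<^esub> \<phi> j u)"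
    using u y by (simp add: \<phi>_smult q D.M.smult_assoc1[symmetric] D.m_assoc numeral_2_eq_2)
  then have "\<phi> j (y \<odot>\<^bsub>M j\<^esub> u) = d' (j - 1) ((y [^] q) \<odot>\<^bsub>M (j - 1)\<^esub> v)"
    using v y by simp
  then have "\<phi> j (y \<odot>\<^bsub>M j\<^esub> u) \<in> D'.coboundaries j"
    using v y by (intro D'.coboundariesI[of "(y [^] q) \<odot>\<^bsub>M (j - 1)\<^esub> v" "j - 1"]) auto
  moreover have "y \<odot>\<^bsub>M j\<^esub> u \<in> D.cocycles j"
    using u y by (simp add: D.cocycles_def)
  ultimately show "y \<odot>\<^bsub>M j\<^esub> u \<in> D.coboundaries j"
    using inj by (simp add: injective_on_cohomology_def)
qed

end

text \<open>The list is arbitrary in the induction because the step needs the hypothesis for the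
  tail \<open>ys\<close> and also for the \<open>p\<close>-th powers of \<open>ys\<close>, which is
  why \<open>I\<close> is closed under \<open>p\<close>-th powers. Injectivity for the longer list
  comes first, since the killing statement is derived from it.\<close>

lemma koszul_injective_and_killed:
  assumes F: "frobenius_pair R M d d p \<phi>" and p: "p \<ge> 2"
    and I: "I \<subseteq> carrier R" "\<And>x. x \<in> I \<Longrightarrow> x [^]\<^bsub>R\<^esub> p \<in> I"
    and inj: "\<And>j. j \<le> n \<Longrightarrow> frobenius_pair.injective_on_cohomology M d d \<phi> j"
    and kills: "\<And>j y. j < n \<Longrightarrow> y \<in> I \<Longrightarrow> cochain_complex.kills_cohomology M d y j"
  shows "set xs \<subseteq> I \<Longrightarrow>
    (\<forall>j\<le>n. frobenius_pair.injective_on_cohomology (koszul_module M (length xs)) (koszul_diff M d xs)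
      (koszul_diff M d (map (\<lambda>x. x [^]\<^bsub>R\<^esub> p) xs)) (koszul_map (length xs) \<phi>) j) \<and>
    (\<forall>j<n. \<forall>y\<in>I. cochain_complex.kills_cohomology (koszul_module M (length xs)) (koszul_diff M d xs) y j)"
proof (induction "length xs" arbitrary: xs)
  case 0
  then show ?case using inj kills by simp
next
  case (Suc l)
  then obtain x ys where xs: "xs = x # ys" by (cases xs) auto
  let ?pw = "\<lambda>x. x [^]\<^bsub>R\<^esub> p"
  interpret F: frobenius_pair R M d d p \<phi> by fact
  have ys: "l = length ys" "set ys \<subseteq> I" "x \<in> I" using Suc xs by auto
  have ysp: "l = length (map ?pw ys)" "set (map ?pw ys) \<subseteq> I" using ys I by auto
  interpret Y: frobenius_pair R "koszul_module M l" "koszul_diff M d ys"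
    "koszul_diff M d (map ?pw ys)" p "koszul_map l \<phi>"
    using koszul_frobenius_pair[OF F, of ys] ys I by auto
  interpret X: frobenius_pair R "koszul_module M (Suc l)" "koszul_diff M d xs"
    "koszul_diff M d (map ?pw xs)" p "koszul_map (Suc l) \<phi>"
    using koszul_frobenius_pair[OF F, of xs] Suc.prems I Suc(2) by auto
  note IH = Suc(1)[OF ys(1,2)] and IHp = Suc(1)[OF ysp]
  have inj': "X.injective_on_cohomology j" if "j \<le> n" for j
    using cone_injective_on_cohomology[OF Y.frobenius_pair_axioms, of x j] that IH IHp ys I
    by (auto simp: xs)
  moreover have "X.D.kills_cohomology y j" if "j < n" "y \<in> I" for y j
  proof (rule X.kills_cohomology_descent[OF inj' _ _ p])
    \<comment> \<open>On the \<open>p\<close>-th powers of the tail, \<open>y\<close> kills by the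
      induction hypothesis; the cone over \<open>x^p\<close> costs one more factor
      \<open>y\<close>.\<close>
    show "X.D'.kills_cohomology (y \<otimes>\<^bsub>R\<^esub> y) j"
      using cone_kills_cohomology[OF Y.D'.is_cochain_complex, of "?pw x" y j] that IHp ys I
      by (auto simp: xs)
  qed (use that I in auto)
  ultimately show ?case using Suc(2) by auto
qed


section \<open>Subcomplexes of cones and homotopies modulo a subcomplex\<close>

definition cone_set :: "(int \<Rightarrow> (nat \<Rightarrow> 'b) set) \<Rightarrow> int \<Rightarrow> (nat \<Rightarrow> 'b) set" where
  "cone_set S j = {u. evens u \<in> S j \<and> odds u \<in> S (j - 1)}"

text \<open>Extends a null-homotopy \<open>h\<close> of \<psi> on \<open>M\<close> to one of \<psi>
  plus \<open>x\<close> times \<theta> on the cone, when \<theta> commutes with \<open>d\<close>: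
  \<theta> carries the second summand back to the first, and \<open>cone_diff\<close> carries the
  first to the second by \<open>x\<close>. The sign of the last term matches that of
  \<open>cone_diff\<close>.\<close>

definition cone_homotopy :: "(int \<Rightarrow> ('a, nat \<Rightarrow> 'b) module) \<Rightarrow> (int \<Rightarrow> (nat \<Rightarrow> 'b) \<Rightarrow> nat \<Rightarrow> 'b) \<Rightarrow>
    (int \<Rightarrow> (nat \<Rightarrow> 'b) \<Rightarrow> nat \<Rightarrow> 'b) \<Rightarrow> int \<Rightarrow> (nat \<Rightarrow> 'b) \<Rightarrow> nat \<Rightarrow> 'b" where
  "cone_homotopy M \<theta> h j u =
     join (h j (evens u) \<oplus>\<^bsub>M (j - 1)\<^esub> \<theta> (j - 1) (odds u)) (\<ominus>\<^bsub>M (j - 2)\<^esub> h (j - 1) (odds u))"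

locale subcomplex = cochain_complex R M d
  for R :: "('a, 'c) ring_scheme" (structure) and M :: "int \<Rightarrow> ('a, 'b) module" and d +
  fixes S :: "int \<Rightarrow> 'b set"
  assumes submod: "submodule (S j) R (M j)" and d_sub: "u \<in> S j \<Longrightarrow> d j u \<in> S (j + 1)"
begin

lemma sub_zero [simp, intro]: "\<zero>\<^bsub>M j\<^esub> \<in> S j"
  using submod[of j] by (simp add: submodule_def subgroup_def)

lemma sub_carrier [simp, dest]: "u \<in> S j \<Longrightarrow> u \<in> carrier (M j)"
  using M.submoduleE(1)[OF submod[of j]] by auto

lemma sub_add [simp, intro]: "u \<in> S j \<Longrightarrow> v \<in> S j \<Longrightarrow> u \<oplus>\<^bsub>M j\<^esub> v \<in> S j"
  and sub_neg [simp, intro]: "u \<in> S j \<Longrightarrow> \<ominus>\<^bsub>M j\<^esub> u \<in> S j"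
  and sub_smult [simp, intro]: "r \<in> carrier R \<Longrightarrow> u \<in> S j \<Longrightarrow> r \<odot>\<^bsub>M j\<^esub> u \<in> S j"
  using M.submoduleE(3-5)[OF submod[of j]] by auto

lemma sub_minus [simp, intro]: "u \<in> S j \<Longrightarrow> v \<in> S j \<Longrightarrow> u \<ominus>\<^bsub>M j\<^esub> v \<in> S j"
  by (simp add: M.minus_eq)

lemma sub_d [simp, intro]: "u \<in> S j \<Longrightarrow> k = j + 1 \<Longrightarrow> d j u \<in> S k"
  using d_sub by simp

end

lemma cone_subcomplex:
  assumes "subcomplex R M d S" and x: "x \<in> carrier R"
  shows "subcomplex R (cone_module M) (cone_diff M x d) (cone_set S)"
proof -
  interpret subcomplex R M d S by fact
  interpret C: cochain_complex R "cone_module M" "cone_diff M x d"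
    by (rule cone_complex[OF is_cochain_complex x])
  show ?thesis
  proof (rule subcomplex.intro[OF C.is_cochain_complex subcomplex_axioms.intro], goal_cases)
    case (1 j)
    show ?case
      by (rule C.M.submoduleI)
        (auto simp: cone_set_def cone_carrier cone_zero cone_add cone_smult
          cone_neg[OF is_graded_module])
  next
    case (2 u j)
    then show ?case using x by (auto simp: cone_set_def cone_diff_def)
  qed
qed

text \<open>For \<open>\<psi>\<close> the identity, this says that \<open>h\<close> contracts \<open>S\<close> modulo \<open>T\<close>.\<close>

definition homotopy_mod ::
  "('a, 'c) ring_scheme \<Rightarrow> (int \<Rightarrow> ('a, 'b) module) \<Rightarrow> (int \<Rightarrow> 'b \<Rightarrow> 'b) \<Rightarrow>
    (int \<Rightarrow> 'b set) \<Rightarrow> (int \<Rightarrow> 'b set) \<Rightarrow> (int \<Rightarrow> 'b \<Rightarrow> 'b) \<Rightarrow> (int \<Rightarrow> 'b \<Rightarrow> 'b) \<Rightarrow> bool" where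
  "homotopy_mod R M d S T h \<psi> \<longleftrightarrow> (\<forall>j. \<forall>u\<in>S j. h j u \<in> S (j - 1) \<and>
     d (j - 1) (h j u) \<oplus>\<^bsub>M j\<^esub> h (j + 1) (d j u) \<ominus>\<^bsub>M j\<^esub> \<psi> j u \<in> T j)"

lemma cone_homotopy_linear:
  assumes "graded_module R M"
    and h: "\<And>j. linear_map R (M j) (M (j - 1)) (h j)"
    and \<theta>: "\<And>j. linear_map R (M j) (M j) (\<theta> j)"
  shows "linear_map R (cone_module M j) (cone_module M (j - 1)) (cone_homotopy M \<theta> h j)"
proof -
  interpret graded_module R M by fact
  have hc: "h j u \<in> carrier (M k)" if "u \<in> carrier (M j)" "k = j - 1" for j k u
    using linear_mapD(1)[OF h] that by simp
  note h' = linear_mapD(3,4)[OF h] and \<theta>' = linear_mapD(1,3,4)[OF \<theta>]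
  show ?thesis
    unfolding linear_map_def additive_map_def
    by (auto simp: cone_carrier cone_add cone_smult cone_homotopy_def hc h' \<theta>'
        M.minus_add M.a_ac M.smult_r_distr M.smult_r_minus)
qed

lemma (in abelian_group) cancel_summand_regroup:
  assumes [simp]: "p \<in> carrier G" "q \<in> carrier G" "r \<in> carrier G" "s \<in> carrier G" "t \<in> carrier G"
    "w \<in> carrier G"
  shows "p \<oplus> q \<oplus> (r \<oplus> (s \<ominus> t)) \<ominus> (w \<oplus> s) = (p \<oplus> r \<ominus> w) \<oplus> (q \<ominus> t)"
proof -
  have "p \<oplus> q \<oplus> (r \<oplus> (s \<ominus> t)) \<ominus> (w \<oplus> s) = ((p \<oplus> r \<ominus> w) \<oplus> (q \<ominus> t)) \<oplus> (s \<oplus> \<ominus> s)"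
    by (simp only: minus_eq minus_add assms a_ac a_closed a_inv_closed)
  then show ?thesis by (simp add: r_neg)
qed

lemma (in abelian_group) cancel_two_summands:
  assumes [simp]: "p \<in> carrier G" "q \<in> carrier G" "r \<in> carrier G" "t \<in> carrier G" "w \<in> carrier G"
  shows "p \<oplus> q \<oplus> r \<ominus> (p \<ominus> t) \<ominus> (w \<oplus> q) = r \<oplus> t \<ominus> w"
proof -
  have "p \<oplus> q \<oplus> r \<ominus> (p \<ominus> t) \<ominus> (w \<oplus> q) = (r \<oplus> t \<ominus> w) \<oplus> (p \<oplus> \<ominus> p) \<oplus> (q \<oplus> \<ominus> q)"
    by (simp only: minus_eq minus_add minus_minus assms a_ac a_closed a_inv_closed)
  then show ?thesis by (simp add: r_neg)
qed

lemma (in abelian_group) a_minus_minus_cancel: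
  assumes [simp]: "p \<in> carrier G" "q \<in> carrier G" "r \<in> carrier G"
  shows "(p \<ominus> q) \<ominus> (p \<ominus> r) = \<ominus> (q \<ominus> r)"
proof -
  have "(p \<ominus> q) \<ominus> (p \<ominus> r) = \<ominus> (q \<ominus> r) \<oplus> (p \<oplus> \<ominus> p)"
    by (simp only: minus_eq minus_add minus_minus assms a_ac a_closed a_inv_closed)
  then show ?thesis by (simp add: r_neg)
qed

text \<open>The homotopy formula on \<open>(a, b)\<close> has a single defect beyond that of
  \<open>h\<close>: the commutator of \<open>d\<close> and \<theta> at \<open>b\<close>, in the
  first component. The assumption \<open>comm\<close> places it in \<open>T\<close>.\<close>

lemma cone_homotopy_mod:
  assumes S: "subcomplex R M d S" and T: "subcomplex R M d T" and x: "x \<in> carrier R"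
    and h: "\<And>j. linear_map R (M j) (M (j - 1)) (h j)"
    and \<theta>: "\<And>j. linear_map R (M j) (M j) (\<theta> j)"
    and \<psi>: "\<And>j. \<psi> j \<in> carrier (M j) \<rightarrow> carrier (M j)"
    and \<theta>S: "\<And>j u. u \<in> S j \<Longrightarrow> \<theta> j u \<in> S j"
    and comm: "\<And>j u. u \<in> S j \<Longrightarrow> d j (\<theta> j u) \<ominus>\<^bsub>M (j + 1)\<^esub> \<theta> (j + 1) (d j u) \<in> T (j + 1)"
    and H: "homotopy_mod R M d S T h \<psi>"
  shows "homotopy_mod R (cone_module M) (cone_diff M x d) (cone_set S) (cone_set T)
    (cone_homotopy M \<theta> h) (cone_map (\<lambda>j u. \<psi> j u \<oplus>\<^bsub>M j\<^esub> x \<odot>\<^bsub>M j\<^esub> \<theta> j u))"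
proof -
  interpret S: subcomplex R M d S by fact
  interpret T: subcomplex R M d T by fact
  have hc: "h j u \<in> carrier (M k)" if "u \<in> carrier (M j)" "k = j - 1" for j k u
    using S.linear_mapD(1)[OF h] that by simp
  note h' = S.linear_mapD(3,4,5)[OF h] and \<theta>' = S.linear_mapD(1,3,4,5)[OF \<theta>]
  note tc = S.linear_mapD(1)[OF \<theta>]
  have pc: "\<psi> j u \<in> carrier (M j)" if "u \<in> carrier (M j)" for j u
    using \<psi> that by auto
  have hS: "h j u \<in> S k" if "u \<in> S j" "k = j - 1" for j u k
    using H that by (auto simp: homotopy_mod_def)
  have hT: "d (j - 1) (h j u) \<oplus>\<^bsub>M j\<^esub> h (j + 1) (d j u) \<ominus>\<^bsub>M j\<^esub> \<psi> j u \<in> T j"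
    if "u \<in> S j" for j u
    using H that by (auto simp: homotopy_mod_def)
  show ?thesis
    unfolding homotopy_mod_def
  proof (intro allI ballI conjI)
    fix j u assume "u \<in> cone_set S j"
    then obtain a b where u: "u = join a b" and a: "a \<in> S j" and b: "b \<in> S (j - 1)"
      by (auto simp: cone_set_def eq_join_iff)
    then have ac: "a \<in> carrier (M j)" "b \<in> carrier (M (j - 1))" by auto
    show "cone_homotopy M \<theta> h j u \<in> cone_set S (j - 1)"
      using a b by (auto simp: cone_set_def cone_homotopy_def u hS \<theta>S)
    let ?C = "cone_module M" and ?D = "cone_diff M x d" and ?h = "cone_homotopy M \<theta> h"
    let ?\<psi> = "cone_map (\<lambda>j u. \<psi> j u \<oplus>\<^bsub>M j\<^esub> x \<odot>\<^bsub>M j\<^esub> \<theta> j u)"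
    let ?v = "?D (j - 1) (?h j u) \<oplus>\<^bsub>?C j\<^esub> ?h (j + 1) (?D j u)"
    \<comment> \<open>In the odd part the two terms \<open>x (h a)\<close> will cancel; the even
      part retains the commutator.\<close>
    have v: "evens ?v = (d (j - 1) (h j a) \<oplus>\<^bsub>M j\<^esub> d (j - 1) (\<theta> (j - 1) b)) \<oplus>\<^bsub>M j\<^esub>
        (h (j + 1) (d j a) \<oplus>\<^bsub>M j\<^esub> (x \<odot>\<^bsub>M j\<^esub> \<theta> j a \<ominus>\<^bsub>M j\<^esub> \<theta> j (d (j - 1) b)))"
      "odds ?v = (x \<odot>\<^bsub>M (j - 1)\<^esub> h j a \<oplus>\<^bsub>M (j - 1)\<^esub> x \<odot>\<^bsub>M (j - 1)\<^esub> \<theta> (j - 1) b \<oplus>\<^bsub>M (j - 1)\<^esub>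
         d (j - 2) (h (j - 1) b)) \<ominus>\<^bsub>M (j - 1)\<^esub> (x \<odot>\<^bsub>M (j - 1)\<^esub> h j a \<ominus>\<^bsub>M (j - 1)\<^esub> h j (d (j - 1) b))"
      using ac x by (simp_all add: cone_add cone_diff_def cone_homotopy_def u hc h' \<theta>' S.M.minus_eq S.M.smult_r_distr)
    have "evens ?v \<in> carrier (M j)" "odds ?v \<in> carrier (M (j - 1))"
      unfolding v using ac x by (simp_all add: hc tc)
    then have vc: "?v \<in> carrier (?C j)" by (simp add: cone_carrier)
    have \<psi>c: "?\<psi> j u \<in> carrier (?C j)" using ac x by (simp add: cone_carrier cone_map_def u tc pc)
    have "evens (?v \<ominus>\<^bsub>?C j\<^esub> ?\<psi> j u) =
       (d (j - 1) (h j a) \<oplus>\<^bsub>M j\<^esub> h (j + 1) (d j a) \<ominus>\<^bsub>M j\<^esub> \<psi> j a) \<oplus>\<^bsub>M j\<^esub>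
       (d (j - 1) (\<theta> (j - 1) b) \<ominus>\<^bsub>M j\<^esub> \<theta> j (d (j - 1) b))"
      unfolding cone_minus[OF S.is_graded_module vc \<psi>c] evens_join v
      unfolding cone_map_def evens_join u using ac x by (intro S.M.cancel_summand_regroup) (simp_all add: hc tc pc)
    also have "\<dots> \<in> T j" using hT[OF a] comm[OF b] by simp
    finally have 1: "evens (?v \<ominus>\<^bsub>?C j\<^esub> ?\<psi> j u) \<in> T j" .
    have "odds (?v \<ominus>\<^bsub>?C j\<^esub> ?\<psi> j u) =
       d (j - 2) (h (j - 1) b) \<oplus>\<^bsub>M (j - 1)\<^esub> h j (d (j - 1) b) \<ominus>\<^bsub>M (j - 1)\<^esub> \<psi> (j - 1) b"
      unfolding cone_minus[OF S.is_graded_module vc \<psi>c] odds_join v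
      unfolding cone_map_def odds_join u using ac x by (intro S.M.cancel_two_summands) (simp_all add: hc tc pc)
    also have "\<dots> \<in> T (j - 1)" using hT[OF b] by simp
    finally have 2: "odds (?v \<ominus>\<^bsub>?C j\<^esub> ?\<psi> j u) \<in> T (j - 1)" .
    show "?v \<ominus>\<^bsub>?C j\<^esub> ?\<psi> j u \<in> cone_set T j" using 1 2 by (simp add: cone_set_def)
  qed
qed


section \<open>Contracting Koszul complexes\<close>

primrec koszul_set :: "nat \<Rightarrow> (int \<Rightarrow> (nat \<Rightarrow> 'b) set) \<Rightarrow> int \<Rightarrow> (nat \<Rightarrow> 'b) set" where
  "koszul_set 0 S = S"
| "koszul_set (Suc n) S = cone_set (koszul_set n S)"

lemma koszul_subcomplex:
  assumes "subcomplex R M d S" "set xs \<subseteq> carrier R"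
  shows "subcomplex R (koszul_module M (length xs)) (koszul_diff M d xs) (koszul_set (length xs) S)"
  using assms(2) by (induction xs) (auto intro: cone_subcomplex assms(1))

lemma koszul_map_sum:
  "koszul_map n (\<lambda>j u. f j u \<oplus>\<^bsub>M j\<^esub> x \<odot>\<^bsub>M j\<^esub> g j u) j u =
     koszul_map n f j u \<oplus>\<^bsub>koszul_module M n j\<^esub> x \<odot>\<^bsub>koszul_module M n j\<^esub> koszul_map n g j u"
  by (induction n arbitrary: j u) (simp_all add: cone_map_def cone_add cone_smult)

lemma koszul_map_id:
  assumes "\<And>j u. u \<in> S j \<Longrightarrow> f j u = u"
  shows "u \<in> koszul_set n S j \<Longrightarrow> koszul_map n f j u = u"
  by (induction n arbitrary: j u) (simp_all add: cone_map_def cone_set_def assms)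

lemma koszul_map_set:
  assumes "\<And>j u. u \<in> S j \<Longrightarrow> f j u \<in> S j"
  shows "u \<in> koszul_set n S j \<Longrightarrow> koszul_map n f j u \<in> koszul_set n S j"
  by (induction n arbitrary: j u) (simp_all add: cone_map_def cone_set_def assms)

lemma koszul_map_linear:
  assumes "graded_module R M" "\<And>j. linear_map R (M j) (M j) (f j)"
  shows "linear_map R (koszul_module M n j) (koszul_module M n j) (koszul_map n f j)"
proof (induction n arbitrary: j)
  case (Suc n)
  then show ?case
    unfolding linear_map_def additive_map_def
    by (auto simp: cone_carrier cone_add cone_smult cone_map_def Pi_iff)
qed (use assms in simp)

text \<open>The map acts summand by summand and is linear, so it commutes with the multiplications
  in the Koszul differential. Only the commutator with the coefficient differential survives, up to
  sign.\<close>

lemma koszul_map_commutator: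
  assumes T: "subcomplex R M d T" and S: "subcomplex R M d S"
    and f: "\<And>j. linear_map R (M j) (M j) (f j)"
    and comm: "\<And>j u. u \<in> S j \<Longrightarrow> d j (f j u) \<ominus>\<^bsub>M (j + 1)\<^esub> f (j + 1) (d j u) \<in> T (j + 1)"
  shows "set xs \<subseteq> carrier R \<Longrightarrow> u \<in> koszul_set (length xs) S j \<Longrightarrow>
    koszul_diff M d xs j (koszul_map (length xs) f j u) \<ominus>\<^bsub>koszul_module M (length xs) (j + 1)\<^esub>
      koszul_map (length xs) f (j + 1) (koszul_diff M d xs j u)
    \<in> koszul_set (length xs) T (j + 1)"
proof (induction xs arbitrary: j u)
  case Nil
  then show ?case using comm by simp
next
  case (Cons x xs)
  let ?n = "length xs"
  interpret T: subcomplex R "koszul_module M ?n" "koszul_diff M d xs" "koszul_set ?n T"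
    using koszul_subcomplex[OF T, of xs] Cons.prems by simp
  interpret S: subcomplex R "koszul_module M ?n" "koszul_diff M d xs" "koszul_set ?n S"
    using koszul_subcomplex[OF S, of xs] Cons.prems by simp
  have x: "x \<in> carrier R" and xs: "set xs \<subseteq> carrier R" using Cons.prems by auto
  obtain a b where u: "u = join a b" and a: "a \<in> koszul_set ?n S j" and b: "b \<in> koszul_set ?n S (j - 1)"
    using Cons.prems by (auto simp: cone_set_def eq_join_iff)
  have ac: "a \<in> carrier (koszul_module M ?n j)" "b \<in> carrier (koszul_module M ?n (j - 1))"
    using a b by auto
  let ?f = "koszul_map ?n f" and ?d = "koszul_diff M d xs" and ?K = "koszul_module M ?n"
  have gM: "graded_module R M"
    using S by (simp add: subcomplex_def cochain_complex_def)
  note lin = koszul_map_linear[OF gM f, of ?n]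
  note f' = T.linear_mapD(3,4,5)[OF lin] and fc = T.linear_mapD(1)[OF lin]
  have 1: "?d j (?f j a) \<ominus>\<^bsub>?K (j + 1)\<^esub> ?f (j + 1) (?d j a) \<in> koszul_set ?n T (j + 1)"
    using Cons.IH[OF xs a] .
  have "?d (j - 1) (?f (j - 1) b) \<ominus>\<^bsub>?K j\<^esub> ?f j (?d (j - 1) b) \<in> koszul_set ?n T j"
    using Cons.IH[OF xs b] by simp
  then have "\<ominus>\<^bsub>?K j\<^esub> (?d (j - 1) (?f (j - 1) b) \<ominus>\<^bsub>?K j\<^esub> ?f j (?d (j - 1) b)) \<in> koszul_set ?n T j"
    by simp
  also have "\<ominus>\<^bsub>?K j\<^esub> (?d (j - 1) (?f (j - 1) b) \<ominus>\<^bsub>?K j\<^esub> ?f j (?d (j - 1) b)) =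
      (x \<odot>\<^bsub>?K j\<^esub> ?f j a \<ominus>\<^bsub>?K j\<^esub> ?d (j - 1) (?f (j - 1) b)) \<ominus>\<^bsub>?K j\<^esub>
      ?f j (x \<odot>\<^bsub>?K j\<^esub> a \<ominus>\<^bsub>?K j\<^esub> ?d (j - 1) b)"
  proof -
    have "(x \<odot>\<^bsub>?K j\<^esub> ?f j a \<ominus>\<^bsub>?K j\<^esub> ?d (j - 1) (?f (j - 1) b)) \<ominus>\<^bsub>?K j\<^esub>
        ?f j (x \<odot>\<^bsub>?K j\<^esub> a \<ominus>\<^bsub>?K j\<^esub> ?d (j - 1) b) =
      (x \<odot>\<^bsub>?K j\<^esub> ?f j a \<ominus>\<^bsub>?K j\<^esub> ?d (j - 1) (?f (j - 1) b)) \<ominus>\<^bsub>?K j\<^esub>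
        (x \<odot>\<^bsub>?K j\<^esub> ?f j a \<ominus>\<^bsub>?K j\<^esub> ?f j (?d (j - 1) b))"
      using ac x by (simp add: T.M.minus_eq f' fc)
    then show ?thesis using ac x
      by (simp add: fc T.M.a_minus_minus_cancel)
  qed
  finally have 2: "(x \<odot>\<^bsub>?K j\<^esub> ?f j a \<ominus>\<^bsub>?K j\<^esub> ?d (j - 1) (?f (j - 1) b)) \<ominus>\<^bsub>?K j\<^esub>
      ?f j (x \<odot>\<^bsub>?K j\<^esub> a \<ominus>\<^bsub>?K j\<^esub> ?d (j - 1) b) \<in> koszul_set ?n T j" .
  show ?case
    using 1 2 ac x
    by (simp add: cone_set_def cone_minus[OF T.is_graded_module] cone_carrier cone_diff_def
        cone_map_def u fc)
qed

text \<open>If this map is the identity, the ring elements in the list behave like generators of the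
  unit ideal, with the maps \<theta> as coefficients.\<close>

fun weighted_sum :: "(int \<Rightarrow> ('a, 'b) module) \<Rightarrow> ('a \<times> (int \<Rightarrow> 'b \<Rightarrow> 'b)) list \<Rightarrow> int \<Rightarrow> 'b \<Rightarrow> 'b" where
  "weighted_sum M [] = (\<lambda>j u. \<zero>\<^bsub>M j\<^esub>)"
| "weighted_sum M ((x, \<theta>) # ps) =
     (\<lambda>j u. weighted_sum M ps j u \<oplus>\<^bsub>M j\<^esub> x \<odot>\<^bsub>M j\<^esub> \<theta> j u)"

lemma weighted_sum_closed:
  assumes "graded_module R M" "set (map fst ps) \<subseteq> carrier R"
    "\<And>\<theta> j. \<theta> \<in> set (map snd ps) \<Longrightarrow> linear_map R (M j) (M j) (\<theta> j)"
  shows "u \<in> carrier (M j) \<Longrightarrow> weighted_sum M ps j u \<in> carrier (M j)"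
proof -
  interpret graded_module R M by fact
  show "u \<in> carrier (M j) \<Longrightarrow> weighted_sum M ps j u \<in> carrier (M j)"
    using assms(2,3)
  proof (induction ps)
    case (Cons p ps)
    obtain x \<theta> where p: "p = (x, \<theta>)" by (cases p)
    have "\<theta> j u \<in> carrier (M j)"
      using Cons.prems(1) Cons.prems(3)[of \<theta> j] p by (auto simp: linear_map_def additive_map_def)
    moreover have "weighted_sum M ps j u \<in> carrier (M j)" using Cons by simp
    ultimately show ?case using Cons.prems(2) p by simp
  qed simp
qed

lemma koszul_map_carrier:
  assumes "\<And>j u. u \<in> carrier (M j) \<Longrightarrow> f j u \<in> carrier (M j)"
  shows "u \<in> carrier (koszul_module M n j) \<Longrightarrow> koszul_map n f j u \<in> carrier (koszul_module M n j)"
  by (induction n arbitrary: j u) (simp_all add: cone_map_def cone_carrier assms)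

text \<open>Starts from the zero homotopy of the zero map; each list entry passes to a cone and adds
  its term \<open>x\<close> times \<theta>. Since commutators go one filtration step further, the
  same \<open>h\<close> works modulo the next step at every level \<open>s\<close>.\<close>

lemma koszul_homotopy_exists:
  assumes filt: "\<And>s. subcomplex R M d (S s)"
    and xs: "set (map fst ps) \<subseteq> carrier R"
    and lin: "\<And>\<theta> j. \<theta> \<in> set (map snd ps) \<Longrightarrow> linear_map R (M j) (M j) (\<theta> j)"
    and \<theta>S: "\<And>\<theta> s j u. \<theta> \<in> set (map snd ps) \<Longrightarrow> u \<in> S s j \<Longrightarrow> \<theta> j u \<in> S s j"
    and comm: "\<And>\<theta> s j u. \<theta> \<in> set (map snd ps) \<Longrightarrow> u \<in> S s j \<Longrightarrow>
        d j (\<theta> j u) \<ominus>\<^bsub>M (j + 1)\<^esub> \<theta> (j + 1) (d j u) \<in> S (Suc s) (j + 1)"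
  shows "\<exists>h. (\<forall>j. linear_map R (koszul_module M (length ps) j) (koszul_module M (length ps) (j - 1)) (h j)) \<and>
    (\<forall>s. homotopy_mod R (koszul_module M (length ps)) (koszul_diff M d (map fst ps))
      (koszul_set (length ps) (S s)) (koszul_set (length ps) (S (Suc s))) h
      (koszul_map (length ps) (weighted_sum M ps)))"
  using xs lin \<theta>S comm
proof (induction ps)
  case Nil
  interpret S: subcomplex R M d "S s" for s by (rule filt)
  show ?case
    by (rule exI[of _ "\<lambda>j u. \<zero>\<^bsub>M (j - 1)\<^esub>"])
      (auto simp: linear_map_def additive_map_def homotopy_mod_def S.M.minus_eq S.M.r_neg)
next
  case (Cons p ps)
  obtain x \<theta> where p: "p = (x, \<theta>)" by (cases p)
  let ?n = "length ps"
  have gM: "graded_module R M" using filt[of 0] by (simp add: subcomplex_def cochain_complex_def)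
  obtain h where h: "\<And>j. linear_map R (koszul_module M ?n j) (koszul_module M ?n (j - 1)) (h j)"
    and hm: "\<And>s. homotopy_mod R (koszul_module M ?n) (koszul_diff M d (map fst ps))
      (koszul_set ?n (S s)) (koszul_set ?n (S (Suc s))) h (koszul_map ?n (weighted_sum M ps))"
    using Cons.IH Cons.prems by (metis (no_types, lifting) insert_iff insert_subset list.set(2) list.simps(9))
  have x: "x \<in> carrier R" and ps: "set (map fst ps) \<subseteq> carrier R" using Cons.prems p by auto
  have th: "\<And>j. linear_map R (M j) (M j) (\<theta> j)" using Cons.prems(2) p by auto
  note thn = koszul_map_linear[where f = \<theta>, OF gM th]
  have sub: "subcomplex R (koszul_module M ?n) (koszul_diff M d (map fst ps)) (koszul_set ?n (S s))" for s
    using koszul_subcomplex[OF filt ps] by simp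
  have gK: "graded_module R (koszul_module M ?n)" by (rule koszul_graded_module[OF gM])
  have eq: "(\<lambda>j u. koszul_map ?n (weighted_sum M ps) j u \<oplus>\<^bsub>koszul_module M ?n j\<^esub>
      x \<odot>\<^bsub>koszul_module M ?n j\<^esub> koszul_map ?n \<theta> j u) = koszul_map ?n (weighted_sum M (p # ps))"
    unfolding p weighted_sum.simps by (rule ext, rule ext, rule koszul_map_sum[symmetric])
  have "homotopy_mod R (cone_module (koszul_module M ?n))
      (cone_diff (koszul_module M ?n) x (koszul_diff M d (map fst ps)))
      (cone_set (koszul_set ?n (S s))) (cone_set (koszul_set ?n (S (Suc s))))
      (cone_homotopy (koszul_module M ?n) (koszul_map ?n \<theta>) h)
      (cone_map (\<lambda>j u. koszul_map ?n (weighted_sum M ps) j u \<oplus>\<^bsub>koszul_module M ?n j\<^esub>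
         x \<odot>\<^bsub>koszul_module M ?n j\<^esub> koszul_map ?n \<theta> j u))" for s
  proof (rule cone_homotopy_mod[OF sub sub x h thn _ _ _ hm])
    show "koszul_map ?n (weighted_sum M ps) j \<in> carrier (koszul_module M ?n j) \<rightarrow> carrier (koszul_module M ?n j)" for j
      using Cons.prems(2) by (intro funcsetI koszul_map_carrier weighted_sum_closed[OF gM ps]) auto
    show "koszul_map ?n \<theta> j u \<in> koszul_set ?n (S s) j" if "u \<in> koszul_set ?n (S s) j" for j u
      using that Cons.prems(3) p by (intro koszul_map_set) auto
    show "koszul_diff M d (map fst ps) j (koszul_map ?n \<theta> j u) \<ominus>\<^bsub>koszul_module M ?n (j + 1)\<^esub>
        koszul_map ?n \<theta> (j + 1) (koszul_diff M d (map fst ps) j u) \<in> koszul_set ?n (S (Suc s)) (j + 1)"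
      if "u \<in> koszul_set ?n (S s) j" for j u
      using koszul_map_commutator[where f = \<theta>, OF filt filt th, of s "Suc s" "map fst ps" u j] that ps Cons.prems(4) p
      by simp
  qed
  moreover have "linear_map R (cone_module (koszul_module M ?n) j) (cone_module (koszul_module M ?n) (j - 1))
      (cone_homotopy (koszul_module M ?n) (koszul_map ?n \<theta>) h j)" for j
    by (rule cone_homotopy_linear[OF gK h thn])
  ultimately show ?case unfolding eq
    by (intro exI[of _ "cone_homotopy (koszul_module M ?n) (koszul_map ?n \<theta>) h"]) (simp add: p)
qed

text \<open>The truncation to degrees above \<open>s\<close>, a subcomplex because \<open>d\<close>
  raises degrees. For \<open>s = 0\<close> it omits \<open>M 0\<close>, which for the Cech complex
  is the copy of the ring.\<close>

definition tail_set :: "(int \<Rightarrow> ('a, 'b) module) \<Rightarrow> nat \<Rightarrow> int \<Rightarrow> 'b set" where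
  "tail_set M s j = (if int s < j then carrier (M j) else {\<zero>\<^bsub>M j\<^esub>})"

lemma (in cochain_complex) tail_subcomplex: "subcomplex R M d (tail_set M s)"
proof (rule subcomplex.intro[OF is_cochain_complex subcomplex_axioms.intro], goal_cases)
  case (1 j)
  show ?case
    by (rule M.submoduleI) (auto simp: tail_set_def M.add.inv_one[folded a_inv_def])
qed (auto simp: tail_set_def split: if_splits)

lemma (in abelian_group) cancel_common_summand:
  assumes [simp]: "p \<in> carrier G" "q \<in> carrier G" "r \<in> carrier G"
  shows "(q \<oplus> p) \<ominus> (r \<oplus> q) = p \<ominus> r"
proof -
  have "(q \<oplus> p) \<ominus> (r \<oplus> q) = (p \<ominus> r) \<oplus> (q \<oplus> \<ominus> q)"
    by (simp only: minus_eq minus_add minus_minus assms a_ac a_closed a_inv_closed)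
  then show ?thesis by (simp add: r_neg)
qed

text \<open>Only coefficient degrees up to \<open>j\<close> occur in Koszul degree \<open>j\<close>,
  so the filtration by tails ends after finitely many steps in each degree.\<close>

lemma koszul_set_tail_zero:
  "u \<in> koszul_set n (tail_set M s) j \<Longrightarrow> j \<le> int s \<Longrightarrow> u = \<zero>\<^bsub>koszul_module M n j\<^esub>"
proof (induction n arbitrary: u j)
  case (Suc n)
  from Suc.IH[of "evens u" j] Suc.IH[of "odds u" "j - 1"] Suc.prems
  show ?case by (simp add: cone_set_def cone_zero eq_join_iff)
qed (simp add: tail_set_def)

lemma koszul_set_mono:
  assumes "\<And>j. S j \<subseteq> T j" shows "koszul_set n S j \<subseteq> koszul_set n T j"
proof (induction n arbitrary: j)
  case (Suc n)
  show ?case unfolding koszul_set.simps cone_set_def using Suc[of j] Suc[of "j - 1"] by auto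
qed (use assms in simp)

text \<open>Successive approximation: a cocycle \<open>w\<close> in step \<open>s\<close> of the
  filtration differs from the coboundary of \<open>h w\<close> by an element of step
  \<open>Suc s\<close>. The remainder is pushed along until no degree is left for it.\<close>

lemma koszul_tail_exact:
  assumes C: "cochain_complex R M d" and xs: "set (map fst ps) \<subseteq> carrier R"
    and \<theta>_lin: "\<And>\<theta> j. \<theta> \<in> set (map snd ps) \<Longrightarrow> linear_map R (M j) (M j) (\<theta> j)"
    and id: "\<And>j u. j > 0 \<Longrightarrow> u \<in> carrier (M j) \<Longrightarrow> weighted_sum M ps j u = u"
    and n: "n = length ps"
    and z: "z \<in> koszul_set n (tail_set M 0) j"
    and dz: "koszul_diff M d (map fst ps) j z = \<zero>\<^bsub>koszul_module M n (j + 1)\<^esub>"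
  shows "\<exists>k\<in>koszul_set n (tail_set M 0) (j - 1). koszul_diff M d (map fst ps) (j - 1) k = z"
proof -
  interpret cochain_complex R M d by fact
  let ?D = "koszul_diff M d (map fst ps)" and ?K = "koszul_module M n"
  let ?G = "\<lambda>s. koszul_set n (tail_set M s)" and ?\<psi> = "koszul_map n (weighted_sum M ps)"
  interpret G: subcomplex R ?K ?D "?G s" for s
    using koszul_subcomplex[OF tail_subcomplex xs] by (simp add: n)
  have zero: "weighted_sum M ps j \<zero>\<^bsub>M j\<^esub> = \<zero>\<^bsub>M j\<^esub>" for j
    using xs \<theta>_lin
  proof (induction ps)
    case (Cons p ps)
    obtain x \<theta> where p: "p = (x, \<theta>)" by (cases p)
    have "\<theta> j \<zero>\<^bsub>M j\<^esub> = \<zero>\<^bsub>M j\<^esub>"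
      using linear_mapD(2)[of j j "\<theta> j"] Cons.prems p by auto
    then show ?case using Cons p by simp
  qed simp
  have mono: "?G s i \<subseteq> ?G 0 i" for s i
  proof (rule koszul_set_mono)
    show "tail_set M s j \<subseteq> tail_set M 0 j" for j by (auto simp: tail_set_def)
  qed
  have \<psi>: "?\<psi> i u = u" if "u \<in> ?G s i" for i s u
  proof (rule koszul_map_id[of "tail_set M 0"])
    show "u \<in> ?G 0 i" using that mono by blast
    show "weighted_sum M ps j u = u" if "u \<in> tail_set M 0 j" for j u
      using that id zero by (auto simp: tail_set_def split: if_splits)
  qed
  have "\<exists>h. (\<forall>j. linear_map R (koszul_module M (length ps) j) (koszul_module M (length ps) (j - 1)) (h j)) \<and>
    (\<forall>s. homotopy_mod R (koszul_module M (length ps)) (koszul_diff M d (map fst ps))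
      (koszul_set (length ps) (tail_set M s)) (koszul_set (length ps) (tail_set M (Suc s))) h
      (koszul_map (length ps) (weighted_sum M ps)))"
  proof (rule koszul_homotopy_exists[where S = "tail_set M", OF tail_subcomplex xs])
    show "linear_map R (M j) (M j) (\<theta> j)" if "\<theta> \<in> set (map snd ps)" for \<theta> j
      using that by (rule \<theta>_lin)
    fix \<theta> s j u assume \<theta>: "\<theta> \<in> set (map snd ps)" and u: "u \<in> tail_set M s j"
    note t = linear_mapD(1)[OF \<theta>_lin[OF \<theta>]] linear_mapD(2)[OF \<theta>_lin[OF \<theta>]]
    show "\<theta> j u \<in> tail_set M s j" using u t by (auto simp: tail_set_def split: if_splits)
    \<comment> \<open>The maps \<theta> preserve degrees and \<open>d\<close> raises them by one, so
      any commutator moves to the next tail by itself.\<close>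
    show "d j (\<theta> j u) \<ominus>\<^bsub>M (j + 1)\<^esub> \<theta> (j + 1) (d j u) \<in> tail_set M (Suc s) (j + 1)"
      using u t by (auto simp: tail_set_def M.minus_eq M.r_neg split: if_splits)
  qed
  then obtain h where h: "\<And>j. linear_map R (?K j) (?K (j - 1)) (h j)"
    and hm: "\<And>s. homotopy_mod R ?K ?D (?G s) (?G (Suc s)) h ?\<psi>"
    unfolding n by blast
  have step: "\<exists>k\<in>?G 0 (j - 1). z \<ominus>\<^bsub>?K j\<^esub> ?D (j - 1) k \<in> ?G s j" for s
  proof (induction s)
    case 0
    show ?case using z by (intro bexI[of _ "\<zero>\<^bsub>?K (j - 1)\<^esub>"]) auto
  next
    case (Suc s)
    then obtain k where k: "k \<in> ?G 0 (j - 1)" "z \<ominus>\<^bsub>?K j\<^esub> ?D (j - 1) k \<in> ?G s j" by blast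
    define w where "w = z \<ominus>\<^bsub>?K j\<^esub> ?D (j - 1) k"
    have w: "w \<in> ?G s j" using k by (simp add: w_def)
    have zc: "z \<in> carrier (?K j)" "k \<in> carrier (?K (j - 1))" using z k by auto
    then have dw: "?D j w = \<zero>\<^bsub>?K (j + 1)\<^esub>" using dz by (simp add: w_def G.M.minus_eq G.M.r_neg)
    have hw: "h j w \<in> ?G s (j - 1)" "h j w \<in> carrier (?K (j - 1))"
      using hm[of s] w G.sub_carrier by (auto simp: homotopy_mod_def)
    have h0: "h (j + 1) \<zero>\<^bsub>?K (j + 1)\<^esub> = \<zero>\<^bsub>?K j\<^esub>" using G.linear_mapD(2)[OF h] by simp
    have "?D (j - 1) (h j w) \<oplus>\<^bsub>?K j\<^esub> h (j + 1) (?D j w) \<ominus>\<^bsub>?K j\<^esub> ?\<psi> j w \<in> ?G (Suc s) j"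
      using hm[of s] w unfolding homotopy_mod_def by blast
    \<comment> \<open>As \<open>w\<close> is a cocycle, the term with \<open>h\<close> after the
      differential drops out; on tails the weighted sum is the identity.\<close>
    then have "?D (j - 1) (h j w) \<ominus>\<^bsub>?K j\<^esub> w \<in> ?G (Suc s) j"
      using hw by (simp add: \<psi>[OF w] dw h0)
    then have "\<ominus>\<^bsub>?K j\<^esub> (?D (j - 1) (h j w) \<ominus>\<^bsub>?K j\<^esub> w) \<in> ?G (Suc s) j" by simp
    also have "\<ominus>\<^bsub>?K j\<^esub> (?D (j - 1) (h j w) \<ominus>\<^bsub>?K j\<^esub> w) = z \<ominus>\<^bsub>?K j\<^esub> ?D (j - 1) (k \<oplus>\<^bsub>?K (j - 1)\<^esub> h j w)"
      using zc hw by (simp add: w_def G.M.minus_eq G.M.minus_add G.M.a_ac)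
    finally show ?case
      using k hw mono by (intro bexI[of _ "k \<oplus>\<^bsub>?K (j - 1)\<^esub> h j w"]) auto
  qed
  \<comment> \<open>Step \<open>nat j\<close> is far enough in Koszul degree \<open>j\<close>; for
    negative \<open>j\<close> it is step 0.\<close>
  from step[of "nat j"] obtain k where k: "k \<in> ?G 0 (j - 1)" "z \<ominus>\<^bsub>?K j\<^esub> ?D (j - 1) k \<in> ?G (nat j) j"
    by blast
  from koszul_set_tail_zero[OF k(2)] have "z \<ominus>\<^bsub>?K j\<^esub> ?D (j - 1) k = \<zero>\<^bsub>?K j\<^esub>" by simp
  then have "z = ?D (j - 1) k"
    using k z G.sub_carrier by (subst (asm) G.M.a_minus_eq_zero_iff) auto
  then show ?thesis using k by auto
qed

section \<open>The top Koszul summand and annihilators of relations\<close>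

primrec top_comp :: "nat \<Rightarrow> (nat \<Rightarrow> 'b) \<Rightarrow> nat \<Rightarrow> 'b" where
  "top_comp 0 u = u"
| "top_comp (Suc n) u = top_comp n (odds u)"

text \<open>In Koszul degree \<open>n\<close> over \<open>n\<close> elements exactly one summand has
  coefficients in \<open>M 0\<close>: the multiples of the product of all exterior generators. It is
  reached by taking the odd part \<open>n\<close> times; \<open>top_incl\<close> and
  \<open>top_comp\<close> are its inclusion and projection.\<close>

primrec top_incl :: "(int \<Rightarrow> ('a, nat \<Rightarrow> 'b) module) \<Rightarrow> nat \<Rightarrow> (nat \<Rightarrow> 'b) \<Rightarrow> nat \<Rightarrow> 'b" where
  "top_incl M 0 a = a"
| "top_incl M (Suc n) a = join \<zero>\<^bsub>koszul_module M n (int n + 1)\<^esub> (top_incl M n a)"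

lemma top_comp_incl [simp]: "top_comp n (top_incl M n a) = a"
  by (induction n) auto

lemma top_comp_linear:
  assumes "graded_module R M"
  shows "linear_map R (koszul_module M n (int n)) (M 0) (top_comp n)"
proof (induction n)
  case 0
  interpret graded_module R M by fact
  show ?case by (simp add: linear_map_def additive_map_def)
next
  case (Suc n)
  then show ?case
    by (auto simp: linear_map_def additive_map_def cone_carrier cone_add cone_smult)
qed

lemma top_incl_linear:
  assumes "graded_module R M"
  shows "linear_map R (M 0) (koszul_module M n (int n)) (top_incl M n)"
proof (induction n)
  case 0
  interpret graded_module R M by fact
  show ?case by (simp add: linear_map_def additive_map_def)
next
  case (Suc n)
  interpret graded_module R "koszul_module M n" by (rule koszul_graded_module) fact
  from Suc show ?case
    by (auto simp: linear_map_def additive_map_def cone_carrier cone_add cone_smult add.commute[of 1 "int n"])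
qed

lemma top_comp_tail:
  assumes "u \<in> koszul_set n (tail_set M 0) (int n)"
  shows "top_comp n u = \<zero>\<^bsub>M 0\<^esub>"
  using assms by (induction n arbitrary: u) (auto simp: tail_set_def cone_set_def)

text \<open>Each multiplication in the Koszul differential adds an exterior generator, and the top
  summand already has them all. Only the coefficient differential acts, and its values have degree
  1.\<close>

lemma d_top_incl:
  assumes C: "cochain_complex R M d" and xs: "set xs \<subseteq> carrier R" and a: "a \<in> carrier (M 0)"
  shows "koszul_diff M d xs (int (length xs)) (top_incl M (length xs) a)
    \<in> koszul_set (length xs) (tail_set M 0) (int (length xs) + 1)"
  using xs
proof (induction xs)
  case Nil
  interpret cochain_complex R M d by fact
  show ?case using a by (auto simp: tail_set_def)
next
  case (Cons x xs)
  let ?n = "length xs"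
  interpret C: cochain_complex R M d by fact
  interpret G: subcomplex R "koszul_module M ?n" "koszul_diff M d xs" "koszul_set ?n (tail_set M 0)"
    using koszul_subcomplex[OF C.tail_subcomplex, of xs] Cons.prems by simp
  have len: "int (Suc ?n) = int ?n + 1" "int (Suc ?n) + 1 = int ?n + 2" "int ?n + 1 + 1 = int ?n + 2" by simp_all
  have t: "koszul_diff M d xs (int ?n) (top_incl M ?n a) \<in> koszul_set ?n (tail_set M 0) (int ?n + 1)"
    using Cons by simp
  have x: "x \<in> carrier R" using Cons.prems by simp
  have "koszul_diff M d (x # xs) (int ?n + 1) (top_incl M (Suc ?n) a) =
      join \<zero>\<^bsub>koszul_module M ?n (int ?n + 2)\<^esub> (\<ominus>\<^bsub>koszul_module M ?n (int ?n + 1)\<^esub>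
        koszul_diff M d xs (int ?n) (top_incl M ?n a))"
    using x G.sub_carrier[OF t] by (simp add: cone_diff_def G.M.minus_eq add.commute[of 2])
  also have "\<dots> \<in> koszul_set (Suc ?n) (tail_set M 0) (int ?n + 2)"
    using G.sub_neg[OF t] G.sub_zero[of "int ?n + 2"] by (simp add: cone_set_def add.commute[of 1 "int ?n"])
  finally have "koszul_diff M d (x # xs) (int (Suc ?n)) (top_incl M (Suc ?n) a)
      \<in> koszul_set (Suc ?n) (tail_set M 0) (int (Suc ?n) + 1)"
    using len by (simp only:)
  then show ?case by (simp only: length_Cons)
qed

lemma (in cring) Idl_insert:
  assumes x: "x \<in> carrier R" and A: "A \<subseteq> carrier R" and a: "a \<in> Idl (insert x A)"
  obtains a0 s where "a0 \<in> Idl A" "s \<in> carrier R" "a = a0 \<oplus> s \<otimes> x"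
proof -
  have I: "ideal (Idl A) R" "ideal (PIdl x) R"
    using A x by (auto intro: genideal_ideal cgenideal_ideal)
  interpret A: ideal "Idl A" R by fact
  interpret X: ideal "PIdl x" R by fact
  have "insert x A \<subseteq> Idl A <+> PIdl x"
  proof
    fix y assume "y \<in> insert x A"
    then show "y \<in> Idl A <+> PIdl x"
    proof
      assume "y = x"
      moreover have "\<zero> \<oplus> x \<in> Idl A <+> PIdl x"
        using cgenideal_self[OF x] A.zero_closed unfolding set_add_def' by blast
      ultimately show ?thesis using x by simp
    next
      assume "y \<in> A"
      moreover from this have "y \<oplus> \<zero> \<in> Idl A <+> PIdl x"
        using genideal_self[OF A] X.zero_closed unfolding set_add_def' by blast
      ultimately show ?thesis using A by auto
    qed
  qed
  then have "a \<in> Idl A <+> PIdl x"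
    using genideal_minimal[OF add_ideals[OF I]] a by blast
  then obtain a0 y where "a0 \<in> Idl A" "y \<in> PIdl x" "a = a0 \<oplus> y"
    unfolding set_add_def' by blast
  then show ?thesis using that unfolding cgenideal_def by blast
qed

lemma (in cring) Idl_insertI:
  assumes x: "x \<in> carrier R" and A: "A \<subseteq> carrier R" and a: "a \<in> Idl A" "s \<in> carrier R"
  shows "a \<oplus> s \<otimes> x \<in> Idl (insert x A)"
proof -
  have xA: "insert x A \<subseteq> carrier R" using assms by auto
  interpret I: ideal "Idl (insert x A)" R by (rule genideal_ideal[OF xA])
  have "x \<in> Idl (insert x A)" using genideal_self[OF xA] by auto
  moreover have "Idl A \<subseteq> Idl (insert x A)"
    using genideal_self[OF xA] by (intro genideal_minimal[OF I.is_ideal]) auto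
  ultimately show ?thesis using a(1) I.I_l_closed[OF _ a(2)] by (intro I.a_closed) auto
qed

lemma (in cring) Idl_empty: "Idl {} = {\<zero>}"
proof -
  interpret I: ideal "Idl {}" R by (rule genideal_ideal) simp
  show ?thesis using genideal_minimal[OF zeroideal, of "{}"] I.zero_closed by blast
qed

text \<open>Over a ring the top Koszul cohomology is the quotient by the ideal, so its elements are
  coboundaries in top degree. With coefficients in a complex the same cochain leaves behind terms
  with a coefficient differential, all of positive degree.\<close>

lemma koszul_boundary_of_ideal:
  fixes R (structure)
  assumes C: "cochain_complex R M d" and "set xs \<subseteq> carrier R" "a \<in> Idl (set xs)" "\<epsilon> \<in> carrier (M 0)"
  shows "\<exists>z\<in>carrier (koszul_module M (length xs) (int (length xs) - 1)).
    koszul_diff M d xs (int (length xs) - 1) z \<ominus>\<^bsub>koszul_module M (length xs) (int (length xs))\<^esub>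
      top_incl M (length xs) (a \<odot>\<^bsub>M 0\<^esub> \<epsilon>)
    \<in> koszul_set (length xs) (tail_set M 0) (int (length xs))"
  using assms(2-)
proof (induction xs arbitrary: a)
  case Nil
  interpret cochain_complex R M d by (fact C)
  from Nil show ?case
    by (intro bexI[of _ "\<zero>\<^bsub>M (- 1)\<^esub>"])
      (use d_zero[of "-1"] in \<open>auto simp: Idl_empty tail_set_def M.minus_eq M.r_neg simp del: d_zero\<close>)
next
  case (Cons x xs)
  interpret cochain_complex R M d by (fact C)
  let ?n = "length xs" let ?K = "koszul_module M ?n" and ?D = "koszul_diff M d xs"
  have x: "x \<in> carrier R" and xs: "set xs \<subseteq> carrier R" using Cons.prems by auto
  interpret G: subcomplex R ?K ?D "koszul_set ?n (tail_set M 0)"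
    using koszul_subcomplex[OF tail_subcomplex xs] .
  interpret GC: subcomplex R "koszul_module M (Suc ?n)" "koszul_diff M d (x # xs)" "koszul_set (Suc ?n) (tail_set M 0)"
    using koszul_subcomplex[OF tail_subcomplex, of "x # xs"] Cons.prems by simp
  from Cons.prems(2) obtain a0 s where a0: "a0 \<in> Idl (set xs)" and s: "s \<in> carrier R"
    and a: "a = a0 \<oplus> s \<otimes> x"
    using Idl_insert[OF x xs] by auto
  have a0c: "a0 \<in> carrier R"
    using a0 xs by (meson genideal_ideal ideal.Icarr)
  obtain z where z: "z \<in> carrier (?K (int ?n - 1))"
    "?D (int ?n - 1) z \<ominus>\<^bsub>?K (int ?n)\<^esub> top_incl M ?n (a0 \<odot>\<^bsub>M 0\<^esub> \<epsilon>) \<in> koszul_set ?n (tail_set M 0) (int ?n)"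
    using Cons.IH[OF xs a0 Cons.prems(3)] by blast
  note t = top_incl_linear[OF is_graded_module, of ?n]
  have tc: "top_incl M ?n b \<in> carrier (?K (int ?n))" if "b \<in> carrier (M 0)" for b
    using t that by (auto simp: linear_map_def additive_map_def)
  have ta: "top_incl M ?n (b \<oplus>\<^bsub>M 0\<^esub> c) = top_incl M ?n b \<oplus>\<^bsub>?K (int ?n)\<^esub> top_incl M ?n c"
    if "b \<in> carrier (M 0)" "c \<in> carrier (M 0)" for b c
    using t that by (auto simp: linear_map_def additive_map_def)
  have ts: "top_incl M ?n (r \<odot>\<^bsub>M 0\<^esub> b) = r \<odot>\<^bsub>?K (int ?n)\<^esub> top_incl M ?n b"
    if "b \<in> carrier (M 0)" "r \<in> carrier R" for b r
    using t that by (auto simp: linear_map_def additive_map_def)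
  define e where "e = top_incl M ?n \<epsilon>"
  have e: "e \<in> carrier (?K (int ?n))" using Cons.prems tc by (simp add: e_def)
  \<comment> \<open>With \<open>a = a0 + s x\<close>, the entry \<open>s e\<close> produces
    \<open>s x\<close> in the top summand, and \<open>- z\<close> produces \<open>a0\<close> after
    the sign in \<open>cone_diff\<close>.\<close>
  define w where "w = join (s \<odot>\<^bsub>?K (int ?n)\<^esub> e) (\<ominus>\<^bsub>?K (int ?n - 1)\<^esub> z)"
  have w: "w \<in> carrier (koszul_module M (Suc ?n) (int ?n))"
    using s e z by (simp add: w_def cone_carrier)
  have dw: "koszul_diff M d (x # xs) (int ?n) w = join (s \<odot>\<^bsub>?K (int ?n + 1)\<^esub> ?D (int ?n) e)
      (x \<odot>\<^bsub>?K (int ?n)\<^esub> (s \<odot>\<^bsub>?K (int ?n)\<^esub> e) \<oplus>\<^bsub>?K (int ?n)\<^esub> ?D (int ?n - 1) z)"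
    using s e z x by (simp add: w_def cone_diff_def G.M.minus_eq)
  have te: "top_incl M ?n (a \<odot>\<^bsub>M 0\<^esub> \<epsilon>) = a0 \<odot>\<^bsub>?K (int ?n)\<^esub> e \<oplus>\<^bsub>?K (int ?n)\<^esub> x \<odot>\<^bsub>?K (int ?n)\<^esub> (s \<odot>\<^bsub>?K (int ?n)\<^esub> e)"
    using s x a0c e Cons.prems(3)
    by (simp add: a ts e_def[symmetric] G.M.smult_l_distr G.M.smult_assoc1[symmetric] m_comm)
  have 1: "?D (int ?n) e \<in> koszul_set ?n (tail_set M 0) (int ?n + 1)"
    unfolding e_def using d_top_incl[OF is_cochain_complex xs] Cons.prems(3) by simp
  have 2: "x \<odot>\<^bsub>?K (int ?n)\<^esub> (s \<odot>\<^bsub>?K (int ?n)\<^esub> e) \<oplus>\<^bsub>?K (int ?n)\<^esub> ?D (int ?n - 1) z \<ominus>\<^bsub>?K (int ?n)\<^esub>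
      top_incl M ?n (a \<odot>\<^bsub>M 0\<^esub> \<epsilon>) = ?D (int ?n - 1) z \<ominus>\<^bsub>?K (int ?n)\<^esub> top_incl M ?n (a0 \<odot>\<^bsub>M 0\<^esub> \<epsilon>)"
    unfolding te using s x a0c e z Cons.prems(3)
    by (simp add: ts e_def[symmetric] G.M.cancel_common_summand)
  have wc: "join (s \<odot>\<^bsub>?K (int ?n + 1)\<^esub> ?D (int ?n) e)
      (x \<odot>\<^bsub>?K (int ?n)\<^esub> (s \<odot>\<^bsub>?K (int ?n)\<^esub> e) \<oplus>\<^bsub>?K (int ?n)\<^esub> ?D (int ?n - 1) z)
      \<in> carrier (cone_module ?K (int ?n + 1))"
    using s x e z by (simp add: cone_carrier)
  have tic: "join \<zero>\<^bsub>?K (int ?n + 1)\<^esub> (top_incl M ?n (a \<odot>\<^bsub>M 0\<^esub> \<epsilon>)) \<in> carrier (cone_module ?K (int ?n + 1))"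
    using Cons.prems(3) a a0c s x by (simp add: cone_carrier tc)
  have "koszul_diff M d (x # xs) (int ?n) w \<ominus>\<^bsub>cone_module ?K (int ?n + 1)\<^esub>
      join \<zero>\<^bsub>?K (int ?n + 1)\<^esub> (top_incl M ?n (a \<odot>\<^bsub>M 0\<^esub> \<epsilon>)) \<in> cone_set (koszul_set ?n (tail_set M 0)) (int ?n + 1)"
    unfolding dw cone_minus[OF G.is_graded_module wc tic] evens_join odds_join
    using 1 2 z s by (simp add: cone_set_def)
  then show ?case
    using w by (intro bexI[of _ w]) (simp_all add: add.commute[of 1 "int ?n"])
qed

text \<open>The converse direction: the top summand receives only multiples of members of
  \<open>xs\<close>, because a coefficient differential into \<open>M 0\<close> would start in
  \<open>M (- 1)\<close>, which is zero.\<close>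

lemma top_comp_boundary:
  fixes R (structure)
  assumes C: "cochain_complex R M d" and neg: "carrier (M (- 1)) = {\<zero>\<^bsub>M (- 1)\<^esub>}" and \<epsilon>: "\<epsilon> \<in> carrier (M 0)"
    and gen: "\<And>u. u \<in> carrier (M 0) \<Longrightarrow> \<exists>r\<in>carrier R. u = r \<odot>\<^bsub>M 0\<^esub> \<epsilon>"
    and "set xs \<subseteq> carrier R" "w \<in> carrier (koszul_module M (length xs) (int (length xs) - 1))"
  shows "\<exists>a\<in>Idl (set xs). top_comp (length xs) (koszul_diff M d xs (int (length xs) - 1) w) = a \<odot>\<^bsub>M 0\<^esub> \<epsilon>"
  using assms(5,6)
proof (induction xs arbitrary: w)
  case Nil
  interpret cochain_complex R M d by (fact C)
  from Nil show ?case using neg \<epsilon> d_zero[of "-1"] by (simp add: Idl_empty del: d_zero)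
next
  case (Cons x xs)
  interpret cochain_complex R M d by (fact C)
  let ?n = "length xs" let ?K = "koszul_module M ?n" and ?D = "koszul_diff M d xs"
  have x: "x \<in> carrier R" and xs: "set xs \<subseteq> carrier R" using Cons.prems by auto
  interpret K: cochain_complex R ?K ?D by (rule koszul_complex[OF is_cochain_complex xs])
  have w: "evens w \<in> carrier (?K (int ?n))" "odds w \<in> carrier (?K (int ?n - 1))"
    using Cons.prems by (simp_all add: cone_carrier)
  obtain a where a: "a \<in> Idl (set xs)" "top_comp ?n (?D (int ?n - 1) (odds w)) = a \<odot>\<^bsub>M 0\<^esub> \<epsilon>"
    using Cons.IH[OF xs w(2)] by blast
  note t = top_comp_linear[OF is_graded_module, of ?n]
  note add = additive_map_neg[OF K.M.abelian_group_axioms M.abelian_group_axioms, of "int ?n" 0 "top_comp ?n"]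
  have "top_comp ?n (evens w) \<in> carrier (M 0)"
    using t w by (auto simp: linear_map_def additive_map_def)
  then obtain r where r: "r \<in> carrier R" "top_comp ?n (evens w) = r \<odot>\<^bsub>M 0\<^esub> \<epsilon>" using gen by blast
  interpret I: ideal "Idl (set xs)" R by (rule genideal_ideal[OF xs])
  have ac: "a \<in> carrier R" using a I.Icarr by auto
  have "top_comp ?n (x \<odot>\<^bsub>?K (int ?n)\<^esub> evens w \<ominus>\<^bsub>?K (int ?n)\<^esub> ?D (int ?n - 1) (odds w)) =
      x \<odot>\<^bsub>M 0\<^esub> top_comp ?n (evens w) \<oplus>\<^bsub>M 0\<^esub> \<ominus>\<^bsub>M 0\<^esub> top_comp ?n (?D (int ?n - 1) (odds w))"
    using t w x add by (simp add: linear_map_def additive_map_def K.M.minus_eq)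
  also have "\<dots> = (\<ominus> a \<oplus> r \<otimes> x) \<odot>\<^bsub>M 0\<^esub> \<epsilon>"
    using \<epsilon> x r ac a by (simp add: M.smult_l_distr M.smult_l_minus M.smult_assoc1[symmetric] m_comm M.a_comm)
  finally show ?case
    using Idl_insertI[OF x xs, of "\<ominus> a" r] a(1) r by (auto simp: cone_diff_def)
qed

text \<open>A relation \<open>r x\<close> in the ideal of \<open>xs\<close> gives a cochain that is
  closed up to positive coefficient degrees. Exactness there corrects it to a cocycle;
  \<open>y\<close> times it is a coboundary, and the top summand then shows \<open>y r\<close> in
  the ideal. The element \<open>x\<close> stands at the head so that the even part of the outer cone
  is the Koszul complex of \<open>xs\<close>.\<close>

lemma koszul_annihilator:
  fixes R (structure)
  assumes C: "cochain_complex R M d"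
    and neg: "carrier (M (- 1)) = {\<zero>\<^bsub>M (- 1)\<^esub>}" and \<epsilon>: "\<epsilon> \<in> carrier (M 0)"
    and gen: "\<And>u. u \<in> carrier (M 0) \<Longrightarrow> \<exists>r\<in>carrier R. u = r \<odot>\<^bsub>M 0\<^esub> \<epsilon>"
    and faithful: "\<And>r s. r \<in> carrier R \<Longrightarrow> s \<in> carrier R \<Longrightarrow> r \<odot>\<^bsub>M 0\<^esub> \<epsilon> = s \<odot>\<^bsub>M 0\<^esub> \<epsilon> \<Longrightarrow> r = s"
    and x: "x \<in> carrier R" and xs: "set xs \<subseteq> carrier R" and ps: "map fst ps = x # xs"
    and \<theta>_lin: "\<And>\<theta> j. \<theta> \<in> set (map snd ps) \<Longrightarrow> linear_map R (M j) (M j) (\<theta> j)"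
    and id: "\<And>j u. j > 0 \<Longrightarrow> u \<in> carrier (M j) \<Longrightarrow> weighted_sum M ps j u = u"
    and kills: "cochain_complex.kills_cohomology (koszul_module M (Suc (length xs)))
      (koszul_diff M d (x # xs)) y (int (length xs))"
    and y: "y \<in> carrier R" and r: "r \<in> carrier R" "r \<otimes> x \<in> Idl (set xs)"
  shows "y \<otimes> r \<in> Idl (set xs)"
proof -
  interpret cochain_complex R M d by (fact C)
  let ?n = "length xs" let ?K = "koszul_module M ?n" and ?D = "koszul_diff M d xs"
  interpret G: subcomplex R ?K ?D "koszul_set ?n (tail_set M 0)"
    using koszul_subcomplex[OF tail_subcomplex xs] .
  interpret GC: subcomplex R "cone_module ?K" "cone_diff ?K x ?D" "cone_set (koszul_set ?n (tail_set M 0))"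
    using koszul_subcomplex[OF tail_subcomplex, of "x # xs"] x xs by simp
  have n: "Suc ?n = length ps" using ps by (metis length_Cons length_map)
  note ti = top_incl_linear[OF is_graded_module, of ?n]
  define t where "t = top_incl M ?n (r \<odot>\<^bsub>M 0\<^esub> \<epsilon>)"
  have t: "t \<in> carrier (?K (int ?n))"
    using ti r \<epsilon> by (auto simp: t_def linear_map_def additive_map_def)
  have xt: "top_incl M ?n ((r \<otimes> x) \<odot>\<^bsub>M 0\<^esub> \<epsilon>) = x \<odot>\<^bsub>?K (int ?n)\<^esub> t"
    using ti r x \<epsilon> by (simp add: t_def linear_map_def m_comm[of r x] M.smult_assoc1)
  obtain z where z: "z \<in> carrier (?K (int ?n - 1))"
    and dz: "?D (int ?n - 1) z \<ominus>\<^bsub>?K (int ?n)\<^esub> x \<odot>\<^bsub>?K (int ?n)\<^esub> t \<in> koszul_set ?n (tail_set M 0) (int ?n)"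
    using koszul_boundary_of_ideal[OF C xs r(2) \<epsilon>] unfolding xt by blast
  have dt: "?D (int ?n) t \<in> koszul_set ?n (tail_set M 0) (int ?n + 1)"
    unfolding t_def using d_top_incl[OF C xs] r \<epsilon> by simp
  \<comment> \<open>The pair encodes the relation: the second component of its differential is
    \<open>x t - D z\<close>, zero modulo the tail by the choice of \<open>z\<close>.\<close>
  have jz: "join t z \<in> carrier (cone_module ?K (int ?n))" using t z by (simp add: cone_carrier)
  have "\<ominus>\<^bsub>?K (int ?n)\<^esub> (?D (int ?n - 1) z \<ominus>\<^bsub>?K (int ?n)\<^esub> x \<odot>\<^bsub>?K (int ?n)\<^esub> t)
      = x \<odot>\<^bsub>?K (int ?n)\<^esub> t \<ominus>\<^bsub>?K (int ?n)\<^esub> ?D (int ?n - 1) z"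
    using z t x by (simp add: G.M.minus_eq G.M.minus_add G.M.a_comm)
  then have "x \<odot>\<^bsub>?K (int ?n)\<^esub> t \<ominus>\<^bsub>?K (int ?n)\<^esub> ?D (int ?n - 1) z \<in> koszul_set ?n (tail_set M 0) (int ?n)"
    using G.sub_neg[OF dz] by simp
  then have D: "cone_diff ?K x ?D (int ?n) (join t z) \<in> cone_set (koszul_set ?n (tail_set M 0)) (int ?n + 1)"
    using dt by (simp add: cone_set_def cone_diff_def)
  have "\<exists>k\<in>koszul_set (Suc ?n) (tail_set M 0) (int ?n + 1 - 1).
      koszul_diff M d (map fst ps) (int ?n + 1 - 1) k = cone_diff ?K x ?D (int ?n) (join t z)"
  proof (rule koszul_tail_exact[OF C _ _ _ n])
    show "linear_map R (M j) (M j) (\<theta> j)" if "\<theta> \<in> set (map snd ps)" for \<theta> j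
      using that by (rule \<theta>_lin)
    show "weighted_sum M ps j u = u" if "j > 0" "u \<in> carrier (M j)" for j u
      using that by (rule id)
    show "koszul_diff M d (map fst ps) (int ?n + 1) (cone_diff ?K x ?D (int ?n) (join t z)) =
        \<zero>\<^bsub>koszul_module M (Suc ?n) (int ?n + 1 + 1)\<^esub>"
      using GC.d_d[OF jz, of "int ?n + 1"] by (simp add: ps)
  qed (use ps x xs D in auto)
  then obtain k where k: "k \<in> cone_set (koszul_set ?n (tail_set M 0)) (int ?n)"
    "cone_diff ?K x ?D (int ?n) k = cone_diff ?K x ?D (int ?n) (join t z)"
    by (auto simp: ps)
  have kc: "k \<in> carrier (cone_module ?K (int ?n))" using k by auto
  \<comment> \<open>The correction \<open>k\<close> lies in the tail, so it makes a cocycle without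
    changing the top component.\<close>
  define v where "v = join t z \<ominus>\<^bsub>cone_module ?K (int ?n)\<^esub> k"
  have "v \<in> GC.cocycles (int ?n)"
    using jz kc k(2) by (simp add: v_def GC.cocycles_def GC.M.minus_eq GC.M.r_neg)
  then have "y \<odot>\<^bsub>cone_module ?K (int ?n)\<^esub> v \<in> GC.coboundaries (int ?n)"
    using kills by (simp add: GC.kills_cohomology_def)
  then obtain w where w: "w \<in> carrier (cone_module ?K (int ?n - 1))"
    "y \<odot>\<^bsub>cone_module ?K (int ?n)\<^esub> v = cone_diff ?K x ?D (int ?n - 1) w"
    by (rule GC.coboundariesE)
  have ew: "evens w \<in> carrier (?K (int ?n - 1))" using w by (simp add: cone_carrier)
  have ek: "evens k \<in> koszul_set ?n (tail_set M 0) (int ?n)" using k by (simp add: cone_set_def)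
  then have ekc: "evens k \<in> carrier (?K (int ?n))" by auto
  \<comment> \<open>The even part of a coboundary of the cone is a coboundary for \<open>xs\<close>
    alone; \<open>x\<close> does not occur in it.\<close>
  have "?D (int ?n - 1) (evens w) = evens (y \<odot>\<^bsub>cone_module ?K (int ?n)\<^esub> v)"
    unfolding w(2) by (simp add: cone_diff_def)
  also have "\<dots> = y \<odot>\<^bsub>?K (int ?n)\<^esub> (t \<ominus>\<^bsub>?K (int ?n)\<^esub> evens k)"
    unfolding v_def cone_minus[OF G.is_graded_module jz kc] by (simp add: cone_smult)
  finally have e: "?D (int ?n - 1) (evens w) = y \<odot>\<^bsub>?K (int ?n)\<^esub> (t \<ominus>\<^bsub>?K (int ?n)\<^esub> evens k)" .
  note tl = top_comp_linear[OF is_graded_module, of ?n]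
  have neg: "top_comp ?n (\<ominus>\<^bsub>?K (int ?n)\<^esub> evens k) = \<ominus>\<^bsub>M 0\<^esub> top_comp ?n (evens k)"
    by (rule additive_map_neg[OF G.M.abelian_group_axioms M.abelian_group_axioms _ ekc])
      (use tl in \<open>simp add: linear_map_def\<close>)
  have "top_comp ?n (y \<odot>\<^bsub>?K (int ?n)\<^esub> (t \<ominus>\<^bsub>?K (int ?n)\<^esub> evens k)) =
      y \<odot>\<^bsub>M 0\<^esub> (top_comp ?n t \<oplus>\<^bsub>M 0\<^esub> \<ominus>\<^bsub>M 0\<^esub> top_comp ?n (evens k))"
    using tl t ekc y by (simp add: linear_map_def additive_map_def neg G.M.minus_eq)
  also have "\<dots> = (y \<otimes> r) \<odot>\<^bsub>M 0\<^esub> \<epsilon>"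
    using top_comp_tail[OF ek] y r \<epsilon>
    by (simp add: t_def M.add.inv_one[folded a_inv_def] M.smult_assoc1)
  finally have "top_comp ?n (?D (int ?n - 1) (evens w)) = (y \<otimes> r) \<odot>\<^bsub>M 0\<^esub> \<epsilon>" unfolding e .
  moreover obtain a where "a \<in> Idl (set xs)" "top_comp ?n (?D (int ?n - 1) (evens w)) = a \<odot>\<^bsub>M 0\<^esub> \<epsilon>"
    using top_comp_boundary[OF C assms(2) \<epsilon> gen xs ew] by blast
  moreover have "a \<in> carrier R"
    using \<open>a \<in> Idl (set xs)\<close> genideal_ideal[OF xs] ideal.Icarr by metis
  ultimately show ?thesis using faithful[of "y \<otimes> r" a] y r by auto
qed

section \<open>Localization\<close>

text \<open>Operations on fractions are unions over representatives, so this reduces each formula to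
  independence of the representatives.\<close>

lemma UN_const_nonempty: "A \<noteq> {} \<Longrightarrow> (\<And>x. x \<in> A \<Longrightarrow> f x = c) \<Longrightarrow> (\<Union>x\<in>A. f x) = c"
  by auto

locale multiplicative_subset = cring R for R (structure) +
  fixes S
  assumes S_subset: "S \<subseteq> carrier R" and S_one: "\<one> \<in> S"
    and S_mult: "s \<in> S \<Longrightarrow> t \<in> S \<Longrightarrow> s \<otimes> t \<in> S"
begin

abbreviation "L \<equiv> localization R S"
abbreviation "frc \<equiv> fraction R S"

lemma S_carrier [simp, dest]: "s \<in> S \<Longrightarrow> s \<in> carrier R" using S_subset by auto

declare S_one [simp] S_mult [simp]

lemma loc_rel_iff: "((a, s), (b, t)) \<in> loc_rel R S \<longleftrightarrow> a \<in> carrier R \<and> s \<in> S \<and> b \<in> carrier R \<and> t \<in> S \<and>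
     (\<exists>u\<in>S. u \<otimes> (a \<otimes> t) = u \<otimes> (b \<otimes> s))"
  by (simp add: loc_rel_def)

lemma equiv_loc_rel: "equiv (carrier R \<times> S) (loc_rel R S)"
proof (rule equivI)
  show "loc_rel R S \<subseteq> (carrier R \<times> S) \<times> (carrier R \<times> S)" by (auto simp: loc_rel_def)
  show "refl_on (carrier R \<times> S) (loc_rel R S)"
    by (rule refl_onI) (auto simp: loc_rel_def)
  show "sym (loc_rel R S)" by (rule symI) (force simp: loc_rel_def)
  show "trans (loc_rel R S)"
  proof (rule transI)
    fix x y z assume xy: "(x, y) \<in> loc_rel R S" and yz: "(y, z) \<in> loc_rel R S"
    obtain a s b t c w where x: "x = (a, s)" "y = (b, t)" "z = (c, w)" by (metis surj_pair)
    from xy obtain u where u: "u \<in> S" "u \<otimes> (a \<otimes> t) = u \<otimes> (b \<otimes> s)" and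
      ab: "a \<in> carrier R" "s \<in> S" "b \<in> carrier R" "t \<in> S"
      by (auto simp: x loc_rel_iff)
    from yz obtain v where v: "v \<in> S" "v \<otimes> (b \<otimes> w) = v \<otimes> (c \<otimes> t)" and cw: "c \<in> carrier R" "w \<in> S"
      by (auto simp: x loc_rel_iff)
    \<comment> \<open>The middle denominator \<open>t\<close> is part of the witness because it may
      be a zero divisor and cannot be cancelled.\<close>
    have "(u \<otimes> v \<otimes> t) \<otimes> (a \<otimes> w) = (v \<otimes> w) \<otimes> (u \<otimes> (a \<otimes> t))"
      using u(1) v(1) ab cw by (simp add: m_ac)
    also have "\<dots> = (u \<otimes> s) \<otimes> (v \<otimes> (b \<otimes> w))"
      unfolding u(2) using u(1) v(1) ab cw by (simp add: m_ac)
    also have "\<dots> = (u \<otimes> v \<otimes> t) \<otimes> (c \<otimes> s)"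
      unfolding v(2) using u(1) v(1) ab cw by (simp add: m_ac)
    finally show "(x, z) \<in> loc_rel R S"
      using u(1) v(1) ab cw by (auto simp: x loc_rel_iff intro!: bexI[of _ "u \<otimes> v \<otimes> t"])
  qed
qed

lemma fraction_eq_iff:
  assumes "a \<in> carrier R" "s \<in> S" "b \<in> carrier R" "t \<in> S"
  shows "frc a s = frc b t \<longleftrightarrow> (\<exists>u\<in>S. u \<otimes> (a \<otimes> t) = u \<otimes> (b \<otimes> s))"
  using eq_equiv_class_iff[OF equiv_loc_rel, of "(a, s)" "(b, t)"] assms
  by (simp add: fraction_def loc_rel_iff)

lemma fraction_eqI':
  assumes "u \<otimes> (a \<otimes> t) = u \<otimes> (b \<otimes> s)" "u \<in> S" "a \<in> carrier R" "s \<in> S" "b \<in> carrier R" "t \<in> S"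
  shows "frc a s = frc b t"
  using fraction_eq_iff[of a s b t] assms by blast

lemma fraction_eqI:
  assumes "a \<in> carrier R" "s \<in> S" "b \<in> carrier R" "t \<in> S" "a \<otimes> t = b \<otimes> s"
  shows "frc a s = frc b t"
  using assms by (subst fraction_eq_iff) (auto intro: bexI[of _ \<one>])

lemma mem_fraction_iff:
  assumes "a \<in> carrier R" "s \<in> S"
  shows "(b, t) \<in> frc a s \<longleftrightarrow> b \<in> carrier R \<and> t \<in> S \<and> frc b t = frc a s"
proof -
  have "(b, t) \<in> frc a s \<longleftrightarrow> ((a, s), (b, t)) \<in> loc_rel R S" by (simp add: fraction_def)
  also have "\<dots> \<longleftrightarrow> b \<in> carrier R \<and> t \<in> S \<and> frc a s = frc b t"
    using assms fraction_eq_iff[of a s b t] by (auto simp only: loc_rel_iff)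
  finally show ?thesis by auto
qed

lemma fraction_nonempty: "a \<in> carrier R \<Longrightarrow> s \<in> S \<Longrightarrow> frc a s \<noteq> {}"
  using mem_fraction_iff[of a s a s] by auto

lemma carrier_localization: "carrier L = {frc a s | a s. a \<in> carrier R \<and> s \<in> S}"
  by (auto simp: localization_def quotient_def fraction_def)

lemma fraction_closed [simp, intro]: "a \<in> carrier R \<Longrightarrow> s \<in> S \<Longrightarrow> frc a s \<in> carrier L"
  by (auto simp: carrier_localization)

lemma localizationE:
  assumes "x \<in> carrier L"
  obtains a s where "a \<in> carrier R" "s \<in> S" "x = frc a s"
  using assms by (auto simp: carrier_localization)

lemma fraction_mult [simp]:
  assumes "a \<in> carrier R" "s \<in> S" "b \<in> carrier R" "t \<in> S"
  shows "frc a s \<otimes>\<^bsub>L\<^esub> frc b t = frc (a \<otimes> b) (s \<otimes> t)"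
proof -
  have "frc (a' \<otimes> b') (s' \<otimes> t') = frc (a \<otimes> b) (s \<otimes> t)"
    if "(a', s') \<in> frc a s" "(b', t') \<in> frc b t" for a' b' s' t'
  proof -
    from that assms obtain u v where *: "a' \<in> carrier R" "s' \<in> S" "b' \<in> carrier R" "t' \<in> S" "u \<in> S" "v \<in> S"
      and u: "u \<otimes> (a' \<otimes> s) = u \<otimes> (a \<otimes> s')" and v: "v \<otimes> (b' \<otimes> t) = v \<otimes> (b \<otimes> t')"
      by (auto simp: mem_fraction_iff fraction_eq_iff)
    have "(u \<otimes> v) \<otimes> ((a' \<otimes> b') \<otimes> (s \<otimes> t)) = (u \<otimes> (a' \<otimes> s)) \<otimes> (v \<otimes> (b' \<otimes> t))"
      using * assms by (simp add: m_ac)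
    also have "\<dots> = (u \<otimes> v) \<otimes> ((a \<otimes> b) \<otimes> (s' \<otimes> t'))"
      unfolding u v using * assms by (simp add: m_ac)
    finally show ?thesis by (rule fraction_eqI') (use * assms in simp_all)
  qed
  then show ?thesis
    using fraction_nonempty assms unfolding localization_def
    by (auto intro!: UN_const_nonempty)
qed

lemma fraction_add [simp]:
  assumes "a \<in> carrier R" "s \<in> S" "b \<in> carrier R" "t \<in> S"
  shows "frc a s \<oplus>\<^bsub>L\<^esub> frc b t = frc (a \<otimes> t \<oplus> b \<otimes> s) (s \<otimes> t)"
proof -
  have "frc (a' \<otimes> t' \<oplus> b' \<otimes> s') (s' \<otimes> t') = frc (a \<otimes> t \<oplus> b \<otimes> s) (s \<otimes> t)"
    if "(a', s') \<in> frc a s" "(b', t') \<in> frc b t" for a' b' s' t'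
  proof -
    from that assms obtain u v where *: "a' \<in> carrier R" "s' \<in> S" "b' \<in> carrier R" "t' \<in> S" "u \<in> S" "v \<in> S"
      and u: "u \<otimes> (a' \<otimes> s) = u \<otimes> (a \<otimes> s')" and v: "v \<otimes> (b' \<otimes> t) = v \<otimes> (b \<otimes> t')"
      by (auto simp: mem_fraction_iff fraction_eq_iff)
    have "(u \<otimes> v) \<otimes> ((a' \<otimes> t' \<oplus> b' \<otimes> s') \<otimes> (s \<otimes> t)) =
        (u \<otimes> (a' \<otimes> s)) \<otimes> (v \<otimes> t \<otimes> t') \<oplus> (v \<otimes> (b' \<otimes> t)) \<otimes> (u \<otimes> s \<otimes> s')"
      using * assms by (simp add: m_ac r_distr l_distr)
    also have "\<dots> = (u \<otimes> v) \<otimes> ((a \<otimes> t \<oplus> b \<otimes> s) \<otimes> (s' \<otimes> t'))"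
      unfolding u v using * assms by (simp add: m_ac r_distr l_distr)
    finally show ?thesis by (rule fraction_eqI') (use * assms in simp_all)
  qed
  then show ?thesis
    using fraction_nonempty assms unfolding localization_def
    by (auto intro!: UN_const_nonempty)
qed

lemma fraction_smult [simp]:
  assumes "a \<in> carrier R" "s \<in> S" "r \<in> carrier R"
  shows "r \<odot>\<^bsub>L\<^esub> frc a s = frc (r \<otimes> a) s"
proof -
  have "frc (r \<otimes> a') s' = frc (r \<otimes> a) s" if "(a', s') \<in> frc a s" for a' s'
  proof -
    from that assms obtain u where *: "a' \<in> carrier R" "s' \<in> S" "u \<in> S"
      and u: "u \<otimes> (a' \<otimes> s) = u \<otimes> (a \<otimes> s')"
      by (auto simp: mem_fraction_iff fraction_eq_iff)
    have "u \<otimes> ((r \<otimes> a') \<otimes> s) = r \<otimes> (u \<otimes> (a' \<otimes> s))"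
      using * assms by (simp add: m_ac)
    also have "\<dots> = u \<otimes> ((r \<otimes> a) \<otimes> s')"
      unfolding u using * assms by (simp add: m_ac)
    finally show ?thesis by (rule fraction_eqI') (use * assms in simp_all)
  qed
  then show ?thesis
    using fraction_nonempty assms unfolding localization_def
    by (auto intro!: UN_const_nonempty)
qed

lemma localization_one: "\<one>\<^bsub>L\<^esub> = frc \<one> \<one>"
  and localization_zero: "\<zero>\<^bsub>L\<^esub> = frc \<zero> \<one>"
  by (simp_all add: localization_def)

lemma fraction_zero: "s \<in> S \<Longrightarrow> frc \<zero> s = \<zero>\<^bsub>L\<^esub>"
  unfolding localization_zero by (rule fraction_eqI) auto

lemma fraction_self: "s \<in> S \<Longrightarrow> frc s s = \<one>\<^bsub>L\<^esub>"
  unfolding localization_one by (rule fraction_eqI) auto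

lemma localization_algebra: "algebra R L"
proof (rule algebraI)
  show "cring R" ..
  show "cring L"
  proof (rule cringI)
    show "abelian_group L"
    proof (rule abelian_groupI)
      fix x y assume "x \<in> carrier L" "y \<in> carrier L"
      then obtain a s b t where *: "a \<in> carrier R" "s \<in> S" "x = frc a s" "b \<in> carrier R" "t \<in> S" "y = frc b t"
        by (elim localizationE)
      then show "x \<oplus>\<^bsub>L\<^esub> y \<in> carrier L" by simp
      show "x \<oplus>\<^bsub>L\<^esub> y = y \<oplus>\<^bsub>L\<^esub> x" using * by (simp add: a_comm m_comm)
      fix z assume "z \<in> carrier L"
      then obtain c w where "c \<in> carrier R" "w \<in> S" "z = frc c w" by (elim localizationE)
      then show "x \<oplus>\<^bsub>L\<^esub> y \<oplus>\<^bsub>L\<^esub> z = x \<oplus>\<^bsub>L\<^esub> (y \<oplus>\<^bsub>L\<^esub> z)"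
        using * by (simp add: a_ac m_ac l_distr r_distr)
    next
      show "\<zero>\<^bsub>L\<^esub> \<in> carrier L" by (simp add: localization_zero)
    next
      fix x assume x: "x \<in> carrier L"
      then show "\<zero>\<^bsub>L\<^esub> \<oplus>\<^bsub>L\<^esub> x = x"
        by (auto elim!: localizationE simp: localization_zero)
      from x obtain a s where "a \<in> carrier R" "s \<in> S" "x = frc a s" by (rule localizationE)
      then show "\<exists>y\<in>carrier L. y \<oplus>\<^bsub>L\<^esub> x = \<zero>\<^bsub>L\<^esub>"
        by (intro bexI[of _ "frc (\<ominus> a) s"])
          (auto simp: fraction_zero l_neg l_distr[symmetric])
    qed
    show "comm_monoid L"
    proof (rule comm_monoidI)
      show "\<one>\<^bsub>L\<^esub> \<in> carrier L" by (simp add: localization_one)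
    qed (auto elim!: localizationE simp: m_ac localization_one)
    fix x y z assume "x \<in> carrier L" "y \<in> carrier L" "z \<in> carrier L"
    then obtain a s b t c w where *: "a \<in> carrier R" "s \<in> S" "b \<in> carrier R" "t \<in> S" "c \<in> carrier R" "w \<in> S"
      and "x = frc a s" "y = frc b t" "z = frc c w"
      by (elim localizationE)
    moreover have "frc ((a \<otimes> t \<oplus> b \<otimes> s) \<otimes> c) (s \<otimes> t \<otimes> w) =
        frc (a \<otimes> c \<otimes> (t \<otimes> w) \<oplus> b \<otimes> c \<otimes> (s \<otimes> w)) (s \<otimes> w \<otimes> (t \<otimes> w))"
      by (rule fraction_eqI) (use * in \<open>simp_all add: a_ac m_ac l_distr r_distr\<close>)
    ultimately show "(x \<oplus>\<^bsub>L\<^esub> y) \<otimes>\<^bsub>L\<^esub> z = x \<otimes>\<^bsub>L\<^esub> z \<oplus>\<^bsub>L\<^esub> y \<otimes>\<^bsub>L\<^esub> z"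
      by simp
  qed
next
  fix a b x assume ab: "a \<in> carrier R" "b \<in> carrier R" and "x \<in> carrier L"
  then obtain c s where *: "c \<in> carrier R" "s \<in> S" "x = frc c s" by (elim localizationE)
  have "frc ((a \<oplus> b) \<otimes> c) s = frc (a \<otimes> c \<otimes> s \<oplus> b \<otimes> c \<otimes> s) (s \<otimes> s)"
    by (rule fraction_eqI) (use ab * in \<open>simp_all add: a_ac m_ac l_distr r_distr\<close>)
  then show "(a \<oplus> b) \<odot>\<^bsub>L\<^esub> x = a \<odot>\<^bsub>L\<^esub> x \<oplus>\<^bsub>L\<^esub> b \<odot>\<^bsub>L\<^esub> x"
    using ab * by simp
next
  fix a x y assume a: "a \<in> carrier R" and "x \<in> carrier L" "y \<in> carrier L"
  then obtain b s c t where *: "b \<in> carrier R" "s \<in> S" "x = frc b s" "c \<in> carrier R" "t \<in> S" "y = frc c t"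
    by (elim localizationE)
  then show "a \<odot>\<^bsub>L\<^esub> (x \<oplus>\<^bsub>L\<^esub> y) = a \<odot>\<^bsub>L\<^esub> x \<oplus>\<^bsub>L\<^esub> a \<odot>\<^bsub>L\<^esub> y"
    using a by (simp add: m_ac r_distr)
qed (auto elim!: localizationE simp: m_ac)

end

section \<open>Localization at the powers of one element and the maps between such rings\<close>

lemma (in cring) powers_multiplicative: "f \<in> carrier R \<Longrightarrow> multiplicative_subset R (powers R f)"
proof unfold_locales
  show "\<one> \<in> powers R f" unfolding powers_def by (auto intro: exI[of _ "0::nat"])
qed (auto simp: powers_def nat_pow_mult)

lemma (in cring) power_mem_powers: "f [^] (n::nat) \<in> powers R f"
  by (auto simp: powers_def)

lemma (in cring) localization_powersE:
  assumes "f \<in> carrier R" "x \<in> carrier (localization R (powers R f))"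
  obtains a n where "a \<in> carrier R" "x = fraction R (powers R f) a (f [^] (n::nat))"
proof -
  interpret multiplicative_subset R "powers R f" by (rule powers_multiplicative) fact
  obtain a s where "a \<in> carrier R" "s \<in> powers R f" "x = fraction R (powers R f) a s"
    using assms(2) by (rule localizationE)
  moreover from this obtain n :: nat where "s = f [^] n" unfolding powers_def by blast
  ultimately show thesis using that by blast
qed

text \<open>The union in \<open>loc_map\<close> runs over all representatives with a power of
  \<open>f\<close> as denominator, and over every exponent that yields this power. All of them give
  the same fraction, so the union is a single class.\<close>

lemma (in cring) loc_map_fraction:
  assumes f: "f \<in> carrier R" and g: "g \<in> carrier R" and a: "a \<in> carrier R"
  shows "loc_map R f g (fraction R (powers R f) a (f [^] (n::nat))) =
    fraction R (powers R (f \<otimes> g)) (a \<otimes> g [^] n) ((f \<otimes> g) [^] n)"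
proof -
  interpret F: multiplicative_subset R "powers R f" by (rule powers_multiplicative) fact
  interpret FG: multiplicative_subset R "powers R (f \<otimes> g)" by (rule powers_multiplicative) (use f g in simp)
  have "fraction R (powers R (f \<otimes> g)) (b \<otimes> g [^] m) ((f \<otimes> g) [^] m) =
      fraction R (powers R (f \<otimes> g)) (a \<otimes> g [^] n) ((f \<otimes> g) [^] n)"
    if "(b, f [^] m) \<in> fraction R (powers R f) a (f [^] n)" for b and m :: nat
  proof -
    from that a obtain k :: nat where b: "b \<in> carrier R"
      and k: "f [^] k \<otimes> (b \<otimes> f [^] n) = f [^] k \<otimes> (a \<otimes> f [^] m)"
      by (auto simp: F.mem_fraction_iff F.fraction_eq_iff power_mem_powers) (auto simp: powers_def)
    \<comment> \<open>The relation between the representatives over \<open>f\<close> is multiplied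
      by the powers of \<open>g\<close> that the new denominators require.\<close>
    have "(f \<otimes> g) [^] k \<otimes> ((b \<otimes> g [^] m) \<otimes> (f \<otimes> g) [^] n) =
        (g [^] k \<otimes> g [^] m \<otimes> g [^] n) \<otimes> (f [^] k \<otimes> (b \<otimes> f [^] n))"
      using f g a b by (simp add: nat_pow_distrib m_ac)
    also have "\<dots> = (f \<otimes> g) [^] k \<otimes> ((a \<otimes> g [^] n) \<otimes> (f \<otimes> g) [^] m)"
      unfolding k using f g a b by (simp add: nat_pow_distrib m_ac)
    finally show ?thesis
      by (rule FG.fraction_eqI') (use f g a b in \<open>simp_all add: power_mem_powers\<close>)
  qed
  moreover have "(a, f [^] n) \<in> fraction R (powers R f) a (f [^] n)"
    using a by (simp add: F.mem_fraction_iff power_mem_powers)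
  ultimately show ?thesis unfolding loc_map_def by blast
qed

lemma (in cring) loc_map_closed:
  assumes "f \<in> carrier R" "g \<in> carrier R" "x \<in> carrier (localization R (powers R f))"
  shows "loc_map R f g x \<in> carrier (localization R (powers R (f \<otimes> g)))"
proof -
  interpret FG: multiplicative_subset R "powers R (f \<otimes> g)" by (rule powers_multiplicative) (use assms in simp)
  show ?thesis
    using assms(1,3) by (rule localization_powersE) (simp add: loc_map_fraction assms power_mem_powers)
qed

lemma (in cring) loc_map_add:
  assumes f: "f \<in> carrier R" and g: "g \<in> carrier R"
    and x: "x \<in> carrier (localization R (powers R f))" and y: "y \<in> carrier (localization R (powers R f))"
  shows "loc_map R f g (x \<oplus>\<^bsub>localization R (powers R f)\<^esub> y) =
    loc_map R f g x \<oplus>\<^bsub>localization R (powers R (f \<otimes> g))\<^esub> loc_map R f g y"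
proof -
  interpret F: multiplicative_subset R "powers R f" by (rule powers_multiplicative) fact
  interpret FG: multiplicative_subset R "powers R (f \<otimes> g)" by (rule powers_multiplicative) (use f g in simp)
  obtain a and n :: nat where a: "a \<in> carrier R" "x = F.frc a (f [^] n)"
    using f x by (rule localization_powersE)
  obtain b and m :: nat where b: "b \<in> carrier R" "y = F.frc b (f [^] m)"
    using f y by (rule localization_powersE)
  have "x \<oplus>\<^bsub>F.L\<^esub> y = F.frc (a \<otimes> f [^] m \<oplus> b \<otimes> f [^] n) (f [^] (n + m))"
    using a b f by (simp add: power_mem_powers nat_pow_mult)
  then have "loc_map R f g (x \<oplus>\<^bsub>F.L\<^esub> y) =
      FG.frc ((a \<otimes> f [^] m \<oplus> b \<otimes> f [^] n) \<otimes> g [^] (n + m)) ((f \<otimes> g) [^] (n + m))"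
    using a b f g by (simp add: loc_map_fraction)
  also have "(a \<otimes> f [^] m \<oplus> b \<otimes> f [^] n) \<otimes> g [^] (n + m) =
      (a \<otimes> g [^] n) \<otimes> (f \<otimes> g) [^] m \<oplus> (b \<otimes> g [^] m) \<otimes> (f \<otimes> g) [^] n"
    using a b f g by (simp add: nat_pow_distrib nat_pow_mult[symmetric] m_ac l_distr r_distr)
  finally show ?thesis
    using a b f g by (simp add: loc_map_fraction power_mem_powers nat_pow_mult)
qed

lemma (in cring) loc_map_mult:
  assumes f: "f \<in> carrier R" and g: "g \<in> carrier R"
    and x: "x \<in> carrier (localization R (powers R f))" and y: "y \<in> carrier (localization R (powers R f))"
  shows "loc_map R f g (x \<otimes>\<^bsub>localization R (powers R f)\<^esub> y) =
    loc_map R f g x \<otimes>\<^bsub>localization R (powers R (f \<otimes> g))\<^esub> loc_map R f g y"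
proof -
  interpret F: multiplicative_subset R "powers R f" by (rule powers_multiplicative) fact
  interpret FG: multiplicative_subset R "powers R (f \<otimes> g)" by (rule powers_multiplicative) (use f g in simp)
  obtain a and n :: nat where a: "a \<in> carrier R" "x = F.frc a (f [^] n)"
    using f x by (rule localization_powersE)
  obtain b and m :: nat where b: "b \<in> carrier R" "y = F.frc b (f [^] m)"
    using f y by (rule localization_powersE)
  have "x \<otimes>\<^bsub>F.L\<^esub> y = F.frc (a \<otimes> b) (f [^] (n + m))"
    using a b f by (simp add: power_mem_powers nat_pow_mult)
  then have "loc_map R f g (x \<otimes>\<^bsub>F.L\<^esub> y) = FG.frc ((a \<otimes> b) \<otimes> g [^] (n + m)) ((f \<otimes> g) [^] (n + m))"
    using a b f g by (simp add: loc_map_fraction)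
  also have "(a \<otimes> b) \<otimes> g [^] (n + m) = (a \<otimes> g [^] n) \<otimes> (b \<otimes> g [^] m)"
    using a b f g by (simp add: nat_pow_mult[symmetric] m_ac)
  finally show ?thesis
    using a b f g by (simp add: loc_map_fraction power_mem_powers nat_pow_mult)
qed

lemma (in cring) loc_map_one:
  assumes f: "f \<in> carrier R" and g: "g \<in> carrier R"
  shows "loc_map R f g \<one>\<^bsub>localization R (powers R f)\<^esub> = \<one>\<^bsub>localization R (powers R (f \<otimes> g))\<^esub>"
proof -
  interpret F: multiplicative_subset R "powers R f" by (rule powers_multiplicative) fact
  interpret FG: multiplicative_subset R "powers R (f \<otimes> g)" by (rule powers_multiplicative) (use f g in simp)
  show ?thesis
    using loc_map_fraction[OF f g one_closed, of 0]
    by (simp add: F.localization_one FG.localization_one)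
qed

lemma (in cring) loc_map_smult:
  assumes f: "f \<in> carrier R" and g: "g \<in> carrier R" and r: "r \<in> carrier R"
    and x: "x \<in> carrier (localization R (powers R f))"
  shows "loc_map R f g (r \<odot>\<^bsub>localization R (powers R f)\<^esub> x) =
    r \<odot>\<^bsub>localization R (powers R (f \<otimes> g))\<^esub> loc_map R f g x"
proof -
  interpret F: multiplicative_subset R "powers R f" by (rule powers_multiplicative) fact
  interpret FG: multiplicative_subset R "powers R (f \<otimes> g)" by (rule powers_multiplicative) (use f g in simp)
  obtain a and n :: nat where a: "a \<in> carrier R" "x = F.frc a (f [^] n)"
    using f x by (rule localization_powersE)
  then show ?thesis
    using r f g by (simp add: loc_map_fraction power_mem_powers m_assoc)
qed

text \<open>Both sides multiply numerator and denominator by the same powers; commutativity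
  identifies the two target rings. This is what makes consecutive Cech differentials cancel.\<close>

lemma (in cring) loc_map_commute:
  assumes f: "f \<in> carrier R" and g: "g \<in> carrier R" and h: "h \<in> carrier R"
    and x: "x \<in> carrier (localization R (powers R f))"
  shows "loc_map R (f \<otimes> g) h (loc_map R f g x) = loc_map R (f \<otimes> h) g (loc_map R f h x)"
proof -
  obtain a and n :: nat where a: "a \<in> carrier R" "x = fraction R (powers R f) a (f [^] n)"
    using f x by (rule localization_powersE)
  have "f \<otimes> g \<otimes> h = f \<otimes> h \<otimes> g" using f g h by (simp add: m_ac)
  then show ?thesis
    using a f g h by (simp add: loc_map_fraction m_ac)
qed

lemma (in cring) localization_is_cring:
  "f \<in> carrier R \<Longrightarrow> cring (localization R (powers R f))"
  using multiplicative_subset.localization_algebra[OF powers_multiplicative] algebra.M_cring by blast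

lemma (in cring) loc_map_pow:
  assumes f: "f \<in> carrier R" and g: "g \<in> carrier R"
    and x: "x \<in> carrier (localization R (powers R f))"
  shows "loc_map R f g (x [^]\<^bsub>localization R (powers R f)\<^esub> (n::nat)) =
    loc_map R f g x [^]\<^bsub>localization R (powers R (f \<otimes> g))\<^esub> n"
proof -
  interpret F: cring "localization R (powers R f)" by (rule localization_is_cring) fact
  show ?thesis
    by (induction n) (simp_all add: loc_map_one loc_map_mult f g x)
qed


section \<open>The binomial theorem and additivity of Frobenius\<close>

context cring begin

lemma binomial_expansion:
  assumes a: "a \<in> carrier R" and b: "b \<in> carrier R"
  shows "(a \<oplus> b) [^] n = (\<Oplus>k\<in>{..n}. [(n choose k)] \<cdot> (a [^] k \<otimes> b [^] (n - k)))"
proof -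
  define T where "T n k = [(n choose k)] \<cdot> (a [^] k \<otimes> b [^] (n - k))" for n k :: nat
  have T: "T n k \<in> carrier R" for n k :: nat using a b by (simp add: T_def add.nat_pow_closed)
  have step: "T (Suc n) (Suc k) = a \<otimes> T n k \<oplus> b \<otimes> T n (Suc k)" if k: "k \<le> n" for n k
  \<comment> \<open>For \<open>k = n\<close> the truncated subtraction \<open>n - Suc k\<close> does
    not lower the exponent; there the last term vanishes through its binomial coefficient
    instead.\<close>
  proof (cases "k = n")
    case True
    then show ?thesis using a b by (simp add: T_def add_pow_rdistr m_ac binomial_eq_0)
  next
    case False
    then have e: "n - k = Suc (n - Suc k)" using k by simp
    have "b [^] (n - k) = b [^] (n - Suc k) \<otimes> b" by (simp add: e)
    then show ?thesis using a b
      by (simp add: T_def add_pow_rdistr m_ac add.nat_pow_mult[symmetric])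
  qed
  \<comment> \<open>This vanishing extra term lets the shifted sum be completed to
    \<open>{..Suc n}\<close> and split off again at the other end.\<close>
  have z: "b \<otimes> T n (Suc n) = \<zero>" for n using b by (simp add: T_def binomial_eq_0)
  have bot: "T (Suc n) 0 = b \<otimes> T n 0" for n using b by (simp add: T_def m_comm)
  have "(a \<oplus> b) [^] n = (\<Oplus>k\<in>{..n}. T n k)"
  proof (induction n)
    case 0
    then show ?case by (simp add: T_def)
  next
    case (Suc n)
    have aT: "(\<lambda>k. a \<otimes> T n k) \<in> A \<rightarrow> carrier R" and bT: "(\<lambda>k. b \<otimes> T n k) \<in> A \<rightarrow> carrier R"
      and bT': "(\<lambda>k. b \<otimes> T n (Suc k)) \<in> A \<rightarrow> carrier R" for A
      using a b T by auto
    have "(\<Oplus>k\<in>{..Suc n}. T (Suc n) k) = (\<Oplus>k\<in>{..n}. T (Suc n) (Suc k)) \<oplus> T (Suc n) 0"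
      using T by (intro finsum_Suc2) auto
    also have "(\<Oplus>k\<in>{..n}. T (Suc n) (Suc k)) = (\<Oplus>k\<in>{..n}. a \<otimes> T n k \<oplus> b \<otimes> T n (Suc k))"
      using a b T by (intro finsum_cong' refl) (auto simp: step)
    also have "\<dots> = (\<Oplus>k\<in>{..n}. a \<otimes> T n k) \<oplus> (\<Oplus>k\<in>{..n}. b \<otimes> T n (Suc k))"
      by (rule finsum_addf[OF aT bT'])
    also have "(\<Oplus>k\<in>{..n}. a \<otimes> T n k) \<oplus> (\<Oplus>k\<in>{..n}. b \<otimes> T n (Suc k)) \<oplus> T (Suc n) 0 =
        (\<Oplus>k\<in>{..n}. a \<otimes> T n k) \<oplus> ((\<Oplus>k\<in>{..n}. b \<otimes> T n (Suc k)) \<oplus> b \<otimes> T n 0)"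
      unfolding bot using b T by (intro a_assoc finsum_closed[OF aT] finsum_closed[OF bT'] m_closed)
    also have "(\<Oplus>k\<in>{..n}. b \<otimes> T n (Suc k)) \<oplus> b \<otimes> T n 0 = (\<Oplus>k\<in>{..Suc n}. b \<otimes> T n k)"
      by (rule finsum_Suc2[OF bT, symmetric])
    also have "\<dots> = b \<otimes> T n (Suc n) \<oplus> (\<Oplus>k\<in>{..n}. b \<otimes> T n k)"
      by (rule finsum_Suc[OF bT])
    also have "\<dots> = (\<Oplus>k\<in>{..n}. b \<otimes> T n k)"
      unfolding z by (rule l_zero[OF finsum_closed[OF bT]])
    also have "(\<Oplus>k\<in>{..n}. a \<otimes> T n k) = a \<otimes> (\<Oplus>k\<in>{..n}. T n k)"
      using a T by (intro finsum_rdistr[symmetric]) auto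
    also have "(\<Oplus>k\<in>{..n}. b \<otimes> T n k) = b \<otimes> (\<Oplus>k\<in>{..n}. T n k)"
      using b T by (intro finsum_rdistr[symmetric]) auto
    also have "a \<otimes> (\<Oplus>k\<in>{..n}. T n k) \<oplus> b \<otimes> (\<Oplus>k\<in>{..n}. T n k) = (a \<oplus> b) [^] Suc n"
      using a b by (simp add: Suc[symmetric] l_distr[symmetric] m_comm)
    finally show ?case by simp
  qed
  then show ?thesis by (simp add: T_def)
qed

text \<open>The binomial coefficients strictly between the ends are multiples of \<open>p\<close>,
  and \<open>p\<close> times any element is zero. It is applied to every localization occurring in
  the Cech complex.\<close>

lemma freshmans_dream:
  assumes p: "Factorial_Ring.prime (p::nat)" and char: "[p] \<cdot> \<one> = \<zero>"
    and a: "a \<in> carrier R" and b: "b \<in> carrier R"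
  shows "(a \<oplus> b) [^] p = a [^] p \<oplus> b [^] p"
proof -
  have pz: "[p] \<cdot> x = \<zero>" if "x \<in> carrier R" for x
    using that char add_pow_ldistr[of \<one> x p] by simp
  define T where "T k = [(p choose k)] \<cdot> (a [^] k \<otimes> b [^] (p - k))" for k :: nat
  have T: "T k \<in> carrier R" for k using a b by (simp add: T_def add.nat_pow_closed)
  have mid: "T k = \<zero>" if "0 < k" "k < p" for k
  proof -
    have "p dvd (p choose k)" using that p by (intro dvd_choose_prime) auto
    then obtain m where "p choose k = p * m" by (rule dvdE)
    then have "T k = [m] \<cdot> ([p] \<cdot> (a [^] k \<otimes> b [^] (p - k)))"
      using a b by (simp add: T_def add.nat_pow_pow mult.commute)
    then show ?thesis using a b by (simp add: pz)
  qed
  obtain q where q: "p = Suc (Suc q)"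
    using le_Suc_ex[OF prime_ge_2_nat[OF p]] by auto
  have "(a \<oplus> b) [^] p = (\<Oplus>k\<in>{..p}. T k)" unfolding T_def by (rule binomial_expansion[OF a b])
  also have "\<dots> = T p \<oplus> (\<Oplus>k\<in>{..Suc q}. T k)"
    using T unfolding q by (intro finsum_Suc) auto
  also have "(\<Oplus>k\<in>{..Suc q}. T k) = (\<Oplus>k\<in>{..q}. T (Suc k)) \<oplus> T 0"
    using T by (intro finsum_Suc2) auto
  also have "(\<Oplus>k\<in>{..q}. T (Suc k)) = (\<Oplus>k\<in>{..q}. \<zero>)"
    by (intro finsum_cong' refl) (auto simp: q intro!: mid)
  finally show ?thesis using a b by (simp add: T_def)
qed

end

section \<open>The Cech complex\<close>

text \<open>Adding an index \<open>i\<close> adds the pairs with first or second entry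
  \<open>i\<close>, which cancel each other. The shortcut that the sum equals its own negative would
  say nothing in characteristic 2.\<close>

lemma (in abelian_group) finsum_antisymmetric:
  fixes T :: "nat \<Rightarrow> nat \<Rightarrow> 'a"
  assumes "finite J" and "\<And>k l. k \<in> J \<Longrightarrow> l \<in> J \<Longrightarrow> k \<noteq> l \<Longrightarrow> T k l \<in> carrier G"
    and "\<And>k l. k \<in> J \<Longrightarrow> l \<in> J \<Longrightarrow> k \<noteq> l \<Longrightarrow> T k l = \<ominus> T l k"
  shows "(\<Oplus>k\<in>J. \<Oplus>l\<in>J - {k}. T k l) = \<zero>"
  using assms
proof (induction J rule: finite_induct)
  case empty
  show ?case by simp
next
  case (insert i J)
  have T: "T k l \<in> carrier G" if "k \<in> insert i J" "l \<in> insert i J" "k \<noteq> l" for k l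
    using insert.prems(1) that by blast
  have e: "(\<Oplus>l\<in>insert i J - {k}. T k l) = T k i \<oplus> (\<Oplus>l\<in>J - {k}. T k l)" if "k \<in> J" for k
  proof -
    have "insert i J - {k} = insert i (J - {k})" using that insert.hyps by auto
    moreover have "T k \<in> J - {k} \<rightarrow> carrier G" "T k i \<in> carrier G" using T that insert.hyps by auto
    ultimately show ?thesis using finsum_insert[of "J - {k}" i "T k"] insert.hyps by simp
  qed
  have c: "(\<Oplus>l\<in>J - {k}. T k l) \<in> carrier G" if "k \<in> J" for k
    using T that by (intro finsum_closed) auto
  have ki: "T k i \<in> carrier G" "T i k \<in> carrier G" if "k \<in> J" for k
    using T that insert.hyps by auto
  have "(\<Oplus>k\<in>insert i J. \<Oplus>l\<in>insert i J - {k}. T k l) =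
      (\<Oplus>l\<in>J. T i l) \<oplus> (\<Oplus>k\<in>J. T k i \<oplus> (\<Oplus>l\<in>J - {k}. T k l))"
  proof -
    have "(\<Oplus>k\<in>J. \<Oplus>l\<in>insert i J - {k}. T k l) = (\<Oplus>k\<in>J. T k i \<oplus> (\<Oplus>l\<in>J - {k}. T k l))"
      using e c ki by (intro finsum_cong' refl) auto
    moreover have "insert i J - {i} = J" using insert.hyps by auto
    moreover have "(\<lambda>k. \<Oplus>l\<in>insert i J - {k}. T k l) \<in> J \<rightarrow> carrier G"
      using e c ki by auto
    moreover have "finsum G (T i) J \<in> carrier G" using ki by (intro finsum_closed) auto
    ultimately show ?thesis
      using finsum_insert[of J i "\<lambda>k. \<Oplus>l\<in>insert i J - {k}. T k l"] insert.hyps by simp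
  qed
  also have "(\<Oplus>k\<in>J. T k i \<oplus> (\<Oplus>l\<in>J - {k}. T k l)) = (\<Oplus>k\<in>J. T k i) \<oplus> (\<Oplus>k\<in>J. \<Oplus>l\<in>J - {k}. T k l)"
    using ki c by (intro finsum_addf) auto
  also have "(\<Oplus>k\<in>J. \<Oplus>l\<in>J - {k}. T k l) = \<zero>"
  proof (rule insert.IH)
    fix k l assume kl: "k \<in> J" "l \<in> J" "k \<noteq> l"
    then show "T k l \<in> carrier G" using T by blast
    show "T k l = \<ominus> T l k" using insert.prems(2)[of k l] kl by simp
  qed
  also have "(\<Oplus>l\<in>J. T i l) \<oplus> ((\<Oplus>k\<in>J. T k i) \<oplus> \<zero>) = (\<Oplus>l\<in>J. T i l \<oplus> T l i)"
    using ki finsum_addf[of "\<lambda>l. T i l" J "\<lambda>l. T l i"] finsum_closed[of "\<lambda>l. T l i" J] by (simp add: Pi_def)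
  also have "\<dots> = (\<Oplus>l\<in>J. \<zero>)"
  proof (intro finsum_cong' refl)
    fix l assume "l \<in> J"
    then have "T i l = \<ominus> T l i" using insert.hyps insert.prems(2)[of i l] by auto
    then show "T i l \<oplus> T l i = \<zero>" using ki[OF \<open>l \<in> J\<close>] by (simp add: l_neg)
  qed auto
  finally show ?case by simp
qed

locale cech = cring R for R (structure) +
  fixes xs :: "'a list"
  assumes xs: "set xs \<subseteq> carrier R"
begin

abbreviation "idx \<equiv> cech_index xs"
abbreviation "P \<equiv> cech_loc R xs"
abbreviation "C \<equiv> cech_module R xs"
abbreviation "\<rho> J l \<equiv> loc_map R (cech_elem R xs (J - {l})) (xs ! l)"

lemma nth_closed: "l < length xs \<Longrightarrow> xs ! l \<in> carrier R" using xs by auto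

lemma idx_nth: "J \<in> idx j \<Longrightarrow> l \<in> J \<Longrightarrow> xs ! l \<in> carrier R"
  by (auto simp: cech_index_def intro!: nth_closed)

lemma idx_finite: "J \<in> idx j \<Longrightarrow> finite J"
  by (auto simp: cech_index_def intro: finite_subset)

lemma idx_remove: "J \<in> idx (Suc j) \<Longrightarrow> l \<in> J \<Longrightarrow> J - {l} \<in> idx j"
  by (auto simp: cech_index_def)

lemma elem_closed: "J \<in> idx j \<Longrightarrow> cech_elem R xs J \<in> carrier R"
  unfolding cech_elem_def by (intro finprod_closed) (auto simp: idx_nth)

lemma elem_remove:
  assumes "J \<in> idx j" "l \<in> J"
  shows "cech_elem R xs (J - {l}) \<otimes> xs ! l = cech_elem R xs J"
proof -
  have "J = insert l (J - {l})" using assms by auto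
  then have "cech_elem R xs J = finprod R ((!) xs) (insert l (J - {l}))"
    unfolding cech_elem_def by simp
  also have "\<dots> = xs ! l \<otimes> cech_elem R xs (J - {l})"
    unfolding cech_elem_def using assms idx_finite[OF assms(1)] idx_nth[OF assms(1)]
    by (subst finprod_insert) auto
  finally show ?thesis
    using assms idx_nth[OF assms] elem_closed[OF assms(1)] idx_nth[OF assms(1)]
    by (subst m_comm) (auto simp: cech_elem_def intro!: finprod_closed)
qed

lemma P_algebra: "J \<in> idx j \<Longrightarrow> algebra R (P J)"
  unfolding cech_loc_def using elem_closed
  by (intro multiplicative_subset.localization_algebra powers_multiplicative)

lemma P_module: "J \<in> idx j \<Longrightarrow> module R (P J)"
  using P_algebra algebra.module by blast

lemma P_cring: "J \<in> idx j \<Longrightarrow> cring (P J)"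
  using P_algebra algebra.M_cring by blast

lemma P_abelian: "J \<in> idx j \<Longrightarrow> abelian_group (P J)"
  using P_module module.axioms(2) by blast

lemma \<rho>_linear:
  assumes "J \<in> idx (Suc j)" "l \<in> J"
  shows "linear_map R (P (J - {l})) (P J) (\<rho> J l)"
  unfolding linear_map_def additive_map_def cech_loc_def
  using assms elem_closed[OF idx_remove[OF assms]] idx_nth[OF assms]
  by (auto simp flip: elem_remove[OF assms] simp: loc_map_add loc_map_smult intro: loc_map_closed)

lemma \<rho>_pow:
  assumes "J \<in> idx (Suc j)" "l \<in> J" "x \<in> carrier (P (J - {l}))"
  shows "\<rho> J l (x [^]\<^bsub>P (J - {l})\<^esub> (n::nat)) = \<rho> J l x [^]\<^bsub>P J\<^esub> n"
  using loc_map_pow[OF elem_closed[OF idx_remove[OF assms(1,2)]] idx_nth[OF assms(1,2)]] assms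
  unfolding cech_loc_def by (simp add: elem_remove[OF assms(1,2)])

lemma \<rho>_commute:
  assumes J: "J \<in> idx (Suc (Suc j))" and k: "k \<in> J" and l: "l \<in> J" and kl: "k \<noteq> l"
    and x: "x \<in> carrier (P (J - {k, l}))"
  shows "\<rho> J k (\<rho> (J - {k}) l x) = \<rho> J l (\<rho> (J - {l}) k x)"
proof -
  have K: "J - {k} \<in> idx (Suc j)" "J - {l} \<in> idx (Suc j)" using J k l by (auto intro: idx_remove)
  have e: "J - {k} - {l} = J - {k, l}" "J - {l} - {k} = J - {k, l}" by auto
  have KL: "J - {k, l} \<in> idx j" using idx_remove[OF K(1), of l] l kl e by auto
  have 1: "cech_elem R xs (J - {k, l}) \<otimes> xs ! l = cech_elem R xs (J - {k})"
    using elem_remove[OF K(1), of l] l kl unfolding e by simp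
  have 2: "cech_elem R xs (J - {k, l}) \<otimes> xs ! k = cech_elem R xs (J - {l})"
    using elem_remove[OF K(2), of k] k kl unfolding e by simp
  show ?thesis
    using loc_map_commute[OF elem_closed[OF KL] idx_nth[OF J l] idx_nth[OF J k], of x] x
    unfolding 1 2 e cech_loc_def by simp
qed

lemma C_carrier: "c \<in> carrier (C j) \<longleftrightarrow> c \<in> extensional (idx j) \<and> (\<forall>J\<in>idx j. c J \<in> carrier (P J))"
  by (auto simp: cech_module_def PiE_def)

lemma C_carrierD: "c \<in> carrier (C j) \<Longrightarrow> J \<in> idx j \<Longrightarrow> c J \<in> carrier (P J)"
  by (simp add: C_carrier)

lemma C_add: "c \<oplus>\<^bsub>C j\<^esub> c' = (\<lambda>J\<in>idx j. c J \<oplus>\<^bsub>P J\<^esub> c' J)"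
  and C_smult: "r \<odot>\<^bsub>C j\<^esub> c = (\<lambda>J\<in>idx j. r \<odot>\<^bsub>P J\<^esub> c J)"
  and C_zero: "\<zero>\<^bsub>C j\<^esub> = (\<lambda>J\<in>idx j. \<zero>\<^bsub>P J\<^esub>)"
  by (simp_all add: cech_module_def)

lemma C_eqI:
  assumes "c \<in> extensional (idx j)" "c' \<in> extensional (idx j)" "\<And>J. J \<in> idx j \<Longrightarrow> c J = c' J"
  shows "c = c'"
  using assms by (rule extensionalityI)

lemma C_module: "module R (C j)"
proof (rule moduleI)
  show "cring R" ..
  show "abelian_group (C j)"
  proof (rule abelian_groupI)
    fix c c' assume c: "c \<in> carrier (C j)" "c' \<in> carrier (C j)"
    have cl: "c J \<oplus>\<^bsub>P J\<^esub> c' J \<in> carrier (P J)" if "J \<in> idx j" for J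
      using c that abelian_monoid.a_closed[OF abelian_group.axioms(1)[OF P_abelian[OF that]]]
      by (auto simp: C_carrier)
    then show "c \<oplus>\<^bsub>C j\<^esub> c' \<in> carrier (C j)" by (auto simp: C_carrier C_add)
    show "c \<oplus>\<^bsub>C j\<^esub> c' = c' \<oplus>\<^bsub>C j\<^esub> c"
      unfolding C_add using c
      by (intro restrict_ext abelian_monoid.a_comm[OF abelian_group.axioms(1)[OF P_abelian]])
        (auto simp: C_carrier)
    fix c'' assume c'': "c'' \<in> carrier (C j)"
    show "c \<oplus>\<^bsub>C j\<^esub> c' \<oplus>\<^bsub>C j\<^esub> c'' = c \<oplus>\<^bsub>C j\<^esub> (c' \<oplus>\<^bsub>C j\<^esub> c'')"
      unfolding C_add using c c''
      by (intro restrict_ext) (simp add: abelian_monoid.a_assoc[OF abelian_group.axioms(1)[OF P_abelian]] C_carrier)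
  next
    show "\<zero>\<^bsub>C j\<^esub> \<in> carrier (C j)"
      using abelian_monoid.zero_closed[OF abelian_group.axioms(1)[OF P_abelian]]
      by (auto simp: C_carrier C_zero)
  next
    fix c assume c: "c \<in> carrier (C j)"
    show "\<zero>\<^bsub>C j\<^esub> \<oplus>\<^bsub>C j\<^esub> c = c"
      by (rule C_eqI) (use c in \<open>auto simp: C_add C_zero C_carrier
        abelian_monoid.l_zero[OF abelian_group.axioms(1)[OF P_abelian]]\<close>)
    have n: "\<ominus>\<^bsub>P J\<^esub> c J \<in> carrier (P J)" "\<ominus>\<^bsub>P J\<^esub> c J \<oplus>\<^bsub>P J\<^esub> c J = \<zero>\<^bsub>P J\<^esub>" if "J \<in> idx j" for J
      using c that abelian_group.a_inv_closed[OF P_abelian[OF that]] abelian_group.l_neg[OF P_abelian[OF that]]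
      by (auto simp: C_carrier)
    show "\<exists>c'\<in>carrier (C j). c' \<oplus>\<^bsub>C j\<^esub> c = \<zero>\<^bsub>C j\<^esub>"
      by (rule bexI[of _ "\<lambda>J\<in>idx j. \<ominus>\<^bsub>P J\<^esub> c J"])
        (use n in \<open>auto simp: C_carrier C_add C_zero intro!: restrict_ext\<close>)
  qed
  fix r c assume r: "r \<in> carrier R" and c: "c \<in> carrier (C j)"
  show "r \<odot>\<^bsub>C j\<^esub> c \<in> carrier (C j)"
    using r c by (auto simp: C_carrier C_smult intro: module.smult_closed[OF P_module])
  fix s assume s: "s \<in> carrier R"
  show "(r \<oplus> s) \<odot>\<^bsub>C j\<^esub> c = r \<odot>\<^bsub>C j\<^esub> c \<oplus>\<^bsub>C j\<^esub> s \<odot>\<^bsub>C j\<^esub> c"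
    unfolding C_smult C_add using r s c
    by (intro restrict_ext) (simp add: module.smult_l_distr[OF P_module] C_carrier)
  show "r \<otimes> s \<odot>\<^bsub>C j\<^esub> c = r \<odot>\<^bsub>C j\<^esub> (s \<odot>\<^bsub>C j\<^esub> c)"
    unfolding C_smult using r s c
    by (intro restrict_ext) (simp add: module.smult_assoc1[OF P_module] C_carrier)
next
  fix r c c' assume r: "r \<in> carrier R" and c: "c \<in> carrier (C j)" "c' \<in> carrier (C j)"
  show "r \<odot>\<^bsub>C j\<^esub> (c \<oplus>\<^bsub>C j\<^esub> c') = r \<odot>\<^bsub>C j\<^esub> c \<oplus>\<^bsub>C j\<^esub> r \<odot>\<^bsub>C j\<^esub> c'"
    unfolding C_smult C_add using r c
    by (intro restrict_ext) (simp add: module.smult_r_distr[OF P_module] C_carrier)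
next
  fix c assume c: "c \<in> carrier (C j)"
  show "\<one> \<odot>\<^bsub>C j\<^esub> c = c"
    by (rule C_eqI) (use c in \<open>auto simp: C_smult C_carrier module.smult_one[OF P_module]\<close>)
qed

definition signed_term :: "nat set \<Rightarrow> nat \<Rightarrow> ('a \<times> 'a) set \<Rightarrow> ('a \<times> 'a) set" where
  "signed_term J l y = (if even (card {m\<in>J. m < l}) then \<rho> J l y else \<ominus>\<^bsub>P J\<^esub> \<rho> J l y)"

lemma cech_diff_eq:
  "cech_diff R xs j c = (\<lambda>J\<in>idx (Suc j). \<Oplus>\<^bsub>P J\<^esub> l\<in>J. signed_term J l (c (J - {l})))"
  by (simp add: cech_diff_def signed_term_def Let_def)

lemma signed_term_linear:
  assumes J: "J \<in> idx (Suc j)" "l \<in> J"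
  shows "linear_map R (P (J - {l})) (P J) (signed_term J l)"
proof -
  interpret J: module R "P J" using P_module[OF J(1)] .
  show ?thesis
    using \<rho>_linear[OF J] unfolding linear_map_def additive_map_def signed_term_def
    by (auto simp: J.minus_add J.a_comm J.smult_r_minus Pi_iff)
qed

lemma signed_term_closed:
  assumes "J \<in> idx (Suc j)" "l \<in> J" "c \<in> carrier (C j)"
  shows "signed_term J l (c (J - {l})) \<in> carrier (P J)"
  using signed_term_linear[OF assms(1,2)] C_carrierD[OF assms(3) idx_remove[OF assms(1,2)]]
  by (auto simp: linear_map_def additive_map_def)

lemma cech_diff_linear: "linear_map R (C j) (C (Suc j)) (cech_diff R xs j)"
  unfolding linear_map_def additive_map_def
proof (intro conjI ballI funcsetI)
  fix c assume c: "c \<in> carrier (C j)"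
  show "cech_diff R xs j c \<in> carrier (C (Suc j))"
    unfolding C_carrier cech_diff_eq
    using signed_term_closed c
    by (auto intro!: abelian_monoid.finsum_closed[OF abelian_group.axioms(1)[OF P_abelian]])
  fix c' assume c': "c' \<in> carrier (C j)"
  show "cech_diff R xs j (c \<oplus>\<^bsub>C j\<^esub> c') = cech_diff R xs j c \<oplus>\<^bsub>C (Suc j)\<^esub> cech_diff R xs j c'"
    unfolding cech_diff_eq C_add
  proof (intro restrict_ext)
    fix J assume J: "J \<in> idx (Suc j)"
    interpret J: module R "P J" using P_module[OF J] .
    have "(\<Oplus>\<^bsub>P J\<^esub>l\<in>J. signed_term J l ((\<lambda>J\<in>idx j. c J \<oplus>\<^bsub>P J\<^esub> c' J) (J - {l}))) =
        (\<Oplus>\<^bsub>P J\<^esub>l\<in>J. signed_term J l (c (J - {l})) \<oplus>\<^bsub>P J\<^esub> signed_term J l (c' (J - {l})))"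
      using signed_term_linear[OF J] C_carrierD[OF c] C_carrierD[OF c'] signed_term_closed[OF J _ c]
        signed_term_closed[OF J _ c']
      by (intro J.M.finsum_cong' refl) (auto simp: idx_remove[OF J] linear_map_def additive_map_def)
    also have "\<dots> = (\<Oplus>\<^bsub>P J\<^esub>l\<in>J. signed_term J l (c (J - {l}))) \<oplus>\<^bsub>P J\<^esub>
        (\<Oplus>\<^bsub>P J\<^esub>l\<in>J. signed_term J l (c' (J - {l})))"
      using signed_term_closed[OF J _ c] signed_term_closed[OF J _ c'] by (intro J.M.finsum_addf) auto
    finally show "(\<Oplus>\<^bsub>P J\<^esub>l\<in>J. signed_term J l ((\<lambda>J\<in>idx j. c J \<oplus>\<^bsub>P J\<^esub> c' J) (J - {l}))) =
        (\<lambda>J\<in>idx (Suc j). \<Oplus>\<^bsub>P J\<^esub>l\<in>J. signed_term J l (c (J - {l}))) J \<oplus>\<^bsub>P J\<^esub>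
        (\<lambda>J\<in>idx (Suc j). \<Oplus>\<^bsub>P J\<^esub>l\<in>J. signed_term J l (c' (J - {l}))) J"
      using J by simp
  qed
next
  fix r c assume r: "r \<in> carrier R" and c: "c \<in> carrier (C j)"
  show "cech_diff R xs j (r \<odot>\<^bsub>C j\<^esub> c) = r \<odot>\<^bsub>C (Suc j)\<^esub> cech_diff R xs j c"
    unfolding cech_diff_eq C_smult
  proof (intro restrict_ext)
    fix J assume J: "J \<in> idx (Suc j)"
    interpret J: module R "P J" using P_module[OF J] .
    have "(\<Oplus>\<^bsub>P J\<^esub>l\<in>J. signed_term J l ((\<lambda>J\<in>idx j. r \<odot>\<^bsub>P J\<^esub> c J) (J - {l}))) =
        (\<Oplus>\<^bsub>P J\<^esub>l\<in>J. r \<odot>\<^bsub>P J\<^esub> signed_term J l (c (J - {l})))"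
      using signed_term_linear[OF J] C_carrierD[OF c] signed_term_closed[OF J _ c] r
      by (intro J.M.finsum_cong' refl) (auto simp: idx_remove[OF J] linear_map_def additive_map_def)
    also have "\<dots> = r \<odot>\<^bsub>P J\<^esub> (\<Oplus>\<^bsub>P J\<^esub>l\<in>J. signed_term J l (c (J - {l})))"
      using signed_term_closed[OF J _ c] r idx_finite[OF J] by (intro J.finsum_smult_ldistr[symmetric]) auto
    finally show "(\<Oplus>\<^bsub>P J\<^esub>l\<in>J. signed_term J l ((\<lambda>J\<in>idx j. r \<odot>\<^bsub>P J\<^esub> c J) (J - {l}))) =
        r \<odot>\<^bsub>P J\<^esub> (\<lambda>J\<in>idx (Suc j). \<Oplus>\<^bsub>P J\<^esub>l\<in>J. signed_term J l (c (J - {l}))) J"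
      using J by simp
  qed
qed

text \<open>Removing the larger index leaves the number of indices below \<open>k\<close> unchanged,
  while removing \<open>k\<close> lowers the number below \<open>l\<close> by one. The two orders of
  removal therefore carry opposite signs.\<close>

lemma signed_term_antisymmetric:
  assumes J: "J \<in> idx (Suc (Suc j))" and k: "k \<in> J" and l: "l \<in> J" and kl: "k < l"
    and x: "x \<in> carrier (P (J - {k, l}))"
  shows "signed_term J k (signed_term (J - {k}) l x) = \<ominus>\<^bsub>P J\<^esub> signed_term J l (signed_term (J - {l}) k x)"
proof -
  have K: "J - {k} \<in> idx (Suc j)" "J - {l} \<in> idx (Suc j)" using J k l by (auto intro: idx_remove)
  have e: "J - {k} - {l} = J - {k, l}" "J - {l} - {k} = J - {k, l}" by auto
  interpret J: module R "P J" using P_module[OF J] .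
  have r1: "\<rho> (J - {k}) l x \<in> carrier (P (J - {k}))" "\<rho> (J - {l}) k x \<in> carrier (P (J - {l}))"
    using \<rho>_linear[OF K(1), of l] \<rho>_linear[OF K(2), of k] k l kl x
    by (auto simp: linear_map_def additive_map_def e)
  have r2: "\<rho> J k (\<rho> (J - {k}) l x) \<in> carrier (P J)"
    using \<rho>_linear[OF J k] r1 by (auto simp: linear_map_def additive_map_def)
  have n1: "\<rho> J k (\<ominus>\<^bsub>P (J - {k})\<^esub> \<rho> (J - {k}) l x) = \<ominus>\<^bsub>P J\<^esub> \<rho> J k (\<rho> (J - {k}) l x)"
    using \<rho>_linear[OF J k] r1 by (intro additive_map_neg[OF P_abelian[OF K(1)] P_abelian[OF J]]) (auto simp: linear_map_def)
  have n2: "\<rho> J l (\<ominus>\<^bsub>P (J - {l})\<^esub> \<rho> (J - {l}) k x) = \<ominus>\<^bsub>P J\<^esub> \<rho> J l (\<rho> (J - {l}) k x)"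
    using \<rho>_linear[OF J l] r1 by (intro additive_map_neg[OF P_abelian[OF K(2)] P_abelian[OF J]]) (auto simp: linear_map_def)
  have c: "\<rho> J l (\<rho> (J - {l}) k x) = \<rho> J k (\<rho> (J - {k}) l x)"
    using \<rho>_commute[OF J k l _ x] kl by simp
  have s1: "{m \<in> J - {l}. m < k} = {m \<in> J. m < k}" using kl by auto
  have "{m \<in> J. m < l} = insert k {m \<in> J - {k}. m < l}" using k kl by auto
  then have s2: "card {m \<in> J. m < l} = Suc (card {m \<in> J - {k}. m < l})"
    using idx_finite[OF J] by (simp add: card_insert_if)
  show ?thesis
    unfolding signed_term_def s1 s2 using n1 n2 c r2 by auto
qed

text \<open>At each \<open>J\<close> the double sum runs over ordered pairs of distinct indices
  removed from \<open>J\<close>, and it is antisymmetric in the pair.\<close>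

lemma cech_diff_diff:
  assumes c: "c \<in> carrier (C j)"
  shows "cech_diff R xs (Suc j) (cech_diff R xs j c) = \<zero>\<^bsub>C (Suc (Suc j))\<^esub>"
  unfolding cech_diff_eq[of "Suc j"] C_zero
proof (intro restrict_ext)
  fix J assume J: "J \<in> idx (Suc (Suc j))"
  interpret J: module R "P J" using P_module[OF J] .
  have e: "J - {k} - {l} = J - {k, l}" for k l by auto
  let ?T = "\<lambda>k l. signed_term J k (signed_term (J - {k}) l (c (J - {k, l})))"
  have cc: "c (J - {k, l}) \<in> carrier (P (J - {k, l}))" if "k \<in> J" "l \<in> J" "k \<noteq> l" for k l
    using C_carrierD[OF c idx_remove[OF idx_remove[OF J that(1)]], of l] that by (auto simp: e)
  have t: "signed_term (J - {k}) l (c (J - {k, l})) \<in> carrier (P (J - {k}))"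
    if "k \<in> J" "l \<in> J" "k \<noteq> l" for k l
    using signed_term_closed[OF idx_remove[OF J that(1)] _ c, of l] that by (auto simp: e)
  have T: "?T k l \<in> carrier (P J)" if "k \<in> J" "l \<in> J" "k \<noteq> l" for k l
    using signed_term_linear[OF J that(1)] t[OF that] by (auto simp: linear_map_def additive_map_def)
  have "(\<Oplus>\<^bsub>P J\<^esub>k\<in>J. signed_term J k (cech_diff R xs j c (J - {k}))) =
      (\<Oplus>\<^bsub>P J\<^esub>k\<in>J. \<Oplus>\<^bsub>P J\<^esub>l\<in>J - {k}. ?T k l)"
  proof (intro J.M.finsum_cong' refl)
    fix k assume k: "k \<in> J"
    have K: "J - {k} \<in> idx (Suc j)" using idx_remove[OF J k] .
    have "signed_term J k (cech_diff R xs j c (J - {k})) =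
        signed_term J k (\<Oplus>\<^bsub>P (J - {k})\<^esub>l\<in>J - {k}. signed_term (J - {k}) l (c (J - {k, l})))"
      using K by (simp add: cech_diff_eq e)
    also have "\<dots> = (\<Oplus>\<^bsub>P J\<^esub>l\<in>J - {k}. ?T k l)"
      using signed_term_linear[OF J k] t[OF k] idx_finite[OF K]
      by (intro additive_map_finsum[OF P_abelian[OF K] P_abelian[OF J]]) (auto simp: linear_map_def)
    finally show "signed_term J k (cech_diff R xs j c (J - {k})) = (\<Oplus>\<^bsub>P J\<^esub>l\<in>J - {k}. ?T k l)" .
  qed (use T in \<open>auto intro!: J.M.finsum_closed\<close>)
  also have "\<dots> = \<zero>\<^bsub>P J\<^esub>"
  proof (rule J.M.finsum_antisymmetric)
    fix k l assume kl: "k \<in> J" "l \<in> J" "k \<noteq> l"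
    show "?T k l = \<ominus>\<^bsub>P J\<^esub> ?T l k"
    proof (cases "k < l")
      case True
      then show ?thesis using signed_term_antisymmetric[OF J kl(1,2) True cc[OF kl]]
        by (simp add: insert_commute)
    next
      case False
      then have "?T l k = \<ominus>\<^bsub>P J\<^esub> ?T k l"
        using signed_term_antisymmetric[OF J kl(2,1) _ cc[OF kl(2,1)]] kl
        by (simp add: insert_commute)
      then show ?thesis using T[OF kl] by simp
    qed
  qed (use T idx_finite[OF J] in auto)
  finally show "(\<Oplus>\<^bsub>P J\<^esub>k\<in>J. signed_term J k (cech_diff R xs j c (J - {k}))) = \<zero>\<^bsub>P J\<^esub>" .
qed

end

section \<open>Frobenius on the Cech complex\<close>

lemma (in module) add_pow_smult_one:
  "x \<in> carrier M \<Longrightarrow> add_pow M (n::nat) x = (add_pow R n \<one>) \<odot>\<^bsub>M\<^esub> x"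
  by (induction n) (simp_all add: smult_l_distr)

lemma (in algebra) smult_pow:
  assumes "r \<in> carrier R" "x \<in> carrier M"
  shows "(r \<odot>\<^bsub>M\<^esub> x) [^]\<^bsub>M\<^esub> (n::nat) = (r [^] n) \<odot>\<^bsub>M\<^esub> (x [^]\<^bsub>M\<^esub> n)"
proof (induction n)
  case (Suc n)
  have x: "x [^]\<^bsub>M\<^esub> n \<in> carrier M" using assms by simp
  have "(r [^] n \<odot>\<^bsub>M\<^esub> x [^]\<^bsub>M\<^esub> n) \<otimes>\<^bsub>M\<^esub> (r \<odot>\<^bsub>M\<^esub> x) = r [^] n \<odot>\<^bsub>M\<^esub> (x [^]\<^bsub>M\<^esub> n \<otimes>\<^bsub>M\<^esub> (r \<odot>\<^bsub>M\<^esub> x))"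
    using assms x by (intro smult_assoc2) auto
  also have "x [^]\<^bsub>M\<^esub> n \<otimes>\<^bsub>M\<^esub> (r \<odot>\<^bsub>M\<^esub> x) = r \<odot>\<^bsub>M\<^esub> (x [^]\<^bsub>M\<^esub> n \<otimes>\<^bsub>M\<^esub> x)"
    using assms x by (simp add: comm_monoid.m_comm[OF cring.axioms(2)[OF M_cring], of "x [^]\<^bsub>M\<^esub> n"] smult_assoc2)
  finally show ?case using assms x Suc by (simp add: smult_assoc1)
qed simp

locale cech_char_p = cech +
  fixes p :: nat
  assumes p_prime: "Factorial_Ring.prime p" and char: "[p] \<cdot> \<one> = \<zero>"
begin

abbreviation "F \<equiv> cech_frobenius R p xs"

text \<open>The characteristic is inherited by the localization through its \<open>R\<close>-algebra
  structure.\<close>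

lemma P_frobenius_additive:
  assumes J: "J \<in> idx j"
  shows "additive_map (P J) (P J) (\<lambda>y. y [^]\<^bsub>P J\<^esub> p)"
proof -
  interpret J: algebra R "P J" using P_algebra[OF J] .
  have "add_pow (P J) p \<one>\<^bsub>P J\<^esub> = \<zero>\<^bsub>P J\<^esub>"
    using J.add_pow_smult_one[of "\<one>\<^bsub>P J\<^esub>" p] char by simp
  then show ?thesis
    unfolding additive_map_def using cring.freshmans_dream[OF P_cring[OF J] p_prime] by auto
qed

lemma F_additive: "additive_map (C j) (C j) (F j)"
  unfolding additive_map_def
proof (intro conjI ballI funcsetI)
  fix c assume c: "c \<in> carrier (C j)"
  show "F j c \<in> carrier (C j)"
    using P_frobenius_additive C_carrierD[OF c]
    by (auto simp: C_carrier cech_frobenius_def additive_map_def Pi_iff)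
  fix c' assume c': "c' \<in> carrier (C j)"
  show "F j (c \<oplus>\<^bsub>C j\<^esub> c') = F j c \<oplus>\<^bsub>C j\<^esub> F j c'"
    unfolding cech_frobenius_def C_add
    using P_frobenius_additive C_carrierD[OF c] C_carrierD[OF c']
    by (intro restrict_ext) (simp add: additive_map_def)
qed

lemma F_smult:
  assumes "r \<in> carrier R" "c \<in> carrier (C j)"
  shows "F j (r \<odot>\<^bsub>C j\<^esub> c) = (r [^] p) \<odot>\<^bsub>C j\<^esub> F j c"
  unfolding cech_frobenius_def C_smult
  using assms algebra.smult_pow[OF P_algebra] C_carrierD[OF assms(2)]
  by (intro restrict_ext) simp

text \<open>The restriction maps are multiplicative, and the signs pass through the
  \<open>p\<close>-th power because an additive map commutes with negation; this treats
  \<open>p = 2\<close> and odd \<open>p\<close> alike.\<close>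

lemma F_diff:
  assumes c: "c \<in> carrier (C j)"
  shows "F (Suc j) (cech_diff R xs j c) = cech_diff R xs j (F j c)"
  unfolding cech_frobenius_def cech_diff_eq
proof (intro restrict_ext)
  fix J assume J: "J \<in> idx (Suc j)"
  interpret J: algebra R "P J" using P_algebra[OF J] .
  note add = P_frobenius_additive[OF J]
  have st: "signed_term J l (c (J - {l})) [^]\<^bsub>P J\<^esub> p = signed_term J l (c (J - {l}) [^]\<^bsub>P (J - {l})\<^esub> p)"
    if l: "l \<in> J" for l
  proof -
    have x: "c (J - {l}) \<in> carrier (P (J - {l}))" using C_carrierD[OF c idx_remove[OF J l]] .
    have y: "\<rho> J l (c (J - {l})) \<in> carrier (P J)"
      using \<rho>_linear[OF J l] x by (auto simp: linear_map_def additive_map_def)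
    have "(\<ominus>\<^bsub>P J\<^esub> \<rho> J l (c (J - {l}))) [^]\<^bsub>P J\<^esub> p = \<ominus>\<^bsub>P J\<^esub> (\<rho> J l (c (J - {l})) [^]\<^bsub>P J\<^esub> p)"
      using additive_map_neg[OF J.M.abelian_group_axioms J.M.abelian_group_axioms add y] .
    then show ?thesis by (simp add: signed_term_def \<rho>_pow[OF J l x])
  qed
  have "(\<Oplus>\<^bsub>P J\<^esub>l\<in>J. signed_term J l (c (J - {l}))) [^]\<^bsub>P J\<^esub> p =
      (\<Oplus>\<^bsub>P J\<^esub>l\<in>J. signed_term J l (c (J - {l})) [^]\<^bsub>P J\<^esub> p)"
    using additive_map_finsum[OF J.M.abelian_group_axioms J.M.abelian_group_axioms add idx_finite[OF J],
      of "\<lambda>l. signed_term J l (c (J - {l}))"] signed_term_closed[OF J _ c] by simp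
  also have "\<dots> = (\<Oplus>\<^bsub>P J\<^esub>l\<in>J. signed_term J l ((\<lambda>J\<in>idx j. c J [^]\<^bsub>P J\<^esub> p) (J - {l})))"
  proof (rule J.M.finsum_cong')
    fix l assume l: "l \<in> J"
    show "signed_term J l (c (J - {l})) [^]\<^bsub>P J\<^esub> p =
        signed_term J l ((\<lambda>J\<in>idx j. c J [^]\<^bsub>P J\<^esub> p) (J - {l}))"
      using st[OF l] idx_remove[OF J l] by simp
  next
    show "(\<lambda>l. signed_term J l ((\<lambda>J\<in>idx j. c J [^]\<^bsub>P J\<^esub> p) (J - {l}))) \<in> J \<rightarrow> carrier (P J)"
    proof
      fix l assume l: "l \<in> J"
      have "signed_term J l (c (J - {l})) [^]\<^bsub>P J\<^esub> p \<in> carrier (P J)"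
        using signed_term_closed[OF J l c] by simp
      then show "signed_term J l ((\<lambda>J\<in>idx j. c J [^]\<^bsub>P J\<^esub> p) (J - {l})) \<in> carrier (P J)"
        using st[OF l] idx_remove[OF J l] by simp
    qed
  qed simp
  finally show "(\<lambda>J\<in>idx (Suc j). \<Oplus>\<^bsub>P J\<^esub>l\<in>J. signed_term J l (c (J - {l}))) J [^]\<^bsub>P J\<^esub> p =
      (\<Oplus>\<^bsub>P J\<^esub>l\<in>J. signed_term J l ((\<lambda>J\<in>idx j. c J [^]\<^bsub>P J\<^esub> p) (J - {l})))"
    using J by simp
qed

end

text \<open>Translates injectivity of the map on cosets into a trivial kernel on representatives. By
  additivity of \<open>f\<close>, every member of the coset of \<open>c\<close> is sent into
  \<open>N\<close> as soon as \<open>c\<close> is.\<close>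

lemma (in module) inj_on_cosets_imp:
  assumes N: "submodule N R M" and Z: "Z \<subseteq> carrier M" "\<zero>\<^bsub>M\<^esub> \<in> Z"
    and f: "additive_map M M f" and fN: "f ` N \<subseteq> N"
    and inj: "inj_on (\<lambda>A. \<Union>c\<in>A. N +>\<^bsub>M\<^esub> f c) (a_rcosets\<^bsub>M\<lparr>carrier := Z\<rparr>\<^esub> N)"
    and c: "c \<in> Z" "f c \<in> N"
  shows "c \<in> N"
proof -
  have sub: "additive_subgroup N M"
    using N by (simp add: submodule_def additive_subgroup_def)
  interpret N: additive_subgroup N M by fact
  have mem: "N +>\<^bsub>M\<^esub> x = N \<longleftrightarrow> x \<in> N" if "x \<in> carrier M" for x
    using that a_coset_join1[OF _ that] a_coset_join2[OF that] N.a_subgroup by blast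
  have fz: "f x \<in> N" if x: "x \<in> N +>\<^bsub>M\<^esub> y" and "y \<in> Z" and "f y \<in> N" for x y
  proof -
    obtain n where n: "n \<in> N" "x = n \<oplus>\<^bsub>M\<^esub> y" using x unfolding a_r_coset_def' by auto
    then have "f x = f n \<oplus>\<^bsub>M\<^esub> f y" using f \<open>y \<in> Z\<close> Z N.a_subset by (auto simp: additive_map_def)
    then show ?thesis using fN n \<open>f y \<in> N\<close> by auto
  qed
  have U: "(\<Union>x\<in>N +>\<^bsub>M\<^esub> y. N +>\<^bsub>M\<^esub> f x) = N" if y: "y \<in> Z" "f y \<in> N" for y
  proof -
    have "y \<in> N +>\<^bsub>M\<^esub> y" using y Z N.zero_closed unfolding a_r_coset_def' by (auto intro!: bexI[of _ "\<zero>\<^bsub>M\<^esub>"])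
    moreover have "N +>\<^bsub>M\<^esub> f x = N" if "x \<in> N +>\<^bsub>M\<^esub> y" for x
      using fz[OF that y] mem N.a_subset by blast
    ultimately show ?thesis by auto
  qed
  have z: "\<zero>\<^bsub>M\<^esub> \<in> Z" "f \<zero>\<^bsub>M\<^esub> \<in> N"
    using Z additive_map_zero[OF abelian_group_axioms abelian_group_axioms f] by auto
  have cos: "N +>\<^bsub>M\<^esub> y \<in> a_rcosets\<^bsub>M\<lparr>carrier := Z\<rparr>\<^esub> N" if "y \<in> Z" for y
    using that unfolding A_RCOSETS_def' a_r_coset_def' by auto
  \<comment> \<open>The cosets of \<open>c\<close> and of zero have the same image, namely
    \<open>N\<close>.\<close>
  have "N +>\<^bsub>M\<^esub> c = N +>\<^bsub>M\<^esub> \<zero>\<^bsub>M\<^esub>"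
    by (rule inj_onD[OF inj _ cos[OF c(1)] cos[OF z(1)]]) (simp only: U[OF c] U[OF z])
  then show ?thesis using mem[of c] mem[of "\<zero>\<^bsub>M\<^esub>"] c Z by auto
qed

section \<open>Noetherian local rings\<close>

context noetherian_local_ring begin

lemma mm_ideal: "ideal \<mm> R"
  using maximal by (simp add: maximalideal_def)

lemma mm_carrier: "y \<in> \<mm> \<Longrightarrow> y \<in> carrier R"
  by (rule ideal.Icarr[OF mm_ideal])

lemma one_notin_mm: "\<one> \<notin> \<mm>"
  using ideal.one_imp_carrier[OF mm_ideal] maximalideal.I_notcarr[OF maximal] by blast

text \<open>In a Noetherian ring the union of a nonempty chain of ideals belongs to the chain.
  Zorn's lemma then gives an ideal above \<open>I\<close> that is maximal among those avoiding 1,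
  hence a maximal ideal.\<close>

lemma proper_ideal_le_mm:
  assumes I: "ideal I R" and one: "\<one> \<notin> I"
  shows "I \<subseteq> \<mm>"
proof -
  let ?A = "{J. ideal J R \<and> I \<subseteq> J \<and> \<one> \<notin> J}"
  have "\<exists>J\<in>?A. \<forall>K\<in>?A. J \<subseteq> K \<longrightarrow> K = J"
  proof (rule subset_Zorn_nonempty)
    show "?A \<noteq> {}" using assms by blast
    fix C assume C: "C \<noteq> {}" "subset.chain ?A C"
    note C2 = C(2)[unfolded subset_chain_def]
    have CA: "C \<subseteq> ?A" by (rule conjunct1[OF C2])
    then have "C \<subseteq> {J. ideal J R}" by auto
    then have "subset.chain {J. ideal J R} C"
      unfolding subset_chain_def by (rule conjI[OF _ conjunct2[OF C2]])
    then have "\<Union>C \<in> C" by (rule ideal_chain_is_trivial[OF C(1)])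
    then show "\<Union>C \<in> ?A" by (rule subsetD[OF CA])
  qed
  then obtain J where JA: "J \<in> ?A" and max: "\<forall>K\<in>?A. J \<subseteq> K \<longrightarrow> K = J" by (rule bexE)
  from JA have J: "ideal J R" "I \<subseteq> J" "\<one> \<notin> J" by auto
  have "maximalideal J R"
  proof (rule maximalidealI)
    show "carrier R \<noteq> J" using J by auto
    fix K assume K: "ideal K R" "J \<subseteq> K" "K \<subseteq> carrier R"
    show "K = J \<or> K = carrier R"
    proof (cases "\<one> \<in> K")
      case True
      then show ?thesis using ideal.one_imp_carrier[OF K(1)] by simp
    next
      case False
      then have "K \<in> ?A" using J K by auto
      then show ?thesis using max K by simp
    qed
  qed (rule J)
  then show ?thesis using J unique_maximal by blast
qed

text \<open>A nonunit generates a proper ideal, so it lies in \<mm>; adding \<open>r y\<close> would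
  put 1 into \<mm>.\<close>

lemma one_minus_unit:
  assumes r: "r \<in> carrier R" and y: "y \<in> \<mm>"
  shows "\<one> \<ominus> r \<otimes> y \<in> Units R"
proof (rule ccontr)
  interpret M: ideal \<mm> R by (rule mm_ideal)
  have yc: "y \<in> carrier R" by (rule mm_carrier) fact
  let ?a = "\<one> \<ominus> r \<otimes> y"
  have a: "?a \<in> carrier R" using r yc by simp
  assume not: "?a \<notin> Units R"
  then have "\<one> \<notin> PIdl ?a"
    using ideal_eq_carrier_iff[OF a] ideal.one_imp_carrier[OF cgenideal_ideal[OF a]] by blast
  then have "?a \<in> \<mm>"
    using proper_ideal_le_mm[OF cgenideal_ideal[OF a]] cgenideal_self[OF a] by blast
  moreover have "r \<otimes> y \<in> \<mm>" using r y by (rule M.I_l_closed[rotated])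
  ultimately have "?a \<oplus> r \<otimes> y \<in> \<mm>" by (rule M.a_closed)
  also have "?a \<oplus> r \<otimes> y = \<one>" using r yc by (simp add: minus_eq a_assoc l_neg)
  finally show False using one_notin_mm by simp
qed

text \<open>Nakayama's lemma for a cyclic module, in the elementwise form in which the intersection
  theorem uses it.\<close>

lemma absorb_one_minus:
  assumes I: "ideal I R" and r: "r \<in> carrier R" and y: "y \<in> \<mm>" and c: "c \<in> carrier R"
    and mem: "(\<one> \<ominus> r \<otimes> y) \<otimes> c \<in> I"
  shows "c \<in> I"
proof -
  let ?u = "\<one> \<ominus> r \<otimes> y"
  have u: "?u \<in> Units R" by (rule one_minus_unit[OF r y])
  have "c = inv ?u \<otimes> (?u \<otimes> c)" using u c by (simp add: m_assoc[symmetric] Units_closed)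
  also have "\<dots> \<in> I" using ideal.I_l_closed[OF I mem] u by simp
  finally show ?thesis .
qed

lemma ascending_ideals_stabilize:
  fixes f :: "nat \<Rightarrow> 'a set"
  assumes id: "\<And>n. ideal (f n) R" and asc: "\<And>n. f n \<subseteq> f (Suc n)"
  obtains n where "\<And>k. k \<ge> n \<Longrightarrow> f k = f n"
proof -
  have mono: "m \<le> n \<Longrightarrow> f m \<subseteq> f n" for m n using lift_Suc_mono_le[of f, OF asc] by blast
  have "subset.chain {I. ideal I R} (range f)"
    unfolding subset_chain_def
  proof (intro conjI ballI)
    show "range f \<subseteq> {I. ideal I R}" using id by auto
    fix A B assume "A \<in> range f" "B \<in> range f"
    then obtain m n where "A = f m" "B = f n" by blast
    then show "A \<subseteq> B \<or> B \<subseteq> A" using mono[of m n] mono[of n m] nat_le_linear[of m n] by blast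
  qed
  then have "\<Union>(range f) \<in> range f" by (rule ideal_chain_is_trivial[rotated]) simp
  then obtain n where "\<Union>(range f) = f n" by blast
  then have "f k = f n" if "k \<ge> n" for k using mono[OF that] by blast
  then show thesis by (rule that)
qed

lemma colon_ideal:
  assumes I: "ideal I R" and x: "x \<in> carrier R"
  shows "ideal (colon R I {x}) R"
proof -
  interpret I: ideal I R by fact
  show ?thesis
  proof (rule idealI[OF ring_axioms])
    show "subgroup (colon R I {x}) (add_monoid R)"
    proof (rule add.subgroupI)
      show "colon R I {x} \<subseteq> carrier R" by (auto simp: colon_def)
      have "\<zero> \<in> colon R I {x}" using x by (simp add: colon_def)
      then show "colon R I {x} \<noteq> {}" by blast
      fix a b assume a: "a \<in> colon R I {x}" and b: "b \<in> colon R I {x}"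
      show "\<ominus> a \<in> colon R I {x}" using a x by (simp add: colon_def l_minus)
      show "a \<oplus> b \<in> colon R I {x}" using a b x by (simp add: colon_def l_distr)
    qed
    fix a r assume a: "a \<in> colon R I {x}" and r: "r \<in> carrier R"
    have "r \<otimes> (a \<otimes> x) \<in> I" using a r by (simp add: colon_def I.I_l_closed)
    then show "r \<otimes> a \<in> colon R I {x}" using a r x by (simp add: colon_def m_assoc)
    then show "a \<otimes> r \<in> colon R I {x}" using a r by (simp add: colon_def m_comm)
  qed
qed

lemma minus_mult_distrib:
  assumes "p \<in> carrier R" "q \<in> carrier R" "v \<in> carrier R" "w \<in> carrier R"
  shows "(p \<ominus> v \<otimes> q) \<otimes> w = p \<otimes> w \<ominus> q \<otimes> (w \<otimes> v)"
  using assms by (simp add: minus_eq l_distr r_distr l_minus r_minus m_ac)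

text \<open>If \<open>b \<equiv> c\<^sub>N v\<^bsup>N+1\<^esup>\<close> modulo \<open>I\<close> then \<open>c\<^sub>N \<equiv> v c\<^bsub>N+1\<^esub>\<close> modulo the stable value \<open>T\<close> of
  \<open>I : v\<^bsup>N+1\<^esup>\<close>, so the ideals \<open>T + (c\<^sub>N)\<close> ascend.\<close>

lemma principal_krull_intersection:
  assumes A: "A \<subseteq> carrier R" and v: "v \<in> \<mm>"
    and b: "\<And>N. b \<in> Idl (insert (v [^] Suc N) A)"
  shows "b \<in> Idl A"
proof -
  have vc: "v \<in> carrier R" by (rule mm_carrier) fact
  interpret I: ideal "Idl A" R by (rule genideal_ideal[OF A])
  let ?T = "\<lambda>N. colon R (Idl A) {v [^] Suc N}"
  have T_ideal: "ideal (?T N) R" for N using vc by (intro colon_ideal I.is_ideal) simp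
  have "?T N \<subseteq> ?T (Suc N)" for N
  proof
    fix a assume "a \<in> ?T N"
    then have a: "a \<in> carrier R" "v \<otimes> (a \<otimes> v [^] Suc N) \<in> Idl A"
      using vc I.I_l_closed by (auto simp: colon_def)
    moreover have "v \<otimes> (a \<otimes> v [^] Suc N) = a \<otimes> v [^] Suc (Suc N)" using a vc by (simp add: m_ac)
    ultimately show "a \<in> ?T (Suc N)" by (simp add: colon_def)
  qed
  then obtain n where n: "\<And>k. k \<ge> n \<Longrightarrow> ?T k = ?T n"
    using ascending_ideals_stabilize[of ?T, OF T_ideal] by blast
  interpret T: ideal "?T n" R by (rule T_ideal)
  have "\<exists>a c. a \<in> Idl A \<and> c \<in> carrier R \<and> b = a \<oplus> c \<otimes> v [^] Suc N" for N
    by (rule Idl_insert[OF _ A b[of N]]) (use vc in auto)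
  then obtain a c where a: "\<And>N. a N \<in> Idl A" and c: "\<And>N. c N \<in> carrier R"
    and bN: "\<And>N. b = a N \<oplus> c N \<otimes> v [^] Suc N"
    by (metis (lifting))
  have ac: "a N \<in> carrier R" for N using a I.Icarr by blast
  have bc: "b \<in> carrier R" using ac[of 0] c[of 0] vc by (subst bN[of 0]) simp
  have step: "c N \<ominus> v \<otimes> c (Suc N) \<in> ?T n" if N: "N \<ge> n" for N
  proof -
    have diff: "c k \<otimes> v [^] Suc k = b \<ominus> a k" for k
    proof -
      have "c k \<otimes> v [^] Suc k \<in> carrier R" using c vc by simp
      then show ?thesis using ac[of k] by (subst bN[of k]) (simp add: minus_eq a_add_minus_cancel a_assoc)
    qed
    have "(c N \<ominus> v \<otimes> c (Suc N)) \<otimes> v [^] Suc N = c N \<otimes> v [^] Suc N \<ominus> c (Suc N) \<otimes> (v [^] Suc N \<otimes> v)"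
      using c vc by (intro minus_mult_distrib) auto
    also have "v [^] Suc N \<otimes> v = v [^] Suc (Suc N)" by simp
    also have "c N \<otimes> v [^] Suc N \<ominus> c (Suc N) \<otimes> v [^] Suc (Suc N) = b \<ominus> a N \<ominus> (b \<ominus> a (Suc N))"
      by (simp only: diff)
    also have "b \<ominus> a N \<ominus> (b \<ominus> a (Suc N)) = \<ominus> (a N \<ominus> a (Suc N))"
      using ac bc by (intro a_minus_minus_cancel)
    also have "\<dots> \<in> Idl A" unfolding minus_eq by (intro I.a_inv_closed I.a_closed a)
    finally have "(c N \<ominus> v \<otimes> c (Suc N)) \<otimes> v [^] Suc N \<in> Idl A" .
    moreover have "c N \<ominus> v \<otimes> c (Suc N) \<in> carrier R" using c vc by simp
    ultimately have "c N \<ominus> v \<otimes> c (Suc N) \<in> ?T N" unfolding colon_def by blast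
    then show ?thesis using n[OF N] by simp
  qed
  let ?J = "\<lambda>k. Idl (insert (c (n + k)) (?T n))"
  have Tc: "?T n \<subseteq> carrier R" using T.Icarr by blast
  have J_sub: "insert (c (n + k)) (?T n) \<subseteq> carrier R" for k using c Tc by auto
  have J_ideal: "ideal (?J k) R" for k by (rule genideal_ideal[OF J_sub])
  have "?J k \<subseteq> ?J (Suc k)" for k
  proof (rule genideal_minimal[OF J_ideal], rule insert_subsetI)
    interpret J: ideal "?J (Suc k)" R by (rule J_ideal)
    have g: "insert (c (n + Suc k)) (?T n) \<subseteq> ?J (Suc k)" by (rule genideal_self[OF J_sub])
    then show "?T n \<subseteq> ?J (Suc k)" by blast
    have "c (n + k) \<ominus> v \<otimes> c (n + Suc k) \<in> ?J (Suc k)" using step[of "n + k"] g by auto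
    moreover have "v \<otimes> c (n + Suc k) \<in> ?J (Suc k)" using g vc by (intro J.I_l_closed) auto
    ultimately have "c (n + k) \<ominus> v \<otimes> c (n + Suc k) \<oplus> v \<otimes> c (n + Suc k) \<in> ?J (Suc k)"
      by (rule J.a_closed)
    also have "c (n + k) \<ominus> v \<otimes> c (n + Suc k) \<oplus> v \<otimes> c (n + Suc k) = c (n + k)"
      using c[of "n + k"] c[of "n + Suc k"] vc by (simp add: minus_eq a_assoc l_neg)
    finally show "c (n + k) \<in> ?J (Suc k)" .
  qed
  then obtain k where "\<And>i. i \<ge> k \<Longrightarrow> ?J i = ?J k"
    using ascending_ideals_stabilize[of ?J, OF J_ideal] by blast
  then have "c (n + Suc k) \<in> ?J k"
    using genideal_self[OF J_sub, of "Suc k"] le_SucI[OF order_refl, of k] by blast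
  \<comment> \<open>Write \<open>d\<close> for the later coefficient. Stability gives
    \<open>d = t + r c\<close> for the earlier one \<open>c\<close>, while
    \<open>c = s + v d\<close>, with \<open>s\<close> and \<open>t\<close> in the stable colon
    ideal. Hence \<open>(1 - r v) d\<close> lies in that ideal, and so does
    \<open>d\<close>.\<close>
  then obtain t r where t: "t \<in> Idl (?T n)" and r: "r \<in> carrier R"
    and e: "c (n + Suc k) = t \<oplus> r \<otimes> c (n + k)"
    using Idl_insert[OF c Tc] by blast
  have tT: "t \<in> ?T n" using t genideal_minimal[OF T_ideal order_refl] by blast
  define s where "s = c (n + k) \<ominus> v \<otimes> c (n + Suc k)"
  have s: "s \<in> ?T n" unfolding s_def using step[of "n + k"] by simp
  have sc: "s \<in> carrier R" "t \<in> carrier R" using s tT Tc by auto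
  have cs: "c (n + k) = s \<oplus> v \<otimes> c (n + Suc k)"
    unfolding s_def using c[of "n + k"] c[of "n + Suc k"] vc by (simp add: minus_eq a_assoc l_neg)
  let ?d = "c (n + Suc k)"
  have d: "?d \<in> carrier R" by (rule c)
  have "?d = t \<oplus> r \<otimes> (s \<oplus> v \<otimes> ?d)"
    by (subst e) (rule arg_cong[OF cs])
  also have "\<dots> = t \<oplus> r \<otimes> s \<oplus> r \<otimes> v \<otimes> ?d"
    using r vc sc d by (simp add: r_distr a_assoc m_assoc)
  finally have dd: "?d = t \<oplus> r \<otimes> s \<oplus> r \<otimes> v \<otimes> ?d" .
  have "(\<one> \<ominus> r \<otimes> v) \<otimes> ?d = ?d \<ominus> r \<otimes> v \<otimes> ?d"
    using r vc d by (simp add: minus_eq l_distr l_minus)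
  also have "\<dots> = t \<oplus> r \<otimes> s \<oplus> r \<otimes> v \<otimes> ?d \<ominus> r \<otimes> v \<otimes> ?d"
    by (rule arg_cong[OF dd])
  also have "\<dots> = t \<oplus> r \<otimes> s" using r vc sc d by (simp add: minus_eq a_assoc r_neg)
  also have "\<dots> \<in> ?T n" using tT s r by (intro T.a_closed T.I_l_closed)
  finally have "?d \<in> ?T n" by (rule absorb_one_minus[OF T_ideal r v d])
  moreover have "?T (n + Suc k) = ?T n" by (rule n) (rule le_add1)
  ultimately have "?d \<otimes> v [^] Suc (n + Suc k) \<in> Idl A" unfolding colon_def by blast
  then show ?thesis unfolding bN[of "n + Suc k"] using a by (intro I.a_closed)
qed

end

section \<open>Quotient modules and finite length\<close>

lemma (in module) submodule_additive: "submodule N R M \<Longrightarrow> additive_subgroup N M"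
  by (simp add: submodule_def additive_subgroup_def)

lemma (in module) quotient_module_facts:
  assumes N: "submodule N R M"
  shows "carrier (quotient_module M N) = {N +>\<^bsub>M\<^esub> x | x. x \<in> carrier M}"
    and "x \<in> carrier M \<Longrightarrow> y \<in> carrier M \<Longrightarrow>
      (N +>\<^bsub>M\<^esub> x) \<oplus>\<^bsub>quotient_module M N\<^esub> (N +>\<^bsub>M\<^esub> y) = N +>\<^bsub>M\<^esub> (x \<oplus>\<^bsub>M\<^esub> y)"
    and "r \<in> carrier R \<Longrightarrow> x \<in> carrier M \<Longrightarrow>
      r \<odot>\<^bsub>quotient_module M N\<^esub> (N +>\<^bsub>M\<^esub> x) = N +>\<^bsub>M\<^esub> (r \<odot>\<^bsub>M\<^esub> x)"
    and "\<zero>\<^bsub>quotient_module M N\<^esub> = N +>\<^bsub>M\<^esub> \<zero>\<^bsub>M\<^esub>"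
    and "x \<in> carrier M \<Longrightarrow> N +>\<^bsub>M\<^esub> x = N \<longleftrightarrow> x \<in> N"
proof -
  interpret N: additive_subgroup N M by (rule submodule_additive[OF N])
  interpret N: abelian_subgroup N M
    by (rule abelian_subgroupI3) (rule N.additive_subgroup_axioms abelian_group_axioms)+
  show "carrier (quotient_module M N) = {N +>\<^bsub>M\<^esub> x | x. x \<in> carrier M}"
    unfolding quotient_module_def A_RCOSETS_def' by auto
  show "x \<in> carrier M \<Longrightarrow> y \<in> carrier M \<Longrightarrow>
      (N +>\<^bsub>M\<^esub> x) \<oplus>\<^bsub>quotient_module M N\<^esub> (N +>\<^bsub>M\<^esub> y) = N +>\<^bsub>M\<^esub> (x \<oplus>\<^bsub>M\<^esub> y)"
    by (simp add: quotient_module_def N.a_rcos_sum)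
  show mem: "x \<in> carrier M \<Longrightarrow> N +>\<^bsub>M\<^esub> x = N \<longleftrightarrow> x \<in> N" for x
    using a_coset_join1[of N x] a_coset_join2[of x N] N.a_subgroup by blast
  show "\<zero>\<^bsub>quotient_module M N\<^esub> = N +>\<^bsub>M\<^esub> \<zero>\<^bsub>M\<^esub>"
    using mem[of "\<zero>\<^bsub>M\<^esub>"] by (simp add: quotient_module_def)
  show "r \<odot>\<^bsub>quotient_module M N\<^esub> (N +>\<^bsub>M\<^esub> x) = N +>\<^bsub>M\<^esub> (r \<odot>\<^bsub>M\<^esub> x)"
    if r: "r \<in> carrier R" and x: "x \<in> carrier M" for r x
  proof -
    \<comment> \<open>Scalar multiplication on the quotient is a union over the coset; here all
      members of the union are shown equal.\<close>
    have "N +>\<^bsub>M\<^esub> (r \<odot>\<^bsub>M\<^esub> z) = N +>\<^bsub>M\<^esub> (r \<odot>\<^bsub>M\<^esub> x)" if z: "z \<in> N +>\<^bsub>M\<^esub> x" for z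
    proof -
      obtain n where n: "n \<in> N" "z = n \<oplus>\<^bsub>M\<^esub> x" using z unfolding a_r_coset_def' by blast
      have nc: "n \<in> carrier M" using n N.a_subset by blast
      have rn: "r \<odot>\<^bsub>M\<^esub> n \<in> N" using submoduleE(4)[OF N r n(1)] .
      have "N +>\<^bsub>M\<^esub> (r \<odot>\<^bsub>M\<^esub> z) = (N +>\<^bsub>M\<^esub> (r \<odot>\<^bsub>M\<^esub> n)) <+>\<^bsub>M\<^esub> (N +>\<^bsub>M\<^esub> (r \<odot>\<^bsub>M\<^esub> x))"
        using r nc x by (simp add: N.a_rcos_sum n smult_r_distr)
      also have "N +>\<^bsub>M\<^esub> (r \<odot>\<^bsub>M\<^esub> n) = N +>\<^bsub>M\<^esub> \<zero>\<^bsub>M\<^esub>"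
        using mem[of "r \<odot>\<^bsub>M\<^esub> n"] mem[of "\<zero>\<^bsub>M\<^esub>"] rn r nc by simp
      also have "(N +>\<^bsub>M\<^esub> \<zero>\<^bsub>M\<^esub>) <+>\<^bsub>M\<^esub> (N +>\<^bsub>M\<^esub> (r \<odot>\<^bsub>M\<^esub> x)) = N +>\<^bsub>M\<^esub> (r \<odot>\<^bsub>M\<^esub> x)"
        using r x by (simp add: N.a_rcos_sum)
      finally show ?thesis .
    qed
    moreover have "x \<in> N +>\<^bsub>M\<^esub> x" using x by (rule N.a_rcos_self)
    ultimately have "(\<Union>z\<in>N +>\<^bsub>M\<^esub> x. N +>\<^bsub>M\<^esub> (r \<odot>\<^bsub>M\<^esub> z)) = N +>\<^bsub>M\<^esub> (r \<odot>\<^bsub>M\<^esub> x)" by blast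
    then show ?thesis by (simp add: quotient_module_def)
  qed
qed

lemma (in module) quotient_module_module:
  assumes N: "submodule N R M"
  shows "module R (quotient_module M N)"
proof -
  let ?Q = "quotient_module M N" and ?c = "\<lambda>x. N +>\<^bsub>M\<^esub> x"
  note [simp] = quotient_module_facts(2-4)[OF N]
  have cl [simp]: "?c x \<in> carrier ?Q" if "x \<in> carrier M" for x
    using that unfolding quotient_module_facts(1)[OF N] by blast
  have cE: thesis if "A \<in> carrier ?Q" "\<And>x. x \<in> carrier M \<Longrightarrow> A = ?c x \<Longrightarrow> thesis" for A thesis
    using that unfolding quotient_module_facts(1)[OF N] by blast
  show ?thesis
  proof (rule moduleI)
    show "cring R" by (rule is_cring)
    show "abelian_group ?Q"
    proof (rule abelian_groupI)
      fix A B assume "A \<in> carrier ?Q" "B \<in> carrier ?Q"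
      then obtain x y where x: "x \<in> carrier M" "A = ?c x" and y: "y \<in> carrier M" "B = ?c y" by (elim cE)
      show "A \<oplus>\<^bsub>?Q\<^esub> B \<in> carrier ?Q" "A \<oplus>\<^bsub>?Q\<^esub> B = B \<oplus>\<^bsub>?Q\<^esub> A"
        using x y by (simp_all add: M.a_comm)
      fix D assume "D \<in> carrier ?Q"
      then obtain z where "z \<in> carrier M" "D = ?c z" by (elim cE)
      then show "A \<oplus>\<^bsub>?Q\<^esub> B \<oplus>\<^bsub>?Q\<^esub> D = A \<oplus>\<^bsub>?Q\<^esub> (B \<oplus>\<^bsub>?Q\<^esub> D)" using x y by (simp add: M.a_assoc)
    next
      show "\<zero>\<^bsub>?Q\<^esub> \<in> carrier ?Q" by simp
    next
      fix A assume "A \<in> carrier ?Q"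
      then obtain x where x: "x \<in> carrier M" "A = ?c x" by (elim cE)
      then show "\<zero>\<^bsub>?Q\<^esub> \<oplus>\<^bsub>?Q\<^esub> A = A" by simp
      show "\<exists>B\<in>carrier ?Q. B \<oplus>\<^bsub>?Q\<^esub> A = \<zero>\<^bsub>?Q\<^esub>"
        using x by (intro bexI[of _ "?c (\<ominus>\<^bsub>M\<^esub> x)"]) (simp_all add: M.l_neg)
    qed
  next
    fix a A assume a: "a \<in> carrier R" and "A \<in> carrier ?Q"
    then obtain x where x: "x \<in> carrier M" "A = ?c x" by (elim cE)
    then show "a \<odot>\<^bsub>?Q\<^esub> A \<in> carrier ?Q" using a by simp
    fix b assume b: "b \<in> carrier R"
    show "(a \<oplus>\<^bsub>R\<^esub> b) \<odot>\<^bsub>?Q\<^esub> A = a \<odot>\<^bsub>?Q\<^esub> A \<oplus>\<^bsub>?Q\<^esub> b \<odot>\<^bsub>?Q\<^esub> A"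
      "(a \<otimes>\<^bsub>R\<^esub> b) \<odot>\<^bsub>?Q\<^esub> A = a \<odot>\<^bsub>?Q\<^esub> (b \<odot>\<^bsub>?Q\<^esub> A)"
      using a b x by (simp_all add: smult_l_distr smult_assoc1)
  next
    fix a A B assume a: "a \<in> carrier R" and "A \<in> carrier ?Q" "B \<in> carrier ?Q"
    then obtain x y where "x \<in> carrier M" "A = ?c x" "y \<in> carrier M" "B = ?c y" by (elim cE)
    then show "a \<odot>\<^bsub>?Q\<^esub> (A \<oplus>\<^bsub>?Q\<^esub> B) = a \<odot>\<^bsub>?Q\<^esub> A \<oplus>\<^bsub>?Q\<^esub> a \<odot>\<^bsub>?Q\<^esub> B"
      using a by (simp add: smult_r_distr)
  next
    fix A assume "A \<in> carrier ?Q"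
    then obtain x where "x \<in> carrier M" "A = ?c x" by (elim cE)
    then show "\<one>\<^bsub>R\<^esub> \<odot>\<^bsub>?Q\<^esub> A = A" by simp
  qed
qed

text \<open>Nakayama on a simple factor: if \<open>v = y u\<close> were outside \<open>N\<close>,
  then \<open>N\<close> and \<open>v\<close> would generate \<open>N'\<close>, so
  \<open>u = n + r v\<close> and \<open>(1 - r y) u\<close> would lie in \<open>N\<close>. As
  \<open>1 - r y\<close> is a unit, \<open>u\<close> and then \<open>v\<close> would lie in
  \<open>N\<close>.\<close>

lemma (in noetherian_local_ring) simple_step_killed:
  assumes M: "module R H" and N: "submodule N R H" and N': "submodule N' R H" and sub: "N \<subset> N'"
    and simple: "\<not> (\<exists>L. submodule L R H \<and> N \<subset> L \<and> L \<subset> N')"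
    and y: "y \<in> \<mm>" and u: "u \<in> N'"
  shows "y \<odot>\<^bsub>H\<^esub> u \<in> N"
proof (rule ccontr)
  interpret H: module R H by fact
  note N_cl = H.submoduleE(1,4,5,6)[OF N] and N'_cl = H.submoduleE(1,4,5,6)[OF N']
  have zN: "\<zero>\<^bsub>H\<^esub> \<in> N"
    using N by (simp add: submodule_def subgroup_def)
  have yc: "y \<in> carrier R" by (rule mm_carrier) fact
  have uc: "u \<in> carrier H" using u N'_cl by blast
  assume not: "y \<odot>\<^bsub>H\<^esub> u \<notin> N"
  define v where "v = y \<odot>\<^bsub>H\<^esub> u"
  have v: "v \<in> carrier H" "v \<in> N'" "v \<notin> N" using not yc uc u N'_cl by (auto simp: v_def)
  \<comment> \<open>The submodule generated by \<open>N\<close> and \<open>v\<close>, strictly above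
    \<open>N\<close> and inside \<open>N'\<close>.\<close>
  let ?L = "{n \<oplus>\<^bsub>H\<^esub> r \<odot>\<^bsub>H\<^esub> v | n r. n \<in> N \<and> r \<in> carrier R}"
  have nc: "n \<in> carrier H" if "n \<in> N" for n using that N_cl by blast
  have L: "submodule ?L R H"
  proof (rule H.submoduleI)
    show "?L \<subseteq> carrier H" using nc v by auto
    show "\<zero>\<^bsub>H\<^esub> \<in> ?L" using zN v by (intro CollectI exI[of _ "\<zero>\<^bsub>H\<^esub>"] exI[of _ "\<zero>"]) simp
    fix a assume "a \<in> ?L"
    then obtain n r where a: "n \<in> N" "r \<in> carrier R" "a = n \<oplus>\<^bsub>H\<^esub> r \<odot>\<^bsub>H\<^esub> v" by blast
    have "\<ominus>\<^bsub>H\<^esub> a = \<ominus>\<^bsub>H\<^esub> n \<oplus>\<^bsub>H\<^esub> (\<ominus> r) \<odot>\<^bsub>H\<^esub> v"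
      using a nc v by (simp add: H.M.minus_add H.smult_l_minus)
    then show "\<ominus>\<^bsub>H\<^esub> a \<in> ?L" using a(2) N_cl(4)[OF a(1)] by blast
    fix b assume "b \<in> ?L"
    then obtain m s where b: "m \<in> N" "s \<in> carrier R" "b = m \<oplus>\<^bsub>H\<^esub> s \<odot>\<^bsub>H\<^esub> v" by blast
    have "a \<oplus>\<^bsub>H\<^esub> b = (n \<oplus>\<^bsub>H\<^esub> m) \<oplus>\<^bsub>H\<^esub> (r \<oplus> s) \<odot>\<^bsub>H\<^esub> v"
      using a b nc v by (simp add: H.M.a_ac H.smult_l_distr)
    then show "a \<oplus>\<^bsub>H\<^esub> b \<in> ?L" using a(2) b(2) N_cl(3)[OF a(1) b(1)] by blast
  next
    fix t a assume t: "t \<in> carrier R" and "a \<in> ?L"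
    then obtain n r where a: "n \<in> N" "r \<in> carrier R" "a = n \<oplus>\<^bsub>H\<^esub> r \<odot>\<^bsub>H\<^esub> v" by blast
    have "t \<odot>\<^bsub>H\<^esub> a = t \<odot>\<^bsub>H\<^esub> n \<oplus>\<^bsub>H\<^esub> (t \<otimes> r) \<odot>\<^bsub>H\<^esub> v"
      using a nc v t by (simp add: H.smult_r_distr H.smult_assoc1)
    then show "t \<odot>\<^bsub>H\<^esub> a \<in> ?L" using a t N_cl(2)[OF t a(1)] m_closed[OF t a(2)] by blast
  qed
  have vL: "v \<in> ?L" using zN v by (intro CollectI exI[of _ "\<zero>\<^bsub>H\<^esub>"] exI[of _ "\<one>"]) simp
  have "n \<in> ?L" if "n \<in> N" for n
    using that nc[OF that] v by (intro CollectI exI[of _ n] exI[of _ "\<zero>"]) simp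
  then have NL: "N \<subset> ?L" using vL v by blast
  have "?L \<subseteq> N'" using v sub N'_cl(2,3) by auto
  moreover have "\<not> ?L \<subset> N'" using simple L NL by (meson exI conjI)
  ultimately have "?L = N'" by simp
  then have "u \<in> ?L" using u by simp
  then obtain n r where n: "n \<in> N" "r \<in> carrier R" "u = n \<oplus>\<^bsub>H\<^esub> r \<odot>\<^bsub>H\<^esub> v" by blast
  have "(\<one> \<ominus> r \<otimes> y) \<odot>\<^bsub>H\<^esub> u = u \<ominus>\<^bsub>H\<^esub> r \<odot>\<^bsub>H\<^esub> v"
    using n(2) yc uc by (simp add: minus_eq H.M.minus_eq H.smult_l_distr H.smult_l_minus H.smult_assoc1 v_def)
  also have "\<dots> = n"
    using n(2) nc[OF n(1)] v by (subst n(3)) (simp add: H.M.minus_eq H.M.a_assoc H.M.r_neg)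
  finally have e: "(\<one> \<ominus> r \<otimes> y) \<odot>\<^bsub>H\<^esub> u = n" .
  let ?w = "\<one> \<ominus> r \<otimes> y"
  have w: "?w \<in> Units R" by (rule one_minus_unit[OF n(2) y])
  have "u = (inv ?w \<otimes> ?w) \<odot>\<^bsub>H\<^esub> u" using w uc by simp
  also have "\<dots> = inv ?w \<odot>\<^bsub>H\<^esub> n"
    using w uc Units_closed[OF w] Units_inv_closed[OF w] by (subst e[symmetric]) (rule H.smult_assoc1)
  also have "\<dots> \<in> N" using N_cl(2) Units_inv_closed[OF w] n(1) by blast
  finally have "v \<in> N" unfolding v_def using N_cl(2) yc by blast
  then show False using v by simp
qed

text \<open>Each factor \<open>y\<close> descends one step of a composition series, so its length is
  an exponent that serves all \<open>y\<close> and all \<open>u\<close> at once.\<close>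

lemma (in noetherian_local_ring) finite_length_killed:
  assumes M: "module R H" and fl: "finite_length R H"
  shows "\<exists>n::nat. \<forall>y\<in>\<mm>. \<forall>u\<in>carrier H. (y [^] n) \<odot>\<^bsub>H\<^esub> u = \<zero>\<^bsub>H\<^esub>"
proof -
  interpret H: module R H by fact
  obtain n N where N0: "N 0 = {\<zero>\<^bsub>H\<^esub>}" and Nn: "N n = carrier H"
    and sub: "\<forall>i\<le>n. submodule (N i) R H"
    and step: "\<forall>i<n. N i \<subset> N (Suc i) \<and> \<not> (\<exists>L. submodule L R H \<and> N i \<subset> L \<and> L \<subset> N (Suc i))"
    using fl unfolding finite_length_def by (elim exE conjE)
  have "(y [^] k) \<odot>\<^bsub>H\<^esub> u \<in> N (n - k)" if y: "y \<in> \<mm>" and u: "u \<in> carrier H" and "k \<le> n" for y u k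
    using \<open>k \<le> n\<close>
  proof (induction k)
    case 0
    then show ?case using u Nn by simp
  next
    case (Suc k)
    have yc: "y \<in> carrier R" by (rule mm_carrier) fact
    let ?i = "n - Suc k"
    have i: "?i < n" "Suc ?i = n - k" using Suc.prems by auto
    have "y \<odot>\<^bsub>H\<^esub> ((y [^] k) \<odot>\<^bsub>H\<^esub> u) \<in> N ?i"
    proof (rule simple_step_killed[OF M _ _ _ _ y])
      show "submodule (N ?i) R H" "submodule (N (Suc ?i)) R H" using sub i by auto
      show "N ?i \<subset> N (Suc ?i)" "\<not> (\<exists>L. submodule L R H \<and> N ?i \<subset> L \<and> L \<subset> N (Suc ?i))"
        using step i by blast+
      show "(y [^] k) \<odot>\<^bsub>H\<^esub> u \<in> N (Suc ?i)" using Suc i by simp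
    qed
    also have "y \<odot>\<^bsub>H\<^esub> ((y [^] k) \<odot>\<^bsub>H\<^esub> u) = (y [^] Suc k) \<odot>\<^bsub>H\<^esub> u"
      using yc u by (simp add: H.smult_assoc1[symmetric] m_comm)
    finally show ?case .
  qed
  from this[of _ _ n] N0 show ?thesis by (intro exI[of _ n]) auto
qed

section \<open>Koszul complexes over the Cech complex\<close>

text \<open>The Cech complex is reindexed by integers, with the zero module in negative degrees (the Cech
  module in degree \<open>length xs + 1\<close> is zero), and moved to a type of functions on the naturals, on
  which cones can be iterated without changing the type.\<close>

definition cech_degree :: "'a list \<Rightarrow> int \<Rightarrow> nat" where
  "cech_degree xs j = (if j < 0 then Suc (length xs) else nat j)"

definition constant_module :: "('a, 'b) module \<Rightarrow> ('a, nat \<Rightarrow> 'b) module" where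
  "constant_module M =
     \<lparr>carrier = (\<lambda>c _. c) ` carrier M, monoid.mult = undefined, monoid.one = undefined,
      ring.zero = (\<lambda>_. \<zero>\<^bsub>M\<^esub>), ring.add = (\<lambda>u v _. u 0 \<oplus>\<^bsub>M\<^esub> v 0),
      smult = (\<lambda>r u _. r \<odot>\<^bsub>M\<^esub> u 0)\<rparr>"

lemma constant_module_simps:
  "\<zero>\<^bsub>constant_module M\<^esub> = (\<lambda>_. \<zero>\<^bsub>M\<^esub>)"
  "u \<oplus>\<^bsub>constant_module M\<^esub> v = (\<lambda>_. u 0 \<oplus>\<^bsub>M\<^esub> v 0)"
  "r \<odot>\<^bsub>constant_module M\<^esub> u = (\<lambda>_. r \<odot>\<^bsub>M\<^esub> u 0)"
  by (simp_all add: constant_module_def)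

lemma constant_module_carrier:
  "u \<in> carrier (constant_module M) \<longleftrightarrow> u = (\<lambda>_. u 0) \<and> u 0 \<in> carrier M"
  by (auto simp: constant_module_def)

lemma constant_module_module:
  fixes M :: "('a, 'b) module"
  assumes "module R M"
  shows "module R (constant_module M)"
proof -
  interpret module R M by fact
  show ?thesis
  proof (rule moduleI)
    show "abelian_group (constant_module M)"
    proof (rule abelian_groupI)
      fix u assume "u \<in> carrier (constant_module M)"
      then show "\<exists>v\<in>carrier (constant_module M). v \<oplus>\<^bsub>constant_module M\<^esub> u = \<zero>\<^bsub>constant_module M\<^esub>"
        by (intro bexI[of _ "\<lambda>_. \<ominus>\<^bsub>M\<^esub> u 0"])
          (simp_all add: constant_module_carrier constant_module_simps M.l_neg)
    next
      fix u assume "u \<in> carrier (constant_module M)"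
      then show "\<zero>\<^bsub>constant_module M\<^esub> \<oplus>\<^bsub>constant_module M\<^esub> u = u"
        unfolding constant_module_carrier constant_module_simps by (metis M.l_zero)
    qed (simp_all add: constant_module_carrier constant_module_simps M.a_ac)
  next
    fix u assume "u \<in> carrier (constant_module M)"
    then show "\<one>\<^bsub>R\<^esub> \<odot>\<^bsub>constant_module M\<^esub> u = u"
      unfolding constant_module_carrier constant_module_simps by (metis smult_one)
  qed (simp_all add: is_cring constant_module_carrier constant_module_simps smult_l_distr smult_r_distr
      smult_assoc1)
qed

definition total_module ::
  "('a, 'c) ring_scheme \<Rightarrow> 'a list \<Rightarrow> int \<Rightarrow> ('a, nat \<Rightarrow> nat set \<Rightarrow> ('a \<times> 'a) set) module" where
  "total_module R xs j = constant_module (cech_module R xs (cech_degree xs j))"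

definition total_diff ::
  "('a, 'c) ring_scheme \<Rightarrow> 'a list \<Rightarrow> int \<Rightarrow> (nat \<Rightarrow> nat set \<Rightarrow> ('a \<times> 'a) set) \<Rightarrow>
     nat \<Rightarrow> nat set \<Rightarrow> ('a \<times> 'a) set" where
  "total_diff R xs j u =
     (if j < 0 then \<zero>\<^bsub>total_module R xs (j + 1)\<^esub> else (\<lambda>_. cech_diff R xs (nat j) (u 0)))"

section \<open>Cech cohomology as a module, and the reindexed complex\<close>

context cech begin

lemma cocycles_submodule: "submodule (cech_cocycles R xs j) R (C j)"
proof -
  interpret C: module R "C k" for k by (rule C_module)
  note lin = cech_diff_linear[of j]
  have add: "additive_map (C j) (C (Suc j)) (cech_diff R xs j)" using lin by (simp add: linear_map_def)
  note z = additive_map_zero[OF C.M.abelian_group_axioms C.M.abelian_group_axioms add]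
  note n = additive_map_neg[OF C.M.abelian_group_axioms C.M.abelian_group_axioms add]
  have sub: "cech_cocycles R xs j \<subseteq> carrier (C j)" by (auto simp: cech_cocycles_def)
  show ?thesis
  proof (rule C.submoduleI[OF sub])
    show "\<zero>\<^bsub>C j\<^esub> \<in> cech_cocycles R xs j" by (simp add: cech_cocycles_def z)
    fix a assume "a \<in> cech_cocycles R xs j"
    then have a: "a \<in> carrier (C j)" "cech_diff R xs j a = \<zero>\<^bsub>C (Suc j)\<^esub>"
      by (auto simp: cech_cocycles_def)
    show "\<ominus>\<^bsub>C j\<^esub> a \<in> cech_cocycles R xs j"
      using a by (simp add: cech_cocycles_def n C.M.add.inv_one[folded a_inv_def])
    fix b assume "b \<in> cech_cocycles R xs j"
    then have b: "b \<in> carrier (C j)" "cech_diff R xs j b = \<zero>\<^bsub>C (Suc j)\<^esub>"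
      by (auto simp: cech_cocycles_def)
    show "a \<oplus>\<^bsub>C j\<^esub> b \<in> cech_cocycles R xs j"
      using a b add by (simp add: cech_cocycles_def additive_map_def)
  next
    fix r a assume r: "r \<in> carrier R" and "a \<in> cech_cocycles R xs j"
    then have a: "a \<in> carrier (C j)" "cech_diff R xs j a = \<zero>\<^bsub>C (Suc j)\<^esub>"
      by (auto simp: cech_cocycles_def)
    then show "r \<odot>\<^bsub>C j\<^esub> a \<in> cech_cocycles R xs j"
      using r lin by (simp add: cech_cocycles_def linear_map_def)
  qed
qed

lemma coboundaries_submodule: "submodule (cech_coboundaries R xs j) R (C j)"
proof (cases j)
  case 0
  interpret C: module R "C k" for k by (rule C_module)
  show ?thesis unfolding 0
    by (intro C.submoduleI) (auto simp: cech_coboundaries_def C.M.add.inv_one[folded a_inv_def])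
next
  case (Suc i)
  interpret C: module R "C k" for k by (rule C_module)
  note lin = cech_diff_linear[of i]
  have add: "additive_map (C i) (C (Suc i)) (cech_diff R xs i)" using lin by (simp add: linear_map_def)
  note z = additive_map_zero[OF C.M.abelian_group_axioms C.M.abelian_group_axioms add]
  note n = additive_map_neg[OF C.M.abelian_group_axioms C.M.abelian_group_axioms add]
  show ?thesis unfolding Suc
  proof (rule C.submoduleI)
    show "cech_coboundaries R xs (Suc i) \<subseteq> carrier (C (Suc i))"
      using lin by (auto simp: cech_coboundaries_def linear_map_def additive_map_def)
    show "\<zero>\<^bsub>C (Suc i)\<^esub> \<in> cech_coboundaries R xs (Suc i)"
      by (simp add: cech_coboundaries_def flip: z)
    fix a assume "a \<in> cech_coboundaries R xs (Suc i)"
    then obtain c where c: "c \<in> carrier (C i)" "a = cech_diff R xs i c" by (auto simp: cech_coboundaries_def)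
    show "\<ominus>\<^bsub>C (Suc i)\<^esub> a \<in> cech_coboundaries R xs (Suc i)"
      using c by (simp add: cech_coboundaries_def flip: n)
    fix b assume "b \<in> cech_coboundaries R xs (Suc i)"
    then obtain c' where c': "c' \<in> carrier (C i)" "b = cech_diff R xs i c'" by (auto simp: cech_coboundaries_def)
    have "a \<oplus>\<^bsub>C (Suc i)\<^esub> b = cech_diff R xs i (c \<oplus>\<^bsub>C i\<^esub> c')"
      using c c' add by (simp add: additive_map_def)
    then show "a \<oplus>\<^bsub>C (Suc i)\<^esub> b \<in> cech_coboundaries R xs (Suc i)"
      using c c' by (simp add: cech_coboundaries_def)
  next
    fix r a assume r: "r \<in> carrier R" and "a \<in> cech_coboundaries R xs (Suc i)"
    then obtain c where c: "c \<in> carrier (C i)" "a = cech_diff R xs i c" by (auto simp: cech_coboundaries_def)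
    have "r \<odot>\<^bsub>C (Suc i)\<^esub> a = cech_diff R xs i (r \<odot>\<^bsub>C i\<^esub> c)"
      using c r lin by (simp add: linear_map_def)
    then show "r \<odot>\<^bsub>C (Suc i)\<^esub> a \<in> cech_coboundaries R xs (Suc i)"
      using c r by (simp add: cech_coboundaries_def)
  qed
qed

abbreviation "T \<equiv> total_module R xs"
abbreviation "D \<equiv> total_diff R xs"

lemma T_module: "module R (T j)"
  unfolding total_module_def by (rule constant_module_module[OF C_module])

lemma T_carrier: "(\<lambda>_. c) \<in> carrier (T j) \<longleftrightarrow> c \<in> carrier (C (cech_degree xs j))"
  by (simp add: total_module_def constant_module_carrier)

lemma T_cases:
  assumes "u \<in> carrier (T j)"
  obtains c where "u = (\<lambda>_. c)" "c \<in> carrier (C (cech_degree xs j))"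
  using assms unfolding total_module_def constant_module_carrier by metis

lemma T_simps:
  "\<zero>\<^bsub>T j\<^esub> = (\<lambda>_. \<zero>\<^bsub>C (cech_degree xs j)\<^esub>)"
  "u \<oplus>\<^bsub>T j\<^esub> v = (\<lambda>_. u 0 \<oplus>\<^bsub>C (cech_degree xs j)\<^esub> v 0)"
  "r \<odot>\<^bsub>T j\<^esub> u = (\<lambda>_. r \<odot>\<^bsub>C (cech_degree xs j)\<^esub> u 0)"
  by (simp_all add: total_module_def constant_module_simps)

lemma degree_nonneg: "j \<ge> 0 \<Longrightarrow> cech_degree xs j = nat j" "j \<ge> 0 \<Longrightarrow> nat (j + 1) = Suc (nat j)"
  by (auto simp: cech_degree_def)

lemma T_negative: "j < 0 \<Longrightarrow> u \<in> carrier (T j) \<longleftrightarrow> u = \<zero>\<^bsub>T j\<^esub>"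
proof
  assume j: "j < 0" and "u \<in> carrier (T j)"
  have "idx (Suc (length xs)) = {}"
  proof -
    have "card J \<noteq> Suc (length xs)" if "J \<subseteq> {..<length xs}" for J
      using card_mono[OF _ that] by simp
    then show ?thesis unfolding cech_index_def by blast
  qed
  then have "carrier (C (cech_degree xs j)) = {\<lambda>_. undefined}"
    using j by (simp add: cech_degree_def cech_module_def)
  moreover have "\<zero>\<^bsub>C (cech_degree xs j)\<^esub> \<in> carrier (C (cech_degree xs j))"
    by (rule abelian_monoid.zero_closed[OF abelian_group.axioms(1)[OF module.axioms(2)[OF C_module]]])
  moreover obtain c where "u = (\<lambda>_. c)" "c \<in> carrier (C (cech_degree xs j))"
    using \<open>u \<in> carrier (T j)\<close> by (rule T_cases)
  ultimately show "u = \<zero>\<^bsub>T j\<^esub>" unfolding T_simps by simp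
next
  assume "u = \<zero>\<^bsub>T j\<^esub>"
  then show "u \<in> carrier (T j)"
    using abelian_monoid.zero_closed[OF abelian_group.axioms(1)[OF module.axioms(2)[OF T_module]]]
    by simp
qed

lemma T_complex: "cochain_complex R T D"
proof (rule cochain_complex.intro)
  show gr: "graded_module R T"
    by (intro graded_module.intro graded_module_axioms.intro is_cring T_module)
  interpret graded_module R T by (rule gr)
  show "cochain_complex_axioms R T D"
  proof (rule cochain_complex_axioms.intro)
    fix j
    show "linear_map R (T j) (T (j + 1)) (D j)"
    proof (cases "j < 0")
      case True
      then show ?thesis by (simp add: linear_map_def additive_map_def total_diff_def)
    next
      case False
      then show ?thesis
        using cech_diff_linear[of "nat j"]
        unfolding linear_map_def additive_map_def
        by (auto elim!: T_cases simp: total_diff_def T_carrier T_simps degree_nonneg Pi_iff)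
    qed
    fix u assume u: "u \<in> carrier (T j)"
    show "D (j + 1) (D j u) = \<zero>\<^bsub>T (j + 2)\<^esub>"
    proof (cases "j < 0")
      case True
      show ?thesis
      proof (cases "j + 1 < 0")
        case True
        then show ?thesis by (simp add: total_diff_def add.assoc)
      next
        case False
        then have j: "j = - 1" using \<open>j < 0\<close> by simp
        have "cech_diff R xs 0 \<zero>\<^bsub>C 0\<^esub> = \<zero>\<^bsub>C (Suc 0)\<^esub>"
          using cech_diff_linear[of 0]
          by (intro additive_map_zero[OF module.axioms(2)[OF C_module] module.axioms(2)[OF C_module]])
            (simp add: linear_map_def)
        then show ?thesis by (simp add: total_diff_def j T_simps cech_degree_def)
      qed
    next
      case False
      then have e: "nat (j + 1) = Suc (nat j)" "cech_degree xs (j + 2) = Suc (Suc (nat j))"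
        by (auto simp: cech_degree_def)
      show ?thesis
        using u cech_diff_diff[of _ "nat j"] False
        by (auto elim!: T_cases simp: total_diff_def T_simps degree_nonneg e)
    qed
  qed
qed

sublocale T: cochain_complex R T D by (rule T_complex)

lemma T_cocycles: "j \<ge> 0 \<Longrightarrow> (\<lambda>_. c) \<in> T.cocycles j \<longleftrightarrow> c \<in> cech_cocycles R xs (nat j)"
  unfolding T.cocycles_def mem_Collect_eq T_carrier cech_cocycles_def
  by (simp add: total_diff_def T_simps degree_nonneg fun_eq_iff[of "\<lambda>_. _" "\<lambda>_. _"])

text \<open>In degree 0 the coboundaries come from the zero module in degree -1, in agreement with
  the separate case of \<open>cech_coboundaries\<close>.\<close>

lemma T_coboundaries:
  assumes "j \<ge> 0"
  shows "(\<lambda>_. c) \<in> T.coboundaries j \<longleftrightarrow> c \<in> cech_coboundaries R xs (nat j)"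
proof (cases "j = 0")
  case True
  have "(\<lambda>_. c) \<in> T.coboundaries 0 \<longleftrightarrow> (\<lambda>_. c) = \<zero>\<^bsub>T 0\<^esub>"
    unfolding T.coboundaries_def using T.M.zero_closed[of "- 1"] by (auto simp: total_diff_def)
  also have "\<dots> \<longleftrightarrow> c = \<zero>\<^bsub>C 0\<^esub>"
    by (simp add: T_simps degree_nonneg fun_eq_iff[of "\<lambda>_. _" "\<lambda>_. _"])
  finally show ?thesis using True by (simp add: cech_coboundaries_def)
next
  case False
  then obtain k where k: "nat j = Suc k" "nat (j - 1) = k" "cech_degree xs (j - 1) = k" "\<not> j - 1 < 0"
    using assms by (intro that[of "nat (j - 1)"]) (auto simp: cech_degree_def)
  show ?thesis
  proof
    assume "(\<lambda>_. c) \<in> T.coboundaries j"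
    then obtain v where v: "v \<in> carrier (T (j - 1))" "(\<lambda>_. c) = D (j - 1) v" by (rule T.coboundariesE)
    from v(1) obtain b where b: "v = (\<lambda>_. b)" "b \<in> carrier (C k)" unfolding k(3)[symmetric] by (rule T_cases)
    have "c = cech_diff R xs k b" using fun_cong[OF v(2), of 0] k b by (simp add: total_diff_def)
    then show "c \<in> cech_coboundaries R xs (nat j)" using k b by (simp add: cech_coboundaries_def)
  next
    assume "c \<in> cech_coboundaries R xs (nat j)"
    then obtain b where b: "b \<in> carrier (C k)" "c = cech_diff R xs k b"
      using k by (auto simp: cech_coboundaries_def)
    show "(\<lambda>_. c) \<in> T.coboundaries j"
      by (rule T.coboundariesI[of "\<lambda>_. b" "j - 1"]) (use b k in \<open>simp_all add: T_carrier total_diff_def\<close>)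
  qed
qed

lemma coboundaries_subset_cocycles: "cech_coboundaries R xs j \<subseteq> cech_cocycles R xs j"
proof
  fix c assume c: "c \<in> cech_coboundaries R xs j"
  have "(\<lambda>_. c) \<in> T.coboundaries (int j)" using c by (simp add: T_coboundaries)
  then obtain v where v: "v \<in> carrier (T (int j - 1))" "(\<lambda>_. c) = D (int j - 1) v" by (rule T.coboundariesE)
  then have "(\<lambda>_. c) \<in> T.cocycles (int j)" unfolding T.cocycles_def v(2) by simp
  then show "c \<in> cech_cocycles R xs j" by (simp add: T_cocycles)
qed

text \<open>Cohomology is a quotient of the cochain module with its carrier cut down to the
  cocycles, so the coboundaries must be a submodule of that record.\<close>

lemma submodule_of_submodule:
  assumes M: "module R M" and Z: "submodule Z R M" and N: "submodule N R M" and "N \<subseteq> Z"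
  shows "submodule N R (M\<lparr>carrier := Z\<rparr>)"
proof -
  interpret M: module R M by (rule M)
  interpret Z: module R "M\<lparr>carrier := Z\<rparr>" by (rule submodule.submodule_is_module[OF Z M])
  have NM: "module R (M\<lparr>carrier := N\<rparr>)" by (rule submodule.submodule_is_module[OF N M])
  show ?thesis
    by (rule Z.module_incl_imp_submodule) (use assms(4) NM in simp_all)
qed

lemma cohomology_module: "module R (cech_cohomology R xs j)"
  unfolding cech_cohomology_def
  by (intro module.quotient_module_module submodule.submodule_is_module[OF cocycles_submodule C_module]
      submodule_of_submodule[OF C_module cocycles_submodule coboundaries_submodule coboundaries_subset_cocycles])

text \<open>Passes from classes to representatives: the zero class is the set of coboundaries
  itself.\<close>

lemma cohomology_killed:
  assumes y: "y \<in> carrier R"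
    and kill: "\<And>A. A \<in> carrier (cech_cohomology R xs j) \<Longrightarrow>
      y \<odot>\<^bsub>cech_cohomology R xs j\<^esub> A = \<zero>\<^bsub>cech_cohomology R xs j\<^esub>"
    and c: "c \<in> cech_cocycles R xs j"
  shows "y \<odot>\<^bsub>C j\<^esub> c \<in> cech_coboundaries R xs j"
proof -
  let ?Z = "cech_cocycles R xs j" and ?B = "cech_coboundaries R xs j"
  interpret C: module R "C j" by (rule C_module)
  interpret Z: module R "(C j)\<lparr>carrier := ?Z\<rparr>"
    by (rule submodule.submodule_is_module[OF cocycles_submodule C_module])
  note B = submodule_of_submodule[OF C_module cocycles_submodule coboundaries_submodule
      coboundaries_subset_cocycles, of j]
  note facts = Z.quotient_module_facts[OF B, folded cech_cohomology_def]
  have "?B +>\<^bsub>(C j)\<lparr>carrier := ?Z\<rparr>\<^esub> c \<in> carrier (cech_cohomology R xs j)"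
    unfolding facts(1) using c by auto
  then have "y \<odot>\<^bsub>cech_cohomology R xs j\<^esub> (?B +>\<^bsub>(C j)\<lparr>carrier := ?Z\<rparr>\<^esub> c) = \<zero>\<^bsub>cech_cohomology R xs j\<^esub>"
    by (rule kill)
  moreover have "\<zero>\<^bsub>cech_cohomology R xs j\<^esub> = ?B" by (simp add: cech_cohomology_def quotient_module_def)
  ultimately have "?B +>\<^bsub>(C j)\<lparr>carrier := ?Z\<rparr>\<^esub> (y \<odot>\<^bsub>C j\<^esub> c) = ?B"
    using facts(3)[OF y, of c] c by simp
  moreover have "y \<odot>\<^bsub>C j\<^esub> c \<in> ?Z" using C.submoduleE(4)[OF cocycles_submodule y c] .
  ultimately show ?thesis using facts(5)[of "y \<odot>\<^bsub>C j\<^esub> c"] by simp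
qed

end

section \<open>Coefficients that contract the positive Cech degrees, and the ring in degree
  0\<close>

context cech begin

lemma idx_card: "J \<in> idx j \<Longrightarrow> J \<in> idx (card J)"
  by (simp add: cech_index_def)

lemma P_r_distr:
  assumes "J \<in> idx j" "x \<in> carrier (P J)" "y \<in> carrier (P J)" "z \<in> carrier (P J)"
  shows "x \<otimes>\<^bsub>P J\<^esub> (y \<oplus>\<^bsub>P J\<^esub> z) = x \<otimes>\<^bsub>P J\<^esub> y \<oplus>\<^bsub>P J\<^esub> x \<otimes>\<^bsub>P J\<^esub> z"
    and "(y \<oplus>\<^bsub>P J\<^esub> z) \<otimes>\<^bsub>P J\<^esub> x = y \<otimes>\<^bsub>P J\<^esub> x \<oplus>\<^bsub>P J\<^esub> z \<otimes>\<^bsub>P J\<^esub> x"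
proof -
  interpret J: cring "P J" using P_cring[OF assms(1)] .
  show "x \<otimes>\<^bsub>P J\<^esub> (y \<oplus>\<^bsub>P J\<^esub> z) = x \<otimes>\<^bsub>P J\<^esub> y \<oplus>\<^bsub>P J\<^esub> x \<otimes>\<^bsub>P J\<^esub> z"
    "(y \<oplus>\<^bsub>P J\<^esub> z) \<otimes>\<^bsub>P J\<^esub> x = y \<otimes>\<^bsub>P J\<^esub> x \<oplus>\<^bsub>P J\<^esub> z \<otimes>\<^bsub>P J\<^esub> x"
    using assms by (simp_all add: J.r_distr J.l_distr)
qed

text \<open>The factors for different \<open>J\<close> are unrelated, so this map is linear in each
  degree but in general does not commute with the Cech differential. It serves as one of the maps
  \<theta> of the Koszul homotopy.\<close>

definition cech_scale :: "(nat set \<Rightarrow> ('a \<times> 'a) set) \<Rightarrow> int \<Rightarrow> (nat \<Rightarrow> nat set \<Rightarrow> ('a \<times> 'a) set) \<Rightarrow>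
    nat \<Rightarrow> nat set \<Rightarrow> ('a \<times> 'a) set" where
  "cech_scale e j u = (\<lambda>_. \<lambda>J\<in>idx (cech_degree xs j). e J \<otimes>\<^bsub>P J\<^esub> u 0 J)"

lemma cech_scale_linear:
  assumes e: "\<And>J. J \<in> idx (card J) \<Longrightarrow> e J \<in> carrier (P J)"
  shows "linear_map R (T j) (T j) (cech_scale e j)"
  unfolding linear_map_def additive_map_def
proof (intro conjI ballI funcsetI)
  let ?n = "cech_degree xs j"
  have e': "e J \<in> carrier (P J)" if "J \<in> idx ?n" for J using e idx_card[OF that] by blast
  fix u assume "u \<in> carrier (T j)"
  then obtain c where c: "u = (\<lambda>_. c)" "c \<in> carrier (C ?n)" by (rule T_cases)
  have "e J \<otimes>\<^bsub>P J\<^esub> c J \<in> carrier (P J)" if J: "J \<in> idx ?n" for J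
    using monoid.m_closed[OF ring.is_monoid[OF cring.axioms(1)[OF P_cring[OF J]]] e'[OF J] C_carrierD[OF c(2) J]] .
  then show "cech_scale e j u \<in> carrier (T j)"
    unfolding cech_scale_def T_carrier C_carrier by (simp add: c)
  fix v assume "v \<in> carrier (T j)"
  then obtain b where b: "v = (\<lambda>_. b)" "b \<in> carrier (C ?n)" by (rule T_cases)
  have "e J \<otimes>\<^bsub>P J\<^esub> (c J \<oplus>\<^bsub>P J\<^esub> b J) = e J \<otimes>\<^bsub>P J\<^esub> c J \<oplus>\<^bsub>P J\<^esub> e J \<otimes>\<^bsub>P J\<^esub> b J" if J: "J \<in> idx ?n" for J
    by (rule P_r_distr(1)[OF J e'[OF J] C_carrierD[OF c(2) J] C_carrierD[OF b(2) J]])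
  then show "cech_scale e j (u \<oplus>\<^bsub>T j\<^esub> v) = cech_scale e j u \<oplus>\<^bsub>T j\<^esub> cech_scale e j v"
    unfolding cech_scale_def T_simps C_add c(1) b(1)
    by (intro ext) (simp add: restrict_def)
next
  let ?n = "cech_degree xs j"
  fix r u assume r: "r \<in> carrier R" and "u \<in> carrier (T j)"
  then obtain c where c: "u = (\<lambda>_. c)" "c \<in> carrier (C ?n)" by (elim T_cases)
  have "e J \<otimes>\<^bsub>P J\<^esub> (r \<odot>\<^bsub>P J\<^esub> c J) = r \<odot>\<^bsub>P J\<^esub> (e J \<otimes>\<^bsub>P J\<^esub> c J)" if J: "J \<in> idx ?n" for J
  proof -
    interpret J: algebra R "P J" using P_algebra[OF J] .
    have "e J \<in> carrier (P J)" "c J \<in> carrier (P J)" using e idx_card[OF J] C_carrierD[OF c(2) J] by auto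
    then show ?thesis using r
      by (simp add: comm_monoid.m_comm[OF cring.axioms(2)[OF P_cring[OF J]], of "e J"] J.smult_assoc2)
  qed
  then show "cech_scale e j (r \<odot>\<^bsub>T j\<^esub> u) = r \<odot>\<^bsub>T j\<^esub> cech_scale e j u"
    unfolding cech_scale_def T_simps C_smult c(1)
    by (intro ext) (simp add: restrict_def)
qed

fun scale_sum :: "('a \<times> (nat set \<Rightarrow> ('a \<times> 'a) set)) list \<Rightarrow> nat set \<Rightarrow> ('a \<times> 'a) set" where
  "scale_sum [] J = \<zero>\<^bsub>P J\<^esub>"
| "scale_sum ((y, e) # qs) J = scale_sum qs J \<oplus>\<^bsub>P J\<^esub> y \<odot>\<^bsub>P J\<^esub> e J"

text \<open>Membership in \<open>P J\<close> is proved in the same induction because distributivity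
  in \<open>P J\<close> needs it at each step.\<close>

lemma weighted_sum_scale:
  assumes c: "c \<in> carrier (C (cech_degree xs j))"
    and qs: "set (map fst qs) \<subseteq> carrier R" "\<And>e J. e \<in> set (map snd qs) \<Longrightarrow> J \<in> idx (card J) \<Longrightarrow> e J \<in> carrier (P J)"
  shows "weighted_sum T (map (\<lambda>(y, e). (y, cech_scale e)) qs) j (\<lambda>_. c) =
      (\<lambda>_. \<lambda>J\<in>idx (cech_degree xs j). scale_sum qs J \<otimes>\<^bsub>P J\<^esub> c J) \<and>
    (\<forall>J\<in>idx (cech_degree xs j). scale_sum qs J \<in> carrier (P J))"
  using qs
proof (induction qs)
  case Nil
  have "\<zero>\<^bsub>P J\<^esub> \<otimes>\<^bsub>P J\<^esub> c J = \<zero>\<^bsub>P J\<^esub>" "\<zero>\<^bsub>P J\<^esub> \<in> carrier (P J)" if J: "J \<in> idx (cech_degree xs j)" for J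
  proof -
    interpret J: cring "P J" using P_cring[OF J] .
    show "\<zero>\<^bsub>P J\<^esub> \<otimes>\<^bsub>P J\<^esub> c J = \<zero>\<^bsub>P J\<^esub>" using C_carrierD[OF c J] by simp
    show "\<zero>\<^bsub>P J\<^esub> \<in> carrier (P J)" by simp
  qed
  then show ?case by (simp add: T_simps C_zero restrict_def fun_eq_iff)
next
  case (Cons q qs)
  obtain y e where q: "q = (y, e)" by (cases q)
  have y: "y \<in> carrier R" and e: "\<And>J. J \<in> idx (card J) \<Longrightarrow> e J \<in> carrier (P J)"
    using Cons.prems q by auto
  have IH: "weighted_sum T (map (\<lambda>(y, e). (y, cech_scale e)) qs) j (\<lambda>_. c) =
      (\<lambda>_. \<lambda>J\<in>idx (cech_degree xs j). scale_sum qs J \<otimes>\<^bsub>P J\<^esub> c J)"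
    "\<And>J. J \<in> idx (cech_degree xs j) \<Longrightarrow> scale_sum qs J \<in> carrier (P J)"
  proof -
    have "weighted_sum T (map (\<lambda>(y, e). (y, cech_scale e)) qs) j (\<lambda>_. c) =
        (\<lambda>_. \<lambda>J\<in>idx (cech_degree xs j). scale_sum qs J \<otimes>\<^bsub>P J\<^esub> c J) \<and>
      (\<forall>J\<in>idx (cech_degree xs j). scale_sum qs J \<in> carrier (P J))"
      by (rule Cons.IH) (use Cons.prems in auto)
    then show "weighted_sum T (map (\<lambda>(y, e). (y, cech_scale e)) qs) j (\<lambda>_. c) =
        (\<lambda>_. \<lambda>J\<in>idx (cech_degree xs j). scale_sum qs J \<otimes>\<^bsub>P J\<^esub> c J)"
      "\<And>J. J \<in> idx (cech_degree xs j) \<Longrightarrow> scale_sum qs J \<in> carrier (P J)"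
      by blast+
  qed
  have *: "scale_sum qs J \<otimes>\<^bsub>P J\<^esub> c J \<oplus>\<^bsub>P J\<^esub> y \<odot>\<^bsub>P J\<^esub> (e J \<otimes>\<^bsub>P J\<^esub> c J) =
      (scale_sum qs J \<oplus>\<^bsub>P J\<^esub> y \<odot>\<^bsub>P J\<^esub> e J) \<otimes>\<^bsub>P J\<^esub> c J \<and>
      scale_sum qs J \<oplus>\<^bsub>P J\<^esub> y \<odot>\<^bsub>P J\<^esub> e J \<in> carrier (P J)"
    if J: "J \<in> idx (cech_degree xs j)" for J
  proof -
    interpret J: algebra R "P J" using P_algebra[OF J] .
    have cl: "scale_sum qs J \<in> carrier (P J)" "e J \<in> carrier (P J)" "c J \<in> carrier (P J)"
      using IH(2)[OF J] e idx_card[OF J] C_carrierD[OF c J] by auto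
    then show ?thesis using y
      by (simp add: P_r_distr(2)[OF J] J.smult_assoc2)
  qed
  have "weighted_sum T (map (\<lambda>(y, e). (y, cech_scale e)) (q # qs)) j (\<lambda>_. c) =
      weighted_sum T (map (\<lambda>(y, e). (y, cech_scale e)) qs) j (\<lambda>_. c) \<oplus>\<^bsub>T j\<^esub>
        y \<odot>\<^bsub>T j\<^esub> cech_scale e j (\<lambda>_. c)"
    by (simp add: q)
  also have "\<dots> = (\<lambda>_. \<lambda>J\<in>idx (cech_degree xs j). scale_sum (q # qs) J \<otimes>\<^bsub>P J\<^esub> c J)"
    unfolding IH(1) T_simps C_add C_smult using * by (simp add: cech_scale_def q restrict_def fun_eq_iff)
  finally show ?case using * by (simp add: q)
qed

text \<open>Write \<open>a J\<close> as a combination of \<open>ys\<close>; its coefficients divided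
  by the common denominator \<open>s J\<close> are the required factors.\<close>

lemma scale_sum_fraction_exists:
  assumes "set ys \<subseteq> carrier R"
    and "\<And>J. J \<in> idx (card J) \<Longrightarrow> a J \<in> Idl (set ys)"
    and "\<And>J. J \<in> idx (card J) \<Longrightarrow> s J \<in> powers R (cech_elem R xs J)"
  shows "\<exists>qs. map fst qs = ys \<and> (\<forall>e\<in>set (map snd qs). \<forall>J. J \<in> idx (card J) \<longrightarrow> e J \<in> carrier (P J)) \<and>
    (\<forall>J. J \<in> idx (card J) \<longrightarrow> scale_sum qs J = fraction R (powers R (cech_elem R xs J)) (a J) (s J))"
  using assms
proof (induction ys arbitrary: a)
  case Nil
  have "fraction R (powers R (cech_elem R xs J)) (a J) (s J) = \<zero>\<^bsub>P J\<^esub>" if J: "J \<in> idx (card J)" for J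
  proof -
    interpret J: multiplicative_subset R "powers R (cech_elem R xs J)"
      by (rule powers_multiplicative[OF elem_closed[OF J]])
    have "a J = \<zero>" using Nil.prems(2)[OF J] Idl_empty by simp
    then show ?thesis using J.fraction_zero[OF Nil.prems(3)[OF J]] by (simp add: cech_loc_def)
  qed
  then show ?case by simp
next
  case (Cons y ys)
  have y: "y \<in> carrier R" and ys: "set ys \<subseteq> carrier R" using Cons.prems by auto
  have "\<exists>a0 r. J \<in> idx (card J) \<longrightarrow> a0 \<in> Idl (set ys) \<and> r \<in> carrier R \<and> a J = a0 \<oplus> r \<otimes> y" for J
  proof (cases "J \<in> idx (card J)")
    case True
    then have "a J \<in> Idl (insert y (set ys))" using Cons.prems(2) by simp
    then show ?thesis using Idl_insert[OF y ys] by metis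
  qed simp
  then obtain a0 r where ar: "\<And>J. J \<in> idx (card J) \<Longrightarrow> a0 J \<in> Idl (set ys) \<and> r J \<in> carrier R \<and> a J = a0 J \<oplus> r J \<otimes> y"
    by metis
  from Cons.IH[OF ys, of a0] ar Cons.prems(3) obtain qs where qs: "map fst qs = ys"
    "\<forall>e\<in>set (map snd qs). \<forall>J. J \<in> idx (card J) \<longrightarrow> e J \<in> carrier (P J)"
    "\<And>J. J \<in> idx (card J) \<Longrightarrow> scale_sum qs J = fraction R (powers R (cech_elem R xs J)) (a0 J) (s J)"
    by blast
  define e where "e J = fraction R (powers R (cech_elem R xs J)) (r J) (s J)" for J
  have *: "e J \<in> carrier (P J) \<and> scale_sum qs J \<oplus>\<^bsub>P J\<^esub> y \<odot>\<^bsub>P J\<^esub> e J =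
      fraction R (powers R (cech_elem R xs J)) (a J) (s J)" if J: "J \<in> idx (card J)" for J
  proof -
    interpret J: multiplicative_subset R "powers R (cech_elem R xs J)"
      by (rule powers_multiplicative[OF elem_closed[OF J]])
    have a0: "a0 J \<in> carrier R" using ar[OF J] ideal.Icarr[OF genideal_ideal[OF ys]] by blast
    have r: "r J \<in> carrier R" "a J = a0 J \<oplus> r J \<otimes> y" using ar[OF J] by auto
    have s: "s J \<in> powers R (cech_elem R xs J)" using Cons.prems(3)[OF J] .
    have sc: "s J \<in> carrier R" using s by (rule J.S_carrier)
    have "J.frc (a0 J \<otimes> s J \<oplus> (y \<otimes> r J) \<otimes> s J) (s J \<otimes> s J) = J.frc (a J) (s J)"
      by (rule J.fraction_eqI) (use a0 r s sc y in \<open>simp_all add: l_distr r_distr m_ac\<close>)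
    then show ?thesis using a0 r s y by (simp add: e_def cech_loc_def qs(3)[OF J])
  qed
  show ?case
    using * qs(1,2) by (intro exI[of _ "(y, e) # qs"]) auto
qed

text \<open>If \<open>f^N\<close> lies in the ideal of \<open>ys\<close>, then
  \<open>1 = f^N / f^N\<close> is a combination of \<open>ys\<close> in the localization at
  \<open>f\<close>. Doing this for every nonempty \<open>J\<close> makes the weighted sum the
  identity in positive degrees.\<close>

lemma koszul_data_exists:
  assumes ys: "set ys \<subseteq> carrier R"
    and pow: "\<And>J. J \<in> idx (card J) \<Longrightarrow> J \<noteq> {} \<Longrightarrow> \<exists>N::nat. cech_elem R xs J [^] N \<in> Idl (set ys)"
  obtains ps where "map fst ps = ys"
    "\<And>\<theta> j. \<theta> \<in> set (map snd ps) \<Longrightarrow> linear_map R (T j) (T j) (\<theta> j)"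
    "\<And>j u. j > 0 \<Longrightarrow> u \<in> carrier (T j) \<Longrightarrow> weighted_sum T ps j u = u"
proof -
  interpret I: ideal "Idl (set ys)" R by (rule genideal_ideal[OF ys])
  obtain N :: "nat set \<Rightarrow> nat" where N: "\<And>J. J \<in> idx (card J) \<Longrightarrow> J \<noteq> {} \<Longrightarrow> cech_elem R xs J [^] N J \<in> Idl (set ys)"
    using pow by metis
  define s where "s J = cech_elem R xs J [^] N J" for J
  \<comment> \<open>At the empty set the localized element is 1, no power of which need lie in the
    ideal. The value zero is a placeholder there, as that index occurs only in degree 0.\<close>
  define a where "a J = (if J = {} then \<zero> else s J)" for J
  have "a J \<in> Idl (set ys)" if "J \<in> idx (card J)" for J using N[OF that] by (simp add: a_def s_def)
  moreover have "s J \<in> powers R (cech_elem R xs J)" for J by (simp add: s_def power_mem_powers)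
  ultimately obtain qs where qs: "map fst qs = ys"
    "\<forall>e\<in>set (map snd qs). \<forall>J. J \<in> idx (card J) \<longrightarrow> e J \<in> carrier (P J)"
    "\<And>J. J \<in> idx (card J) \<Longrightarrow> scale_sum qs J = fraction R (powers R (cech_elem R xs J)) (a J) (s J)"
    using scale_sum_fraction_exists[OF ys, of a s] by blast
  have one: "scale_sum qs J = \<one>\<^bsub>P J\<^esub>" if J: "J \<in> idx (card J)" "J \<noteq> {}" for J
  proof -
    interpret J: multiplicative_subset R "powers R (cech_elem R xs J)"
      by (rule powers_multiplicative[OF elem_closed[OF J(1)]])
    show ?thesis using qs(3)[OF J(1)] J(2) J.fraction_self[of "s J"]
      by (simp add: a_def s_def power_mem_powers cech_loc_def)
  qed
  let ?ps = "map (\<lambda>(y, e). (y, cech_scale e)) qs"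
  show thesis
  proof (rule that[of ?ps])
    show "map fst ?ps = ys" using qs(1) by (auto simp: case_prod_unfold)
    show "linear_map R (T j) (T j) (\<theta> j)" if "\<theta> \<in> set (map snd ?ps)" for \<theta> j
    proof -
      from that obtain e where "\<theta> = cech_scale e" "e \<in> set (map snd qs)" by force
      then show ?thesis using cech_scale_linear[of e] qs(2) by simp
    qed
    fix j :: int and u assume j: "j > 0" and "u \<in> carrier (T j)"
    then obtain c where c: "u = (\<lambda>_. c)" "c \<in> carrier (C (cech_degree xs j))" by (elim T_cases)
    have ne: "J \<noteq> {}" if "J \<in> idx (cech_degree xs j)" for J
      using that j by (auto simp: cech_index_def cech_degree_def)
    have "weighted_sum T ?ps j u = (\<lambda>_. \<lambda>J\<in>idx (cech_degree xs j). scale_sum qs J \<otimes>\<^bsub>P J\<^esub> c J)"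
      unfolding c(1) using weighted_sum_scale[OF c(2), of qs] qs(1,2) ys by auto
    also have "(\<lambda>J\<in>idx (cech_degree xs j). scale_sum qs J \<otimes>\<^bsub>P J\<^esub> c J) = c"
    proof (rule C_eqI)
      show "c \<in> extensional (idx (cech_degree xs j))" using c(2) by (simp add: C_carrier)
      fix J assume J: "J \<in> idx (cech_degree xs j)"
      interpret J: cring "P J" using P_cring[OF J] .
      show "(\<lambda>J\<in>idx (cech_degree xs j). scale_sum qs J \<otimes>\<^bsub>P J\<^esub> c J) J = c J"
        using J one[OF idx_card[OF J] ne[OF J]] C_carrierD[OF c(2) J] by simp
    qed simp
    finally show "weighted_sum T ?ps j u = u" using c by simp
  qed
qed

text \<open>The only index in degree 0 is the empty set and its product is 1, so the degree 0 term
  is free of rank one on the constant cochain 1. Ring elements can thus be read off from degree 0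
  cochains.\<close>

lemma T_generator:
  obtains \<epsilon> where "\<epsilon> \<in> carrier (T 0)" "\<forall>u\<in>carrier (T 0). \<exists>r\<in>carrier R. u = r \<odot>\<^bsub>T 0\<^esub> \<epsilon>"
    "inj_on (\<lambda>r. r \<odot>\<^bsub>T 0\<^esub> \<epsilon>) (carrier R)"
proof -
  have idx0: "idx 0 = {{}}"
    unfolding cech_index_def by (auto dest: finite_subset)
  have pw: "powers R \<one> = {\<one>}" by (auto simp: powers_def)
  have P: "P {} = localization R {\<one>}" by (simp add: cech_loc_def cech_elem_def pw)
  interpret S: multiplicative_subset R "{\<one>}" by unfold_locales auto
  let ?e = "\<lambda>J\<in>idx 0. S.frc \<one> \<one>"
  have d0: "cech_degree xs 0 = 0" by (simp add: cech_degree_def)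
  have sm: "r \<odot>\<^bsub>T 0\<^esub> (\<lambda>_. ?e) = (\<lambda>_. \<lambda>J\<in>idx 0. S.frc r \<one>)" if "r \<in> carrier R" for r
    using that by (auto simp: T_simps d0 C_smult idx0 P restrict_def fun_eq_iff)
  show thesis
  proof (rule that[of "\<lambda>_. ?e"])
    show "(\<lambda>_. ?e) \<in> carrier (T 0)"
      unfolding T_carrier d0 C_carrier by (simp add: idx0 P)
    show "\<forall>u\<in>carrier (T 0). \<exists>r\<in>carrier R. u = r \<odot>\<^bsub>T 0\<^esub> (\<lambda>_. ?e)"
    proof
      fix u assume "u \<in> carrier (T 0)"
      then obtain c where c: "u = (\<lambda>_. c)" "c \<in> carrier (C 0)" using T_cases[of u 0] unfolding d0 by blast
      have "c {} \<in> carrier (localization R {\<one>})" using C_carrierD[OF c(2), of "{}"] by (simp add: idx0 P)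
      then obtain r where r: "r \<in> carrier R" "c {} = S.frc r \<one>" by (rule S.localizationE) auto
      have "c = (\<lambda>J\<in>idx 0. S.frc r \<one>)"
        by (rule C_eqI[of _ 0]) (use c(2) r in \<open>auto simp: C_carrier idx0\<close>)
      then show "\<exists>r\<in>carrier R. u = r \<odot>\<^bsub>T 0\<^esub> (\<lambda>_. ?e)" using r c sm by auto
    qed
    show "inj_on (\<lambda>r. r \<odot>\<^bsub>T 0\<^esub> (\<lambda>_. ?e)) (carrier R)"
    proof (rule inj_onI)
      fix r s assume r: "r \<in> carrier R" and s: "s \<in> carrier R" and e: "r \<odot>\<^bsub>T 0\<^esub> (\<lambda>_. ?e) = s \<odot>\<^bsub>T 0\<^esub> (\<lambda>_. ?e)"
      have "(\<lambda>J\<in>idx 0. S.frc r \<one>) = (\<lambda>J\<in>idx 0. S.frc s \<one>)" using e unfolding sm[OF r] sm[OF s] by meson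
      then have "S.frc r \<one> = S.frc s \<one>" by (metis idx0 insertI1 restrict_apply')
      then show "r = s" using r s by (simp add: S.fraction_eq_iff)
    qed
  qed
qed

end

section \<open>Annihilators of Cech and Koszul cohomology through Frobenius\<close>

context cech_char_p begin

definition total_frobenius :: "int \<Rightarrow> (nat \<Rightarrow> nat set \<Rightarrow> ('a \<times> 'a) set) \<Rightarrow> nat \<Rightarrow> nat set \<Rightarrow> ('a \<times> 'a) set" where
  "total_frobenius j u = (\<lambda>_. F (cech_degree xs j) (u 0))"

lemma F_closed: "c \<in> carrier (C j) \<Longrightarrow> F j c \<in> carrier (C j)"
  using F_additive by (auto simp: additive_map_def)

lemma F_zero: "F j \<zero>\<^bsub>C j\<^esub> = \<zero>\<^bsub>C j\<^esub>"
  by (rule additive_map_zero[OF module.axioms(2)[OF C_module] module.axioms(2)[OF C_module] F_additive])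

lemma total_frobenius_pair: "frobenius_pair R T D D p total_frobenius"
proof (rule frobenius_pair.intro[OF T_complex T_complex], rule frobenius_pair_axioms.intro)
  fix j
  show "additive_map (T j) (T j) (total_frobenius j)"
    unfolding additive_map_def
    using F_additive[of "cech_degree xs j"]
    by (auto elim!: T_cases simp: total_frobenius_def T_carrier T_simps additive_map_def Pi_iff)
  show "total_frobenius j (r \<odot>\<^bsub>T j\<^esub> u) = (r [^] p) \<odot>\<^bsub>T j\<^esub> total_frobenius j u"
    if "r \<in> carrier R" "u \<in> carrier (T j)" for r u
    using that by (auto elim!: T_cases simp: total_frobenius_def T_simps F_smult)
  show "total_frobenius (j + 1) (D j u) = D j (total_frobenius j u)" if u: "u \<in> carrier (T j)" for u
  proof (cases "j < 0")
    case True
    then show ?thesis by (simp add: total_diff_def total_frobenius_def T_simps F_zero)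
  next
    case False
    obtain c where c: "u = (\<lambda>_. c)" "c \<in> carrier (C (cech_degree xs j))" using u by (rule T_cases)
    then show ?thesis using False
      by (simp add: total_diff_def total_frobenius_def degree_nonneg F_diff)
  qed
qed

lemma F_cocycle: "c \<in> cech_cocycles R xs j \<Longrightarrow> F j c \<in> cech_cocycles R xs j"
  using F_diff[of c j] F_closed[of c j] F_zero[of "Suc j"] by (auto simp: cech_cocycles_def)

lemma F_coboundary: "c \<in> cech_coboundaries R xs j \<Longrightarrow> F j c \<in> cech_coboundaries R xs j"
proof (cases j)
  case 0
  assume "c \<in> cech_coboundaries R xs j"
  then show ?thesis using F_zero[of 0] by (simp add: 0 cech_coboundaries_def)
next
  case (Suc i)
  assume "c \<in> cech_coboundaries R xs j"
  then obtain b where b: "b \<in> carrier (C i)" "c = cech_diff R xs i b"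
    by (auto simp: Suc cech_coboundaries_def)
  then show ?thesis using F_diff[OF b(1)] F_closed[OF b(1)] by (simp add: Suc cech_coboundaries_def)
qed

lemma F_injective_imp:
  assumes inj: "inj_on (cohomology_frobenius R p xs j) (carrier (cech_cohomology R xs j))"
    and c: "c \<in> cech_cocycles R xs j" "F j c \<in> cech_coboundaries R xs j"
  shows "c \<in> cech_coboundaries R xs j"
proof -
  interpret Cj: module R "C j" by (rule C_module)
  show ?thesis
  proof (rule Cj.inj_on_cosets_imp[OF coboundaries_submodule _ _ F_additive _ _ c])
    show "cech_cocycles R xs j \<subseteq> carrier (C j)" by (auto simp: cech_cocycles_def)
    show "\<zero>\<^bsub>C j\<^esub> \<in> cech_cocycles R xs j"
      using cocycles_submodule[of j] by (simp add: submodule_def subgroup_def)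
    show "F j ` cech_coboundaries R xs j \<subseteq> cech_coboundaries R xs j" using F_coboundary by blast
    show "inj_on (\<lambda>A. \<Union>c\<in>A. cech_coboundaries R xs j +>\<^bsub>C j\<^esub> F j c)
        (a_rcosets\<^bsub>(C j)\<lparr>carrier := cech_cocycles R xs j\<rparr>\<^esub> cech_coboundaries R xs j)"
      using inj by (simp add: cohomology_frobenius_def[abs_def] cech_cohomology_def quotient_module_def)
  qed
qed

lemma F_injective_funpow:
  assumes inj: "\<And>c. c \<in> cech_cocycles R xs j \<Longrightarrow> F j c \<in> cech_coboundaries R xs j \<Longrightarrow> c \<in> cech_coboundaries R xs j"
  shows "c \<in> cech_cocycles R xs j \<Longrightarrow> (F j ^^ e) c \<in> cech_coboundaries R xs j \<Longrightarrow> c \<in> cech_coboundaries R xs j"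
proof (induction e arbitrary: c)
  case (Suc e)
  then have "(F j ^^ e) (F j c) \<in> cech_coboundaries R xs j" by (simp add: funpow_swap1)
  then have "F j c \<in> cech_coboundaries R xs j" using Suc.IH F_cocycle Suc.prems(1) by blast
  then show ?case using inj Suc.prems(1) by blast
qed simp

lemma F_funpow_smult:
  assumes "y \<in> carrier R" "c \<in> cech_cocycles R xs j"
  shows "(F j ^^ e) (y \<odot>\<^bsub>C j\<^esub> c) = (y [^] (p ^ e)) \<odot>\<^bsub>C j\<^esub> (F j ^^ e) c \<and> (F j ^^ e) c \<in> cech_cocycles R xs j"
proof (induction e)
  case 0
  then show ?case using assms by simp
next
  case (Suc e)
  have "(F j ^^ e) c \<in> carrier (C j)" using Suc by (simp add: cech_cocycles_def)
  then show ?case using Suc assms F_cocycle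
    by (simp add: F_smult nat_pow_pow mult.commute)
qed

text \<open>Applying Frobenius \<open>N\<close> times turns \<open>y c\<close> into
  \<open>y^(p^N)\<close> times a cocycle, and \<open>p^N \<ge> N\<close> makes this a coboundary.
  Injectivity, iterated \<open>N\<close> times, returns to \<open>y c\<close>.\<close>

lemma frobenius_kills:
  assumes inj: "\<And>c. c \<in> cech_cocycles R xs j \<Longrightarrow> F j c \<in> cech_coboundaries R xs j \<Longrightarrow> c \<in> cech_coboundaries R xs j"
    and kill: "\<And>c. c \<in> cech_cocycles R xs j \<Longrightarrow> (y [^] (N::nat)) \<odot>\<^bsub>C j\<^esub> c \<in> cech_coboundaries R xs j"
    and y: "y \<in> carrier R" and c: "c \<in> cech_cocycles R xs j"
  shows "y \<odot>\<^bsub>C j\<^esub> c \<in> cech_coboundaries R xs j"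
proof (rule F_injective_funpow[OF inj])
  interpret Cj: module R "C j" by (rule C_module)
  show "y \<odot>\<^bsub>C j\<^esub> c \<in> cech_cocycles R xs j" using Cj.submoduleE(4)[OF cocycles_submodule y c] .
  \<comment> \<open>The number \<open>N\<close> of iterations is taken equal to the known exponent;
    the crude bound \<open>N < 2^N\<close> suffices.\<close>
  have "2 ^ N \<le> p ^ N" using prime_ge_2_nat[OF p_prime] by (rule power_mono) simp
  moreover have "N < 2 ^ N" by (rule less_exp)
  ultimately have "N \<le> p ^ N" by linarith
  then obtain q where q: "p ^ N = q + N" by (metis add.commute le_Suc_ex)
  define b where "b = (F j ^^ N) c"
  have b: "b \<in> cech_cocycles R xs j" "(F j ^^ N) (y \<odot>\<^bsub>C j\<^esub> c) = (y [^] (p ^ N)) \<odot>\<^bsub>C j\<^esub> b"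
    using F_funpow_smult[OF y c, of N] by (auto simp: b_def)
  have bc: "b \<in> carrier (C j)" using b by (simp add: cech_cocycles_def)
  have "(y [^] (p ^ N)) \<odot>\<^bsub>C j\<^esub> b = (y [^] q) \<odot>\<^bsub>C j\<^esub> ((y [^] N) \<odot>\<^bsub>C j\<^esub> b)"
    using y bc by (simp add: q nat_pow_mult[symmetric] Cj.smult_assoc1)
  also have "\<dots> \<in> cech_coboundaries R xs j"
    using Cj.submoduleE(4)[OF coboundaries_submodule _ kill[OF b(1)]] y by simp
  finally show "(F j ^^ N) (y \<odot>\<^bsub>C j\<^esub> c) \<in> cech_coboundaries R xs j" using b(2) by simp
qed (rule c | assumption)+

text \<open>Feeds the reindexed Cech complex into the Koszul induction; closure under
  \<open>p\<close>-th powers holds because \<open>I\<close> is an ideal and \<open>p\<close> is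
  positive.\<close>

lemma koszul_killed:
  assumes inj: "\<And>j c. c \<in> cech_cocycles R xs j \<Longrightarrow> F j c \<in> cech_coboundaries R xs j \<Longrightarrow> c \<in> cech_coboundaries R xs j"
    and kill: "\<And>j c y. j < n \<Longrightarrow> y \<in> I \<Longrightarrow> c \<in> cech_cocycles R xs j \<Longrightarrow> y \<odot>\<^bsub>C j\<^esub> c \<in> cech_coboundaries R xs j"
    and I: "ideal I R" and ys: "set ys \<subseteq> I" and j: "j < int n" and y: "y \<in> I"
  shows "cochain_complex.kills_cohomology (koszul_module T (length ys)) (koszul_diff T D ys) y j"
proof -
  interpret I: ideal I R by fact
  interpret Fr: frobenius_pair R T D D p total_frobenius by (rule total_frobenius_pair)
  have p2: "p \<ge> 2" using prime_ge_2_nat[OF p_prime] .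
  have pow: "x [^] p \<in> I" if "x \<in> I" for x
  proof -
    obtain q where "p = Suc q" using p2 by (cases p) auto
    then show ?thesis using that I.Icarr[OF that] I.I_l_closed[of x "x [^] q"] by simp
  qed
  have inj_T: "Fr.injective_on_cohomology i" for i
    unfolding Fr.injective_on_cohomology_def
  proof (intro ballI impI)
    fix u assume u: "u \<in> T.cocycles i" and Fu: "total_frobenius i u \<in> T.coboundaries i"
    have uc: "u \<in> carrier (T i)" using u by (simp add: T.cocycles_def)
    show "u \<in> T.coboundaries i"
    \<comment> \<open>Negative degrees carry the zero module; they have to be covered because a cone
      refers to degree \<open>j - 1\<close>.\<close>
    proof (cases "i < 0")
      case True
      then have "u = \<zero>\<^bsub>T i\<^esub>" using uc T_negative by blast
      then show ?thesis by (intro T.coboundariesI[of "\<zero>\<^bsub>T (i - 1)\<^esub>" "i - 1"]) simp_all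
    next
      case False
      obtain c where c: "u = (\<lambda>_. c)" using uc by (rule T_cases)
      show ?thesis using False u Fu inj[of c "nat i"]
        by (simp add: c T_cocycles T_coboundaries total_frobenius_def degree_nonneg)
    qed
  qed
  have kill_T: "T.kills_cohomology y i" if i: "i < int n" and y: "y \<in> I" for i y
    unfolding T.kills_cohomology_def
  proof
    fix u assume u: "u \<in> T.cocycles i"
    have uc: "u \<in> carrier (T i)" using u by (simp add: T.cocycles_def)
    show "y \<odot>\<^bsub>T i\<^esub> u \<in> T.coboundaries i"
    proof (cases "i < 0")
      case True
      then have "u = \<zero>\<^bsub>T i\<^esub>" using uc T_negative by blast
      then show ?thesis using I.Icarr[OF y]
        by (intro T.coboundariesI[of "\<zero>\<^bsub>T (i - 1)\<^esub>" "i - 1"]) simp_all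
    next
      case False
      obtain c where c: "u = (\<lambda>_. c)" using uc by (rule T_cases)
      show ?thesis using False u i kill[of "nat i" y c] y
        by (simp add: c T_cocycles T_coboundaries T_simps degree_nonneg)
    qed
  qed
  show ?thesis
    using koszul_injective_and_killed[OF total_frobenius_pair p2 _ pow inj_T kill_T ys] j y I.Icarr
    by blast
qed

end

text \<open>The multiples of 1 lie in the domain \<open>K\<close>, so a product of integers that
  vanishes there has a vanishing factor; divisibility by \<open>p\<close> is therefore
  prime.\<close>

lemma (in cring) subfield_char_prime:
  assumes K: "subfield K R" and p: "p > 0" and char: "\<And>n::nat. [n] \<cdot> \<one> = \<zero> \<longleftrightarrow> p dvd n"
  shows "Factorial_Ring.prime p"
proof -
  interpret K: subdomain K R using K by (simp add: subfield_def)
  have mem: "[n] \<cdot> \<one> \<in> K" for n :: nat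
    using subringE(2,3,7)[OF K.subring_axioms] by (induction n) simp_all
  have mult: "[(a * b)] \<cdot> \<one> = [a] \<cdot> \<one> \<otimes> [b] \<cdot> \<one>" for a b :: nat
    by (simp add: add_pow_ldistr add.nat_pow_pow mult.commute)
  have "prime_elem p"
  proof (rule prime_elemI)
    show "p \<noteq> 0" using p by simp
    show "\<not> p dvd 1" using char[of 1] K.sub_one_not_zero by simp
    fix a b assume "p dvd a * b"
    then have "[a] \<cdot> \<one> \<otimes> [b] \<cdot> \<one> = \<zero>" using char[of "a * b"] mult by simp
    then have "[a] \<cdot> \<one> = \<zero> \<or> [b] \<cdot> \<one> = \<zero>" using K.subintegral mem by blast
    then show "p dvd a \<or> p dvd b" using char by simp
  qed
  then show ?thesis by (simp add: prime_def)
qed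

lemma (in cring) Idl_mono: "A \<subseteq> B \<Longrightarrow> B \<subseteq> carrier R \<Longrightarrow> Idl A \<subseteq> Idl B"
  using genideal_minimal[OF genideal_ideal[of B], of A] genideal_self[of B] by blast

lemma (in cring) power_mod_ideal:
  assumes I: "ideal I R" and a: "a \<in> I" and b: "b \<in> carrier R"
  shows "\<exists>c\<in>I. (a \<oplus> b) [^] (k::nat) = c \<oplus> b [^] k"
proof (induction k)
  case 0
  interpret I: ideal I R by fact
  show ?case by (intro bexI[of _ "\<zero>"]) simp_all
next
  case (Suc k)
  interpret I: ideal I R by fact
  obtain c where c: "c \<in> I" "(a \<oplus> b) [^] k = c \<oplus> b [^] k" using Suc by blast
  have ac: "a \<in> carrier R" "c \<in> carrier R" using a c I.Icarr by auto
  have "c \<otimes> (a \<oplus> b) \<oplus> b [^] k \<otimes> a \<in> I"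
    using a b c ac by (intro I.a_closed I.I_r_closed I.I_l_closed) auto
  moreover have "(c \<oplus> b [^] k) \<otimes> (a \<oplus> b) = c \<otimes> (a \<oplus> b) \<oplus> b [^] k \<otimes> a \<oplus> b [^] k \<otimes> b"
    using ac b by (simp add: l_distr r_distr a_ac)
  ultimately show ?case using c by (intro bexI[of _ "c \<otimes> (a \<oplus> b) \<oplus> b [^] k \<otimes> a"]) simp_all
qed

text \<open>From \<open>g^N = a + s v\<close> one gets that \<open>g^(N k)\<close> equals
  \<open>s^k v^k\<close> modulo the ideal of \<open>A\<close>. So replacing a parameter by a power
  preserves the radical condition.\<close>

lemma (in cring) power_in_Idl_insert_pow:
  assumes A: "A \<subseteq> carrier R" and v: "v \<in> carrier R" and g: "g \<in> carrier R"
    and mem: "g [^] (N::nat) \<in> Idl (insert v A)"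
  shows "\<exists>N'::nat. g [^] N' \<in> Idl (insert (v [^] (k::nat)) A)"
proof -
  obtain a s where a: "a \<in> Idl A" and s: "s \<in> carrier R" and e: "g [^] N = a \<oplus> s \<otimes> v"
    using Idl_insert[OF v A mem] by blast
  obtain c where c: "c \<in> Idl A" "(a \<oplus> s \<otimes> v) [^] k = c \<oplus> (s \<otimes> v) [^] k"
    using power_mod_ideal[OF genideal_ideal[OF A] a, of "s \<otimes> v" k] s v by auto
  have "g [^] (N * k) = c \<oplus> s [^] k \<otimes> v [^] k"
    using c(2) g s v by (simp add: nat_pow_pow[symmetric] e nat_pow_distrib)
  then show ?thesis using Idl_insertI[OF _ A c(1), of "v [^] k" "s [^] k"] s v
    by (intro exI[of _ "N * k"]) simp
qed

section \<open>Colon ideals of parameters\<close>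

text \<open>Here \<open>xs\<close> generates \<mm> and defines the Cech complex, while
  \<open>n\<close> is to be the number of parameters. The dimension itself is not mentioned; it acts
  through the range of degrees in \<open>killed\<close>.\<close>

locale buchsbaum_setup = cech_char_p R xs p + noetherian_local_ring R \<mm>
  for R :: "('a, 'c) ring_scheme" (structure) and xs p \<mm> +
  fixes n :: nat
  assumes gens: "Idl (set xs) = \<mm>"
    and F_inj: "c \<in> cech_cocycles R xs j \<Longrightarrow> F j c \<in> cech_coboundaries R xs j \<Longrightarrow> c \<in> cech_coboundaries R xs j"
    and killed: "j < n \<Longrightarrow> y \<in> \<mm> \<Longrightarrow> c \<in> cech_cocycles R xs j \<Longrightarrow> y \<odot>\<^bsub>C j\<^esub> c \<in> cech_coboundaries R xs j"
begin

text \<open>The parameter in question is put at the head, where \<open>koszul_annihilator\<close>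
  expects the element whose relations over the rest are examined.\<close>

lemma colon_last:
  assumes ys: "set (x # ys) \<subseteq> \<mm>" "length (x # ys) = n"
    and rad: "\<And>g. g \<in> \<mm> \<Longrightarrow> \<exists>N::nat. g [^] N \<in> Idl (set (x # ys))"
    and y: "y \<in> \<mm>" and r: "r \<in> carrier R" "r \<otimes> x \<in> Idl (set ys)"
  shows "y \<otimes> r \<in> Idl (set ys)"
proof -
  interpret M: ideal \<mm> R by (rule mm_ideal)
  have ysc: "set (x # ys) \<subseteq> carrier R" using ys mm_carrier by blast
  \<comment> \<open>For nonempty \<open>J\<close> the product contains a generator of \<mm>; the
    radical condition then supplies the powers that the contraction needs.\<close>
  have "cech_elem R xs J \<in> \<mm>" if J: "J \<in> idx (card J)" "J \<noteq> {}" for J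
  proof -
    obtain l where l: "l \<in> J" using J by blast
    then have Jc: "J \<in> idx (Suc (card (J - {l})))"
      using J idx_finite[OF J(1)] by (metis card_Suc_Diff1)
    have "xs ! l \<in> set xs" using J l by (auto simp: cech_index_def)
    then have "xs ! l \<in> \<mm>" using genideal_self[OF xs] gens by blast
    then have "cech_elem R xs (J - {l}) \<otimes> xs ! l \<in> \<mm>"
      using elem_closed[OF idx_remove[OF Jc l]] by (intro M.I_l_closed)
    then show ?thesis using elem_remove[OF J(1) l] by simp
  qed
  then obtain ps where ps: "map fst ps = x # ys"
    "\<And>\<theta> j. \<theta> \<in> set (map snd ps) \<Longrightarrow> linear_map R (T j) (T j) (\<theta> j)"
    "\<And>j u. j > 0 \<Longrightarrow> u \<in> carrier (T j) \<Longrightarrow> weighted_sum T ps j u = u"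
    using koszul_data_exists[OF ysc] rad by blast
  obtain \<epsilon> where \<epsilon>: "\<epsilon> \<in> carrier (T 0)" "\<forall>u\<in>carrier (T 0). \<exists>r\<in>carrier R. u = r \<odot>\<^bsub>T 0\<^esub> \<epsilon>"
    "inj_on (\<lambda>r. r \<odot>\<^bsub>T 0\<^esub> \<epsilon>) (carrier R)"
    by (rule T_generator)
  have neg: "carrier (T (- 1)) = {\<zero>\<^bsub>T (- 1)\<^esub>}" using T_negative[of "- 1"] by auto
  \<comment> \<open>The relevant Koszul degree is \<open>n - 1\<close>, the last one in the range
    where \<mm> kills.\<close>
  have "int (length ys) < int n" using ys(2) by simp
  then have kills: "cochain_complex.kills_cohomology (koszul_module T (Suc (length ys)))
      (koszul_diff T D (x # ys)) y (int (length ys))"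
    using koszul_killed[OF F_inj killed mm_ideal ys(1) _ y] by simp
  show ?thesis
  proof (rule koszul_annihilator[OF T_complex neg \<epsilon>(1) _ _ _ _ ps(1) _ _ kills])
    show "\<exists>r\<in>carrier R. u = r \<odot>\<^bsub>T 0\<^esub> \<epsilon>" if "u \<in> carrier (T 0)" for u using that \<epsilon>(2) by blast
    show "r = s" if "r \<in> carrier R" "s \<in> carrier R" "r \<odot>\<^bsub>T 0\<^esub> \<epsilon> = s \<odot>\<^bsub>T 0\<^esub> \<epsilon>" for r s using that \<epsilon>(3) by (simp add: inj_on_def)
    show "linear_map R (T j) (T j) (\<theta> j)" if "\<theta> \<in> set (map snd ps)" for \<theta> j using that by (rule ps(2))
    show "weighted_sum T ps j u = u" if "j > 0" "u \<in> carrier (T j)" for j u using that by (rule ps(3))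
  qed (use ysc y r mm_carrier in auto)
qed

text \<open>A later parameter is replaced by a power and moved into \<open>us\<close>, which keeps
  the number of parameters and enlarges the ideal containing \<open>r x\<close>. Intersecting over
  all powers removes it again from the conclusion.\<close>

lemma colon_middle:
  assumes "set (x # us @ vs) \<subseteq> \<mm>" "length (x # us @ vs) = n"
    and "\<And>g. g \<in> \<mm> \<Longrightarrow> \<exists>N::nat. g [^] N \<in> Idl (set (x # us @ vs))"
    and y: "y \<in> \<mm>" and r: "r \<in> carrier R" and "r \<otimes> x \<in> Idl (set us)"
  shows "y \<otimes> r \<in> Idl (set us)"
  using assms(1,2,3,6)
proof (induction vs arbitrary: us)
  case Nil
  show ?case by (rule colon_last[OF _ _ _ y r, of x us]) (use Nil in auto)
next
  case (Cons v vs)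
  interpret M: ideal \<mm> R by (rule mm_ideal)
  have v: "v \<in> \<mm>" and us: "set us \<subseteq> carrier R" and vc: "v \<in> carrier R"
    using Cons.prems(1) mm_carrier by auto
  have all: "set (x # us @ vs) \<subseteq> carrier R" using Cons.prems(1) mm_carrier by auto
  show ?case
  proof (rule principal_krull_intersection[OF us v])
    fix N
    let ?w = "v [^] Suc N"
    \<comment> \<open>The exponent is at least 1, so the power is still in \<mm>.\<close>
    have w: "?w \<in> \<mm>" using v vc by (simp add: M.I_l_closed)
    have "y \<otimes> r \<in> Idl (set (us @ [?w]))"
    proof (rule Cons.IH)
      show "set (x # (us @ [?w]) @ vs) \<subseteq> \<mm>" using Cons.prems(1) w by auto
      show "length (x # (us @ [?w]) @ vs) = n" using Cons.prems(2) by simp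
      fix g assume g: "g \<in> \<mm>"
      have 1: "set (x # us @ v # vs) = insert v (set (x # us @ vs))" by auto
      have 2: "set (x # (us @ [?w]) @ vs) = insert ?w (set (x # us @ vs))" by auto
      obtain K :: nat where "g [^] K \<in> Idl (set (x # us @ v # vs))" using Cons.prems(3)[OF g] by blast
      then show "\<exists>N'::nat. g [^] N' \<in> Idl (set (x # (us @ [?w]) @ vs))"
        unfolding 1 2 by (rule power_in_Idl_insert_pow[OF all vc mm_carrier[OF g]])
    next
      have "Idl (set us) \<subseteq> Idl (set (us @ [?w]))" using us w mm_carrier by (intro Idl_mono) auto
      then show "r \<otimes> x \<in> Idl (set (us @ [?w]))" using Cons.prems(4) by blast
    qed
    then show "y \<otimes> r \<in> Idl (insert ?w (set us))" by simp
  qed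
qed

lemma colon_eq:
  assumes zs: "set zs \<subseteq> \<mm>" "length zs = n"
    and rad: "\<And>g. g \<in> \<mm> \<Longrightarrow> \<exists>N::nat. g [^] N \<in> Idl (set zs)"
    and i: "i < length zs"
  shows "colon R (Idl (set (take i zs))) {zs ! i} = colon R (Idl (set (take i zs))) \<mm>"
proof (intro equalityI subsetI)
  fix r assume "r \<in> colon R (Idl (set (take i zs))) {zs ! i}"
  then have r: "r \<in> carrier R" "r \<otimes> zs ! i \<in> Idl (set (take i zs))" by (auto simp: colon_def)
  define x us vs where "x = zs ! i" and "us = take i zs" and "vs = drop (Suc i) zs"
  \<comment> \<open>Length and generated ideal do not depend on the order, so the parameter under
    study may be moved to the front.\<close>
  have z: "zs = us @ x # vs" using id_take_nth_drop[OF i] by (simp add: x_def us_def vs_def)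
  have s: "set (x # us @ vs) = set zs" "length (x # us @ vs) = length zs" unfolding z by auto
  have "r \<otimes> y \<in> Idl (set us)" if y: "y \<in> \<mm>" for y
  proof -
    have "y \<otimes> r \<in> Idl (set us)"
    proof (rule colon_middle[OF _ _ _ y r(1)])
      show "set (x # us @ vs) \<subseteq> \<mm>" "length (x # us @ vs) = n" unfolding s using zs by auto
      show "\<exists>N::nat. g [^] N \<in> Idl (set (x # us @ vs))" if "g \<in> \<mm>" for g unfolding s using rad[OF that] .
      show "r \<otimes> x \<in> Idl (set us)" using r by (simp add: x_def us_def)
    qed
    then show ?thesis using m_comm[OF r(1) mm_carrier[OF y]] by simp
  qed
  then show "r \<in> colon R (Idl (set (take i zs))) \<mm>" using r by (simp add: colon_def us_def)
next
  fix r assume "r \<in> colon R (Idl (set (take i zs))) \<mm>"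
  moreover have "zs ! i \<in> \<mm>" using zs(1) nth_mem[OF i] by blast
  ultimately show "r \<in> colon R (Idl (set (take i zs))) {zs ! i}" by (simp add: colon_def)
qed

end

section \<open>Chosen generators of the maximal ideal, and the conclusion\<close>

lemma (in noetherian_local_ring) ideal_gens_mm:
  "set (ideal_gens R \<mm>) \<subseteq> carrier R" "Idl (set (ideal_gens R \<mm>)) = \<mm>"
proof -
  obtain A where "A \<subseteq> carrier R" "finite A" "\<mm> = Idl A" using finetely_gen[OF mm_ideal] by blast
  then have "\<exists>xs. set xs \<subseteq> carrier R \<and> Idl (set xs) = \<mm>" by (metis finite_list)
  then have "set (ideal_gens R \<mm>) \<subseteq> carrier R \<and> Idl (set (ideal_gens R \<mm>)) = \<mm>"
    unfolding ideal_gens_def by (rule someI_ex)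
  then show "set (ideal_gens R \<mm>) \<subseteq> carrier R" "Idl (set (ideal_gens R \<mm>)) = \<mm>" by auto
qed

theorem corollary1p3:
  fixes R :: "('a, 'c) ring_scheme" and \<mm> :: "'a set" and p :: nat
  assumes "noetherian_local_ring R \<mm>"
    and "p > 0" and "contains_field_of_char R p"
    and "F_injective R \<mm> p"
    and "\<And>i. enat i < krull_dim R \<Longrightarrow> finite_length R (local_cohomology R \<mm> i)"
  shows "buchsbaum_ring R \<mm>"
  unfolding buchsbaum_ring_def
proof (intro conjI allI impI)
  show "noetherian_local_ring R \<mm>" by fact
  interpret noetherian_local_ring R \<mm> by fact
  fix zs i assume sop: "system_of_parameters R \<mm> zs" and i: "i < length zs"
  \<comment> \<open>These are the generators behind \<open>local_cohomology\<close>; they need have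
    no relation to the parameters \<open>zs\<close>.\<close>
  define xs where "xs = ideal_gens R \<mm>"
  obtain K where K: "subfield K R" and char: "\<And>n::nat. [n] \<cdot>\<^bsub>R\<^esub> \<one>\<^bsub>R\<^esub> = \<zero>\<^bsub>R\<^esub> \<longleftrightarrow> p dvd n"
    using assms(3) unfolding contains_field_of_char_def by blast
  interpret cech_char_p R xs p
  proof unfold_locales
    show "set xs \<subseteq> carrier R" unfolding xs_def by (rule ideal_gens_mm)
    show "Factorial_Ring.prime p" by (rule subfield_char_prime[OF K assms(2) char])
    show "[p] \<cdot>\<^bsub>R\<^esub> \<one>\<^bsub>R\<^esub> = \<zero>\<^bsub>R\<^esub>" using char by simp
  qed
  have inj: "c \<in> cech_coboundaries R xs j"
    if "c \<in> cech_cocycles R xs j" "F j c \<in> cech_coboundaries R xs j" for c j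
  proof (rule F_injective_imp[OF _ that])
    show "inj_on (cohomology_frobenius R p xs j) (carrier (cech_cohomology R xs j))"
      using assms(4) unfolding F_injective_def local_cohomology_def local_cohomology_frobenius_def[abs_def] xs_def
      by (auto simp: eta_contract_eq)
  qed
  have len: "enat (length zs) = krull_dim R" and zs: "set zs \<subseteq> \<mm>"
    and rad: "radical R (Idl\<^bsub>R\<^esub> (set zs)) = \<mm>"
    using sop unfolding system_of_parameters_def by auto
  have killed: "y \<odot>\<^bsub>C j\<^esub> c \<in> cech_coboundaries R xs j"
    if j: "j < length zs" and y: "y \<in> \<mm>" and c: "c \<in> cech_cocycles R xs j" for j y c
  proof -
    \<comment> \<open>The dimension enters here: the number of parameters equals it, so finite
      length is available in every degree below that number.\<close>
    have "enat j < krull_dim R" using j by (simp flip: len)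
    then have "finite_length R (cech_cohomology R xs j)"
      using assms(5) unfolding local_cohomology_def xs_def by blast
    then obtain N :: nat where N: "\<forall>y\<in>\<mm>. \<forall>u\<in>carrier (cech_cohomology R xs j).
        (y [^]\<^bsub>R\<^esub> N) \<odot>\<^bsub>cech_cohomology R xs j\<^esub> u = \<zero>\<^bsub>cech_cohomology R xs j\<^esub>"
      using finite_length_killed[OF cohomology_module] by blast
    have yc: "y \<in> carrier R" by (rule mm_carrier[OF y])
    have kN: "(y [^]\<^bsub>R\<^esub> N) \<odot>\<^bsub>C j\<^esub> b \<in> cech_coboundaries R xs j" if "b \<in> cech_cocycles R xs j" for b
      using N y that yc by (intro cohomology_killed) auto
    show ?thesis by (rule frobenius_kills[OF inj kN yc c])
  qed
  interpret buchsbaum_setup R xs p \<mm> "length zs"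
  proof unfold_locales
    show "Idl\<^bsub>R\<^esub> (set xs) = \<mm>" unfolding xs_def by (rule ideal_gens_mm)
  qed (rule inj killed; assumption)+
  show "colon R (Idl\<^bsub>R\<^esub> (set (take i zs))) {zs ! i} = colon R (Idl\<^bsub>R\<^esub> (set (take i zs))) \<mm>"
  proof (rule colon_eq[OF zs refl _ i])
    show "\<exists>N::nat. g [^]\<^bsub>R\<^esub> N \<in> Idl\<^bsub>R\<^esub> (set zs)" if "g \<in> \<mm>" for g
      using that rad unfolding radical_def by blast
  qed
qed

end
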